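(* The dagger rigidification functor $\mathfrak C_\dagger:\mathrm{sSet}^\dagger\to\mathrm{sCat}^\dagger$ does not send all monomorphisms of $\mathrm{sSet}^\dagger$ to cofibrations of the dagger Bergner model structure $\mathrm{sCat}^\dagger_{\mathrm{Bergner}}$: the map $\mathfrak C_\dagger(\partial Q^1\to Q^1)$, which is the map $\mathbf 1_\dagger\to\mathcal E_{\mathrm{sa}}$, is not a cofibration.
   Context: Dagger simplicial sets. A dagger simplicial set is a simplicial set $K$ with $\dagger_K:K\to K^{\mathrm{op}}$ satisfying $\dagger_K^{\mathrm{op}}\dagger_K=\mathrm{id}$ and equal to the identity on vertices; morphisms in $\mathrm{sSet}^\dagger$ are simplicial maps commuting with daggers. $\mathrm{sSet}^\dagger$ is equivalent to presheaves on the category with objects $[n]$ and morphisms the order-preserving or order-reversing maps; let $Q^1$ be the quotient of the representable presheaf on $[1]$ by the $C_2$-action induced by the order reversal of $[1]$, so that $\mathrm{Hom}_{\mathrm{sSet}^\dagger}(Q^1,Z)=\{\sigma\in Z_1\mid\sigma^\dagger=\sigma\}$ (the self-conjugate $1$-simplex). $\partial Q^1\subseteq Q^1$ is the image of the boundary of the representable; it is a single vertex. Dagger simplicial categories. A dagger simplicial category is a small simplicial category $\mathcal C$ with simplicial maps $(-)^\dagger:\mathcal C(x,y)\to\mathcal C(y,x)$ with $(f^\dagger)^\dagger=f$, $\mathrm{id}_x^\dagger=\mathrm{id}_x$, $(gf)^\dagger=f^\dagger g^\dagger$; morphisms in $\mathrm{sCat}^\dagger$ are simplicial functors commuting with daggers.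 $\mathbf 1_\dagger$ is the terminal dagger simplicial category. $\mathcal E_{\mathrm{sa}}$ has one object $x$, $\mathcal E_{\mathrm{sa}}(x,x)=\mathbb N$ (discrete), composition given by addition and identity dagger (the free dagger simplicial category on one self-adjoint endomorphism). $\mathfrak C_\dagger$: let $\mathfrak C$ be the ordinary rigidification functor (left adjoint of the homotopy coherent nerve), with canonical isomorphism $\chi_X:\mathfrak C(X^{\mathrm{op}})\cong\mathfrak C(X)^{\mathrm{op}}$; $\mathfrak C_\dagger(X)$ is $\mathfrak C(X)$ with dagger $\chi_X\circ\mathfrak C(\dagger_X)$. The dagger Bergner model structure $\mathrm{sCat}^\dagger_{\mathrm{Bergner}}$ is a combinatorial model structure on $\mathrm{sCat}^\dagger$ whose trivial fibrations are exactly the dagger simplicial functors that are surjective on objects and induce trivial Kan fibrations on all mapping spaces; hence its cofibrations are exactly the morphisms with the left lifting property against these. *)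

theory Defs
  imports Main "HOL-Library.FuncSet"
begin

section \<open>Simplicial sets\<close>

text \<open>
  A morphism from \<open>[m]\<close> to \<open>[n]\<close> of the simplex category is a function on \<open>nat\<close> of which only
  the values on \<open>{..m}\<close> matter; accordingly \<open>act X m n \<alpha>\<close>, the operator from \<open>n\<close>-simplices to
  \<open>m\<close>-simplices induced by \<open>\<alpha>\<close>, is required to depend only on these values.
\<close>

definition delta_map :: "nat \<Rightarrow> nat \<Rightarrow> (nat \<Rightarrow> nat) \<Rightarrow> bool" where
  "delta_map m n \<alpha> \<longleftrightarrow> (\<forall>i\<le>m. \<alpha> i \<le> n) \<and> (\<forall>i j. i \<le> j \<and> j \<le> m \<longrightarrow> \<alpha> i \<le> \<alpha> j)"

definition delta_antimap :: "nat \<Rightarrow> nat \<Rightarrow> (nat \<Rightarrow> nat) \<Rightarrow> bool" where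
  "delta_antimap m n \<alpha> \<longleftrightarrow> (\<forall>i\<le>m. \<alpha> i \<le> n) \<and> (\<forall>i j. i \<le> j \<and> j \<le> m \<longrightarrow> \<alpha> j \<le> \<alpha> i)"

record 'a sset =
  Simp :: "nat \<Rightarrow> 'a set"
  act :: "nat \<Rightarrow> nat \<Rightarrow> (nat \<Rightarrow> nat) \<Rightarrow> 'a \<Rightarrow> 'a"

locale simplicial_set =
  fixes X :: "('a, 'z) sset_scheme"
  assumes act_closed: "delta_map m n \<alpha> \<Longrightarrow> x \<in> Simp X n \<Longrightarrow> act X m n \<alpha> x \<in> Simp X m"
    and act_cong: "delta_map m n \<alpha> \<Longrightarrow> (\<And>i. i \<le> m \<Longrightarrow> \<alpha> i = \<beta> i) \<Longrightarrow> x \<in> Simp X n \<Longrightarrow>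
      act X m n \<alpha> x = act X m n \<beta> x"
    and act_id: "x \<in> Simp X n \<Longrightarrow> act X n n (\<lambda>i. i) x = x"
    and act_comp: "delta_map k m \<beta> \<Longrightarrow> delta_map m n \<alpha> \<Longrightarrow> x \<in> Simp X n \<Longrightarrow>
      act X k n (\<lambda>i. \<alpha> (\<beta> i)) x = act X k m \<beta> (act X m n \<alpha> x)"

definition simplicial_map ::
  "('a, 'y) sset_scheme \<Rightarrow> ('b, 'z) sset_scheme \<Rightarrow> (nat \<Rightarrow> 'a \<Rightarrow> 'b) \<Rightarrow> bool" where
  "simplicial_map X Y f \<longleftrightarrow> simplicial_set X \<and> simplicial_set Y \<and>
     (\<forall>n. \<forall>x\<in>Simp X n. f n x \<in> Simp Y n) \<and>
     (\<forall>m n \<alpha>. \<forall>x\<in>Simp X n. delta_map m n \<alpha> \<longrightarrow> f m (act X m n \<alpha> x) = act Y m n \<alpha> (f n x))"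

definition op_sset :: "('a, 'z) sset_scheme \<Rightarrow> 'a sset" where
  "op_sset X = \<lparr>Simp = Simp X, act = (\<lambda>m n \<alpha>. act X m n (\<lambda>i. n - \<alpha> (m - i)))\<rparr>"

definition vertex :: "('a, 'z) sset_scheme \<Rightarrow> nat \<Rightarrow> 'a \<Rightarrow> nat \<Rightarrow> 'a" where
  "vertex X n \<sigma> i = act X 0 n (\<lambda>_. i) \<sigma>"

definition std_simplex :: "nat \<Rightarrow> (nat \<Rightarrow> nat) sset" where
  "std_simplex n = \<lparr>Simp = (\<lambda>m. {\<sigma> \<in> extensional {..m}. delta_map m n \<sigma>}),
                    act = (\<lambda>m' m \<alpha> \<sigma>. restrict (\<lambda>i. \<sigma> (\<alpha> i)) {..m'})\<rparr>"

definition std_boundary :: "nat \<Rightarrow> (nat \<Rightarrow> nat) sset" where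
  "std_boundary n = (std_simplex n)
     \<lparr>Simp := (\<lambda>m. {\<sigma> \<in> Simp (std_simplex n) m. \<sigma> ` {..m} \<noteq> {..n}})\<rparr>"

definition trivial_kan_fibration ::
  "('a, 'y) sset_scheme \<Rightarrow> ('b, 'z) sset_scheme \<Rightarrow> (nat \<Rightarrow> 'a \<Rightarrow> 'b) \<Rightarrow> bool" where
  "trivial_kan_fibration X Y p \<longleftrightarrow> simplicial_map X Y p \<and>
     (\<forall>n u v. simplicial_map (std_boundary n) X u \<and> simplicial_map (std_simplex n) Y v \<and>
        (\<forall>k. \<forall>s\<in>Simp (std_boundary n) k. p k (u k s) = v k s) \<longrightarrow>
        (\<exists>w. simplicial_map (std_simplex n) X w \<and>
           (\<forall>k. \<forall>s\<in>Simp (std_boundary n) k. w k s = u k s) \<and>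
           (\<forall>k. \<forall>s\<in>Simp (std_simplex n) k. p k (w k s) = v k s)))"


section \<open>Dagger simplicial sets\<close>

record 'a dsset = "'a sset" +
  dag :: "nat \<Rightarrow> 'a \<Rightarrow> 'a"

locale dagger_simplicial_set = simplicial_set X for X :: "('a, 'z) dsset_scheme" +
  assumes dag_map: "simplicial_map X (op_sset X) (dag X)"
    and dag_dag: "x \<in> Simp X n \<Longrightarrow> dag X n (dag X n x) = x"
    and dag_vertex: "x \<in> Simp X 0 \<Longrightarrow> dag X 0 x = x"

definition dagger_map ::
  "('a, 'y) dsset_scheme \<Rightarrow> ('b, 'z) dsset_scheme \<Rightarrow> (nat \<Rightarrow> 'a \<Rightarrow> 'b) \<Rightarrow> bool" where
  "dagger_map X Y f \<longleftrightarrow> dagger_simplicial_set X \<and> dagger_simplicial_set Y \<and>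
     simplicial_map X Y f \<and> (\<forall>n. \<forall>x\<in>Simp X n. f n (dag X n x) = dag Y n (f n x))"

definition dagger_mono ::
  "('a, 'y) dsset_scheme \<Rightarrow> ('b, 'z) dsset_scheme \<Rightarrow> (nat \<Rightarrow> 'a \<Rightarrow> 'b) \<Rightarrow> bool" where
  "dagger_mono X Y f \<longleftrightarrow> dagger_map X Y f \<and> (\<forall>n. inj_on (f n) (Simp X n))"

text \<open>
  The presheaf represented by \<open>[n]\<close> on the category of monotone and antitone maps; the dagger is
  precomposition with the order reversal.
\<close>

definition dagger_simplex :: "nat \<Rightarrow> (nat \<Rightarrow> nat) dsset" where
  "dagger_simplex n =
     \<lparr>Simp = (\<lambda>m. {\<sigma> \<in> extensional {..m}. delta_map m n \<sigma> \<or> delta_antimap m n \<sigma>}),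
      act = (\<lambda>m' m \<alpha> \<sigma>. restrict (\<lambda>i. \<sigma> (\<alpha> i)) {..m'}),
      dag = (\<lambda>m \<sigma>. restrict (\<lambda>i. \<sigma> (m - i)) {..m})\<rparr>"

definition orbit :: "nat \<Rightarrow> (nat \<Rightarrow> nat) \<Rightarrow> (nat \<Rightarrow> nat) set" where
  "orbit m \<sigma> = {\<sigma>, restrict (\<lambda>i. 1 - \<sigma> i) {..m}}"

definition Q1 :: "(nat \<Rightarrow> nat) set dsset" where
  "Q1 = \<lparr>Simp = (\<lambda>m. orbit m ` Simp (dagger_simplex 1) m),
         act = (\<lambda>m' m \<alpha> c. act (dagger_simplex 1) m' m \<alpha> ` c),
         dag = (\<lambda>m c. dag (dagger_simplex 1) m ` c)\<rparr>"

definition boundary_Q1 :: "(nat \<Rightarrow> nat) set dsset" where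
  "boundary_Q1 =
     Q1\<lparr>Simp := (\<lambda>m. orbit m ` {\<sigma> \<in> Simp (dagger_simplex 1) m. \<sigma> ` {..m} \<noteq> {..1}})\<rparr>"

definition boundary_Q1_incl :: "nat \<Rightarrow> (nat \<Rightarrow> nat) set \<Rightarrow> (nat \<Rightarrow> nat) set" where
  "boundary_Q1_incl m c = c"


section \<open>Simplicial categories\<close>

text \<open>
  \<open>Comp C x y z n g f\<close> is the composite of \<open>f\<close> from \<open>x\<close> to \<open>y\<close> with \<open>g\<close> from \<open>y\<close> to \<open>z\<close> in
  simplicial degree \<open>n\<close>, and \<open>Ident C x\<close> is a vertex of \<open>Hom C x x\<close>.
\<close>

record ('o, 'm) scat =
  Obj :: "'o set"
  Hom :: "'o \<Rightarrow> 'o \<Rightarrow> 'm sset"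
  Comp :: "'o \<Rightarrow> 'o \<Rightarrow> 'o \<Rightarrow> nat \<Rightarrow> 'm \<Rightarrow> 'm \<Rightarrow> 'm"
  Ident :: "'o \<Rightarrow> 'm"

definition ident_at :: "('o, 'm, 'z) scat_scheme \<Rightarrow> 'o \<Rightarrow> nat \<Rightarrow> 'm" where
  "ident_at C x n = act (Hom C x x) n 0 (\<lambda>_. 0) (Ident C x)"

locale simplicial_category =
  fixes C :: "('o, 'm, 'z) scat_scheme"
  assumes Hom_simplicial: "x \<in> Obj C \<Longrightarrow> y \<in> Obj C \<Longrightarrow> simplicial_set (Hom C x y)"
    and Ident_closed: "x \<in> Obj C \<Longrightarrow> Ident C x \<in> Simp (Hom C x x) 0"
    and Comp_closed: "x \<in> Obj C \<Longrightarrow> y \<in> Obj C \<Longrightarrow> z \<in> Obj C \<Longrightarrow>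
      f \<in> Simp (Hom C x y) n \<Longrightarrow> g \<in> Simp (Hom C y z) n \<Longrightarrow>
      Comp C x y z n g f \<in> Simp (Hom C x z) n"
    and Comp_act: "x \<in> Obj C \<Longrightarrow> y \<in> Obj C \<Longrightarrow> z \<in> Obj C \<Longrightarrow> delta_map m n \<alpha> \<Longrightarrow>
      f \<in> Simp (Hom C x y) n \<Longrightarrow> g \<in> Simp (Hom C y z) n \<Longrightarrow>
      act (Hom C x z) m n \<alpha> (Comp C x y z n g f) =
      Comp C x y z m (act (Hom C y z) m n \<alpha> g) (act (Hom C x y) m n \<alpha> f)"
    and Comp_assoc: "x \<in> Obj C \<Longrightarrow> y \<in> Obj C \<Longrightarrow> z \<in> Obj C \<Longrightarrow> w \<in> Obj C \<Longrightarrow>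
      f \<in> Simp (Hom C x y) n \<Longrightarrow> g \<in> Simp (Hom C y z) n \<Longrightarrow> h \<in> Simp (Hom C z w) n \<Longrightarrow>
      Comp C x z w n h (Comp C x y z n g f) = Comp C x y w n (Comp C y z w n h g) f"
    and Comp_ident_right: "x \<in> Obj C \<Longrightarrow> y \<in> Obj C \<Longrightarrow> f \<in> Simp (Hom C x y) n \<Longrightarrow>
      Comp C x x y n f (ident_at C x n) = f"
    and Comp_ident_left: "x \<in> Obj C \<Longrightarrow> y \<in> Obj C \<Longrightarrow> f \<in> Simp (Hom C x y) n \<Longrightarrow>
      Comp C x y y n (ident_at C y n) f = f"

record ('o, 'm, 'p, 'q) sfun =
  fobj :: "'o \<Rightarrow> 'p"
  fhom :: "'o \<Rightarrow> 'o \<Rightarrow> nat \<Rightarrow> 'm \<Rightarrow> 'q"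

definition simplicial_functor ::
  "('o, 'm, 'y) scat_scheme \<Rightarrow> ('p, 'q, 'z) scat_scheme \<Rightarrow> ('o, 'm, 'p, 'q) sfun \<Rightarrow> bool" where
  "simplicial_functor C D F \<longleftrightarrow> simplicial_category C \<and> simplicial_category D \<and>
     (\<forall>x\<in>Obj C. fobj F x \<in> Obj D) \<and>
     (\<forall>x\<in>Obj C. \<forall>y\<in>Obj C.
        simplicial_map (Hom C x y) (Hom D (fobj F x) (fobj F y)) (fhom F x y)) \<and>
     (\<forall>x\<in>Obj C. fhom F x x 0 (Ident C x) = Ident D (fobj F x)) \<and>
     (\<forall>x\<in>Obj C. \<forall>y\<in>Obj C. \<forall>z\<in>Obj C. \<forall>n. \<forall>f\<in>Simp (Hom C x y) n. \<forall>g\<in>Simp (Hom C y z) n.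
        fhom F x z n (Comp C x y z n g f) =
        Comp D (fobj F x) (fobj F y) (fobj F z) n (fhom F y z n g) (fhom F x y n f))"

definition sfun_comp ::
  "('p, 'q, 'r, 's) sfun \<Rightarrow> ('o, 'm, 'p, 'q) sfun \<Rightarrow> ('o, 'm, 'r, 's) sfun" where
  "sfun_comp G F = \<lparr>fobj = (\<lambda>x. fobj G (fobj F x)),
     fhom = (\<lambda>x y n f. fhom G (fobj F x) (fobj F y) n (fhom F x y n f))\<rparr>"

definition sfun_id :: "('o, 'm, 'o, 'm) sfun" where
  "sfun_id = \<lparr>fobj = (\<lambda>x. x), fhom = (\<lambda>_ _ _ f. f)\<rparr>"

definition sfun_eq ::
  "('o, 'm, 'z) scat_scheme \<Rightarrow> ('o, 'm, 'p, 'q) sfun \<Rightarrow> ('o, 'm, 'p, 'q) sfun \<Rightarrow> bool" where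
  "sfun_eq C F G \<longleftrightarrow> (\<forall>x\<in>Obj C. fobj F x = fobj G x) \<and>
     (\<forall>x\<in>Obj C. \<forall>y\<in>Obj C. \<forall>n. \<forall>f\<in>Simp (Hom C x y) n. fhom F x y n f = fhom G x y n f)"

text \<open>Only the direction of composition is reversed, not the mapping spaces.\<close>

definition op_scat :: "('o, 'm, 'z) scat_scheme \<Rightarrow> ('o, 'm) scat" where
  "op_scat C = \<lparr>Obj = Obj C, Hom = (\<lambda>x y. Hom C y x),
     Comp = (\<lambda>x y z n g f. Comp C z y x n f g), Ident = Ident C\<rparr>"


section \<open>Dagger simplicial categories\<close>

record ('o, 'm) dscat = "('o, 'm) scat" +
  Dag :: "'o \<Rightarrow> 'o \<Rightarrow> nat \<Rightarrow> 'm \<Rightarrow> 'm"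

locale dagger_simplicial_category = simplicial_category C
  for C :: "('o, 'm, 'z) dscat_scheme" +
  assumes Dag_map: "x \<in> Obj C \<Longrightarrow> y \<in> Obj C \<Longrightarrow> simplicial_map (Hom C x y) (Hom C y x) (Dag C x y)"
    and Dag_Dag: "x \<in> Obj C \<Longrightarrow> y \<in> Obj C \<Longrightarrow> f \<in> Simp (Hom C x y) n \<Longrightarrow>
      Dag C y x n (Dag C x y n f) = f"
    and Dag_Ident: "x \<in> Obj C \<Longrightarrow> Dag C x x 0 (Ident C x) = Ident C x"
    and Dag_Comp: "x \<in> Obj C \<Longrightarrow> y \<in> Obj C \<Longrightarrow> z \<in> Obj C \<Longrightarrow>
      f \<in> Simp (Hom C x y) n \<Longrightarrow> g \<in> Simp (Hom C y z) n \<Longrightarrow>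
      Dag C x z n (Comp C x y z n g f) = Comp C z y x n (Dag C x y n f) (Dag C y z n g)"

definition dagger_functor ::
  "('o, 'm, 'y) dscat_scheme \<Rightarrow> ('p, 'q, 'z) dscat_scheme \<Rightarrow> ('o, 'm, 'p, 'q) sfun \<Rightarrow> bool" where
  "dagger_functor C D F \<longleftrightarrow>
     dagger_simplicial_category C \<and> dagger_simplicial_category D \<and> simplicial_functor C D F \<and>
     (\<forall>x\<in>Obj C. \<forall>y\<in>Obj C. \<forall>n. \<forall>f\<in>Simp (Hom C x y) n.
        fhom F y x n (Dag C x y n f) = Dag D (fobj F x) (fobj F y) n (fhom F x y n f))"

definition dagger_iso ::
  "('o, 'm, 'y) dscat_scheme \<Rightarrow> ('p, 'q, 'z) dscat_scheme \<Rightarrow> ('o, 'm, 'p, 'q) sfun \<Rightarrow> bool" where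
  "dagger_iso C D F \<longleftrightarrow> dagger_functor C D F \<and>
     (\<exists>G. dagger_functor D C G \<and> sfun_eq C (sfun_comp G F) sfun_id \<and>
          sfun_eq D (sfun_comp F G) sfun_id)"

definition dagger_arrow_iso ::
  "('o, 'm, 'x1) dscat_scheme \<Rightarrow> ('p, 'q, 'x2) dscat_scheme \<Rightarrow> ('o, 'm, 'p, 'q) sfun \<Rightarrow>
   ('o2, 'm2, 'x3) dscat_scheme \<Rightarrow> ('p2, 'q2, 'x4) dscat_scheme \<Rightarrow> ('o2, 'm2, 'p2, 'q2) sfun \<Rightarrow>
   bool" where
  "dagger_arrow_iso A B F A' B' F' \<longleftrightarrow> dagger_functor A B F \<and> dagger_functor A' B' F' \<and>
     (\<exists>\<Phi> \<Psi>. dagger_iso A A' \<Phi> \<and> dagger_iso B B' \<Psi> \<and>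
        sfun_eq A (sfun_comp \<Psi> F) (sfun_comp F' \<Phi>))"

definition dagger_trivial_fibration ::
  "('o, 'm, 'y) dscat_scheme \<Rightarrow> ('p, 'q, 'z) dscat_scheme \<Rightarrow> ('o, 'm, 'p, 'q) sfun \<Rightarrow> bool" where
  "dagger_trivial_fibration C D F \<longleftrightarrow> dagger_functor C D F \<and> fobj F ` Obj C = Obj D \<and>
     (\<forall>x\<in>Obj C. \<forall>y\<in>Obj C.
        trivial_kan_fibration (Hom C x y) (Hom D (fobj F x) (fobj F y)) (fhom F x y))"

text \<open>
  The cofibrations of the dagger Bergner model structure, i.e. the dagger simplicial functors with
  the left lifting property against the trivial fibrations. The type argument is the universe with
  respect to which categories are small: the objects and the simplices of the mapping spaces of
  the test categories \<open>P\<close> and \<open>Q\<close> are drawn from it.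
\<close>

definition dagger_bergner_cofibration ::
  "'u itself \<Rightarrow> ('o, 'm) dscat \<Rightarrow> ('p, 'q) dscat \<Rightarrow> ('o, 'm, 'p, 'q) sfun \<Rightarrow> bool" where
  "dagger_bergner_cofibration (_ :: 'u itself) A B F \<longleftrightarrow> dagger_functor A B F \<and>
     (\<forall>(P :: ('u, 'u) dscat) (Q :: ('u, 'u) dscat) p u v.
        dagger_trivial_fibration P Q p \<and> dagger_functor A P u \<and> dagger_functor B Q v \<and>
        sfun_eq A (sfun_comp p u) (sfun_comp v F) \<longrightarrow>
        (\<exists>w. dagger_functor B P w \<and> sfun_eq A (sfun_comp w F) u \<and>
             sfun_eq B (sfun_comp p w) v))"

definition terminal_dscat :: "(unit, unit) dscat" where
  "terminal_dscat = \<lparr>Obj = {()}, Hom = (\<lambda>_ _. \<lparr>Simp = (\<lambda>_. {()}), act = (\<lambda>_ _ _ f. f)\<rparr>),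
     Comp = (\<lambda>_ _ _ _ _ _. ()), Ident = (\<lambda>_. ()), Dag = (\<lambda>_ _ _ f. f)\<rparr>"

definition E_sa :: "(unit, nat) dscat" where
  "E_sa = \<lparr>Obj = {()}, Hom = (\<lambda>_ _. \<lparr>Simp = (\<lambda>_. UNIV), act = (\<lambda>_ _ _ f. f)\<rparr>),
     Comp = (\<lambda>_ _ _ _ g f. g + f), Ident = (\<lambda>_. 0), Dag = (\<lambda>_ _ _ f. f)\<rparr>"

text \<open>The only simplicial functor from the terminal dagger simplicial category to \<^term>\<open>E_sa\<close>.\<close>

definition terminal_to_E_sa :: "(unit, unit, unit, nat) sfun" where
  "terminal_to_E_sa = \<lparr>fobj = (\<lambda>_. ()), fhom = (\<lambda>_ _ _ _. 0)\<rparr>"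


section \<open>Rigidification\<close>

text \<open>
  The simplicial category \<open>\<CC>[\<Delta>\<^sup>n]\<close>: the objects are \<open>0, \<dots>, n\<close>, and the mapping space from \<open>i\<close> to \<open>j\<close>
  is the nerve of the poset of all subsets of \<open>{i..j}\<close> that contain \<open>i\<close> and \<open>j\<close> (it is empty if
  \<open>i > j\<close>). A \<open>k\<close>-simplex is thus a chain \<open>T 0 \<subseteq> \<dots> \<subseteq> T k\<close>; composition is union.
\<close>

definition path_category :: "nat \<Rightarrow> (nat, nat \<Rightarrow> nat set) scat" where
  "path_category n = \<lparr>Obj = {..n},
     Hom = (\<lambda>i j. \<lparr>Simp = (\<lambda>k. {T \<in> extensional {..k}.
                     (\<forall>l\<le>k. T l \<subseteq> {i..j} \<and> i \<in> T l \<and> j \<in> T l) \<and>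
                     (\<forall>l l'. l \<le> l' \<and> l' \<le> k \<longrightarrow> T l \<subseteq> T l')}),
                   act = (\<lambda>k' k \<alpha> T. restrict (\<lambda>l. T (\<alpha> l)) {..k'})\<rparr>),
     Comp = (\<lambda>_ _ _ k S T. restrict (\<lambda>l. S l \<union> T l) {..k}),
     Ident = (\<lambda>i. restrict (\<lambda>_. {i}) {..0})\<rparr>"

definition path_functor :: "(nat \<Rightarrow> nat) \<Rightarrow> (nat, nat \<Rightarrow> nat set, nat, nat \<Rightarrow> nat set) sfun" where
  "path_functor \<alpha> = \<lparr>fobj = \<alpha>, fhom = (\<lambda>_ _ k T. restrict (\<lambda>l. \<alpha> ` T l) {..k})\<rparr>"

text \<open>
  \<open>\<CC>(X)\<close> is the colimit of the categories \<open>\<CC>[\<Delta>\<^sup>n]\<close> over all simplices \<open>\<sigma>\<close> of \<open>X\<close>, computed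
  separately in each simplicial degree \<open>k\<close>. Its objects are the vertices of \<open>X\<close>. Its morphisms are
  generated by the tuples \<open>(n, \<sigma>, i, j, T)\<close>, which stand for the image of the \<open>k\<close>-simplex \<open>T\<close> of
  the mapping space from \<open>i\<close> to \<open>j\<close> of \<open>\<CC>[\<Delta>\<^sup>n]\<close> in the copy indexed by the \<open>n\<close>-simplex \<open>\<sigma>\<close>; the
  relations say that these inclusions are functors and compatible with the simplicial operators.
  Words list the generators in the order in which they are traversed.
\<close>

type_synonym 'a gen = "nat \<times> 'a \<times> nat \<times> nat \<times> (nat \<Rightarrow> nat set)"

fun rig_gen :: "('a, 'z) sset_scheme \<Rightarrow> nat \<Rightarrow> 'a gen \<Rightarrow> bool" where
  "rig_gen X k (n, \<sigma>, i, j, T) \<longleftrightarrow>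
     \<sigma> \<in> Simp X n \<and> i \<le> n \<and> j \<le> n \<and> T \<in> Simp (Hom (path_category n) i j) k"

fun gen_src :: "('a, 'z) sset_scheme \<Rightarrow> 'a gen \<Rightarrow> 'a" where
  "gen_src X (n, \<sigma>, i, j, T) = vertex X n \<sigma> i"

fun gen_tgt :: "('a, 'z) sset_scheme \<Rightarrow> 'a gen \<Rightarrow> 'a" where
  "gen_tgt X (n, \<sigma>, i, j, T) = vertex X n \<sigma> j"

fun rig_word :: "('a, 'z) sset_scheme \<Rightarrow> nat \<Rightarrow> 'a \<Rightarrow> 'a \<Rightarrow> 'a gen list \<Rightarrow> bool" where
  "rig_word X k x y [] \<longleftrightarrow> x = y \<and> x \<in> Simp X 0"
| "rig_word X k x y (e # w) \<longleftrightarrow> rig_gen X k e \<and> gen_src X e = x \<and> rig_word X k (gen_tgt X e) y w"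

inductive rig_eq ::
  "('a, 'z) sset_scheme \<Rightarrow> nat \<Rightarrow> 'a \<Rightarrow> 'a \<Rightarrow> 'a gen list \<Rightarrow> 'a gen list \<Rightarrow> bool"
  for X :: "('a, 'z) sset_scheme" and k :: nat where
  rig_refl: "rig_word X k x y w \<Longrightarrow> rig_eq X k x y w w"
| rig_sym: "rig_eq X k x y v w \<Longrightarrow> rig_eq X k x y w v"
| rig_trans: "rig_eq X k x y u v \<Longrightarrow> rig_eq X k x y v w \<Longrightarrow> rig_eq X k x y u w"
| rig_append: "rig_eq X k x y v v' \<Longrightarrow> rig_eq X k y z w w' \<Longrightarrow> rig_eq X k x z (v @ w) (v' @ w')"
| rig_ident: "\<sigma> \<in> Simp X n \<Longrightarrow> i \<le> n \<Longrightarrow>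
    rig_eq X k (vertex X n \<sigma> i) (vertex X n \<sigma> i) [(n, \<sigma>, i, i, ident_at (path_category n) i k)] []"
| rig_comp: "\<sigma> \<in> Simp X n \<Longrightarrow> i \<le> n \<Longrightarrow> j \<le> n \<Longrightarrow> l \<le> n \<Longrightarrow>
    S \<in> Simp (Hom (path_category n) i j) k \<Longrightarrow> T \<in> Simp (Hom (path_category n) j l) k \<Longrightarrow>
    rig_eq X k (vertex X n \<sigma> i) (vertex X n \<sigma> l)
      [(n, \<sigma>, i, j, S), (n, \<sigma>, j, l, T)] [(n, \<sigma>, i, l, Comp (path_category n) i j l k T S)]"
| rig_act: "\<sigma> \<in> Simp X n \<Longrightarrow> delta_map m n \<alpha> \<Longrightarrow> i \<le> m \<Longrightarrow> j \<le> m \<Longrightarrow>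
    T \<in> Simp (Hom (path_category m) i j) k \<Longrightarrow>
    rig_eq X k (vertex X n \<sigma> (\<alpha> i)) (vertex X n \<sigma> (\<alpha> j))
      [(m, act X m n \<alpha> \<sigma>, i, j, T)] [(n, \<sigma>, \<alpha> i, \<alpha> j, fhom (path_functor \<alpha>) i j k T)]"

definition rig_class ::
  "('a, 'z) sset_scheme \<Rightarrow> nat \<Rightarrow> 'a \<Rightarrow> 'a \<Rightarrow> 'a gen list \<Rightarrow> 'a gen list set" where
  "rig_class X k x y w = {w'. rig_eq X k x y w w'}"

text \<open>Operations on classes are defined by applying the word operation to all representatives.\<close>

fun gen_act :: "nat \<Rightarrow> nat \<Rightarrow> (nat \<Rightarrow> nat) \<Rightarrow> 'a gen \<Rightarrow> 'a gen" where
  "gen_act k' k \<alpha> (n, \<sigma>, i, j, T) = (n, \<sigma>, i, j, act (Hom (path_category n) i j) k' k \<alpha> T)"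

definition rigidification :: "('a, 'z) sset_scheme \<Rightarrow> ('a, 'a gen list set) scat" where
  "rigidification X = \<lparr>Obj = Simp X 0,
     Hom = (\<lambda>x y. \<lparr>Simp = (\<lambda>k. {rig_class X k x y w | w. rig_word X k x y w}),
                   act = (\<lambda>k' k \<alpha> c. \<Union>w\<in>c. rig_class X k' x y (map (gen_act k' k \<alpha>) w))\<rparr>),
     Comp = (\<lambda>x y z k d c. \<Union>v\<in>c. \<Union>w\<in>d. rig_class X k x z (v @ w)),
     Ident = (\<lambda>x. rig_class X 0 x x [])\<rparr>"

fun gen_map :: "(nat \<Rightarrow> 'a \<Rightarrow> 'b) \<Rightarrow> 'a gen \<Rightarrow> 'b gen" where
  "gen_map f (n, \<sigma>, i, j, T) = (n, f n \<sigma>, i, j, T)"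

definition rigidification_map ::
  "('b, 'z) sset_scheme \<Rightarrow> (nat \<Rightarrow> 'a \<Rightarrow> 'b) \<Rightarrow> ('a, 'a gen list set, 'b, 'b gen list set) sfun" where
  "rigidification_map Y f = \<lparr>fobj = f 0,
     fhom = (\<lambda>x y k c. \<Union>w\<in>c. rig_class Y k (f 0 x) (f 0 y) (map (gen_map f) w))\<rparr>"

text \<open>
  The canonical isomorphism \<open>\<chi>\<close> from \<open>\<CC>(X\<^sup>o\<^sup>p)\<close> to \<open>\<CC>(X)\<^sup>o\<^sup>p\<close>: on the copy of \<open>\<CC>[\<Delta>\<^sup>n]\<close> indexed by an
  \<open>n\<close>-simplex it is the isomorphism between \<open>\<CC>[\<Delta>\<^sup>n]\<close> and its opposite induced by the reversal of \<open>[n]\<close>.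
\<close>

fun gen_rev :: "nat \<Rightarrow> 'a gen \<Rightarrow> 'a gen" where
  "gen_rev k (n, \<sigma>, i, j, T) = (n, \<sigma>, n - j, n - i, restrict (\<lambda>l. (\<lambda>t. n - t) ` T l) {..k})"

definition rigidification_op ::
  "('a, 'z) sset_scheme \<Rightarrow> ('a, 'a gen list set, 'a, 'a gen list set) sfun" where
  "rigidification_op X = \<lparr>fobj = (\<lambda>x. x),
     fhom = (\<lambda>x y k c. \<Union>w\<in>c. rig_class X k y x (rev (map (gen_rev k) w)))\<rparr>"

definition dagger_rigidification :: "('a, 'z) dsset_scheme \<Rightarrow> ('a, 'a gen list set) dscat" where
  "dagger_rigidification X = scat.extend (rigidification X)
     (dscat.fields (fhom (sfun_comp (rigidification_op X)
                                    (rigidification_map (op_sset X) (dag X)))))"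


section \<open>Basic properties of rigidification\<close>

lemma delta_mapI:
  "(\<And>i. i \<le> m \<Longrightarrow> \<alpha> i \<le> n) \<Longrightarrow> (\<And>i j. i \<le> j \<Longrightarrow> j \<le> m \<Longrightarrow> \<alpha> i \<le> \<alpha> j) \<Longrightarrow> delta_map m n \<alpha>"
  by (simp add: delta_map_def)

lemma delta_mapD:
  assumes "delta_map m n \<alpha>"
  shows "i \<le> m \<Longrightarrow> \<alpha> i \<le> n" "i \<le> j \<Longrightarrow> j \<le> m \<Longrightarrow> \<alpha> i \<le> \<alpha> j"
  using assms by (auto simp: delta_map_def)

lemma delta_map_rev: "delta_map m n \<alpha> \<Longrightarrow> delta_map m n (\<lambda>i. n - \<alpha> (m - i))"
  by (auto simp: delta_map_def intro!: diff_le_mono2)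

lemma delta_map_comp: "delta_map k m \<beta> \<Longrightarrow> delta_map m n \<alpha> \<Longrightarrow> delta_map k n (\<lambda>i. \<alpha> (\<beta> i))"
  by (auto simp: delta_map_def)

lemma restrict_eq_iff: "restrict f A = restrict g A \<longleftrightarrow> (\<forall>x\<in>A. f x = g x)"
  by (metis restrict_apply' restrict_ext)

lemma path_simp_iff: "T \<in> Simp (Hom (path_category n) i j) k \<longleftrightarrow>
   T \<in> extensional {..k} \<and> (\<forall>l\<le>k. T l \<subseteq> {i..j} \<and> i \<in> T l \<and> j \<in> T l) \<and>
   (\<forall>l l'. l \<le> l' \<and> l' \<le> k \<longrightarrow> T l \<subseteq> T l')"
  by (simp add: path_category_def)

lemma path_act: "act (Hom (path_category n) i j) k' k \<alpha> T = restrict (\<lambda>l. T (\<alpha> l)) {..k'}"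
  by (simp add: path_category_def)

lemma path_Comp: "Comp (path_category n) i j l k S T = restrict (\<lambda>p. S p \<union> T p) {..k}"
  by (simp add: path_category_def)

lemma path_Obj: "Obj (path_category n) = {..n}"
  by (simp add: path_category_def)

lemma path_Ident: "Ident (path_category n) i = restrict (\<lambda>_. {i}) {..0}"
  by (simp add: path_category_def)

lemma path_ident_at: "ident_at (path_category n) i k = restrict (\<lambda>_. {i}) {..k}"
  by (auto simp: ident_at_def path_act path_Ident)

lemma path_Hom_simplicial: "simplicial_set (Hom (path_category n) i j)"
proof
  fix k m \<alpha> x assume "delta_map k m \<alpha>" "x \<in> Simp (Hom (path_category n) i j) m"
  then show "act (Hom (path_category n) i j) k m \<alpha> x \<in> Simp (Hom (path_category n) i j) k"
    unfolding path_act path_simp_iff delta_map_def by simp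
next
  fix m x assume "x \<in> Simp (Hom (path_category n) i j) m"
  then show "act (Hom (path_category n) i j) m m (\<lambda>i. i) x = x"
    unfolding path_act path_simp_iff by (auto intro: extensionalityI[of _ "{..m}"])
qed (auto simp: path_act restrict_eq_iff delta_map_def)

lemma path_simplicial_category: "simplicial_category (path_category n)"
proof
  fix x y z k f g
  assume f: "f \<in> Simp (Hom (path_category n) x y) k" and g: "g \<in> Simp (Hom (path_category n) y z) k"
  have sub: "f l \<subseteq> {x..y}" "x \<in> f l" "y \<in> f l" "g l \<subseteq> {y..z}" "y \<in> g l" "z \<in> g l" if "l \<le> k" for l
    using f g that unfolding path_simp_iff by blast+
  have "y \<in> {x..y}" "z \<in> {y..z}" using sub(1,3,4,6)[of 0] by blast+
  then have xyz: "x \<le> y" "y \<le> z" by simp_all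
  have "f l \<union> g l \<subseteq> f l' \<union> g l'" if "l \<le> l'" "l' \<le> k" for l l'
    by (rule Un_mono) (use f g that in \<open>simp_all add: path_simp_iff\<close>)
  moreover have "f l \<union> g l \<subseteq> {x..z}" if "l \<le> k" for l
  proof -
    have "{x..y} \<subseteq> {x..z}" "{y..z} \<subseteq> {x..z}" using xyz by auto
    then show ?thesis using sub[OF that] by blast
  qed
  ultimately show "Comp (path_category n) x y z k g f \<in> Simp (Hom (path_category n) x z) k"
    unfolding path_simp_iff path_Comp using sub by (simp add: Un_commute)
next
  fix x y f k assume f: "f \<in> Simp (Hom (path_category n) x y) k"
  show "Comp (path_category n) x x y k f (ident_at (path_category n) x k) = f"
    using f unfolding path_Comp path_ident_at path_simp_iff
    by (auto intro!: extensionalityI[of _ "{..k}"])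
  show "Comp (path_category n) x y y k (ident_at (path_category n) y k) f = f"
    using f unfolding path_Comp path_ident_at path_simp_iff
    by (auto intro!: extensionalityI[of _ "{..k}"])
qed (auto simp: extensional_restrict path_Hom_simplicial path_simp_iff path_Ident path_Comp path_act restrict_eq_iff
       delta_map_def)

lemma path_functor_simp:
  "fobj (path_functor \<alpha>) i = \<alpha> i"
  "fhom (path_functor \<alpha>) i j k T = restrict (\<lambda>l. \<alpha> ` T l) {..k}"
  by (simp_all add: path_functor_def)

lemma path_functor_closed:
  assumes "delta_map m n \<alpha>" "i \<le> m" "j \<le> m" "T \<in> Simp (Hom (path_category m) i j) k"
  shows "fhom (path_functor \<alpha>) i j k T \<in> Simp (Hom (path_category n) (\<alpha> i) (\<alpha> j)) k"
proof -
  have "\<alpha> ` T l \<subseteq> {\<alpha> i..\<alpha> j}" if "l \<le> k" for l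
  proof -
    have "T l \<subseteq> {i..j}" using assms(4) that unfolding path_simp_iff by blast
    moreover have "\<alpha> i \<le> \<alpha> t \<and> \<alpha> t \<le> \<alpha> j" if "i \<le> t" "t \<le> j" for t
      using that assms(3) delta_mapD(2)[OF assms(1)] by (meson le_trans)
    ultimately show ?thesis by (auto simp: subset_iff)
  qed
  moreover have "\<alpha> ` T l \<subseteq> \<alpha> ` T l'" if "l \<le> l'" "l' \<le> k" for l l'
    using assms(4) that unfolding path_simp_iff by blast
  moreover have "i \<in> T l" "j \<in> T l" if "l \<le> k" for l
    using assms(4) that unfolding path_simp_iff by blast+
  ultimately show ?thesis by (simp add: path_simp_iff path_functor_simp)
qed

lemma path_functor_functor:
  assumes "delta_map m n \<alpha>"
  shows "simplicial_functor (path_category m) (path_category n) (path_functor \<alpha>)"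
  unfolding simplicial_functor_def simplicial_map_def
proof (intro conjI ballI allI impI)
  fix i assume "i \<in> Obj (path_category m)"
  then show "fobj (path_functor \<alpha>) i \<in> Obj (path_category n)"
    using assms by (simp add: path_Obj path_functor_simp delta_map_def)
next
  fix i j k T assume "i \<in> Obj (path_category m)" "j \<in> Obj (path_category m)"
    "T \<in> Simp (Hom (path_category m) i j) k"
  then show "fhom (path_functor \<alpha>) i j k T \<in>
      Simp (Hom (path_category n) (fobj (path_functor \<alpha>) i) (fobj (path_functor \<alpha>) j)) k"
    using path_functor_closed[OF assms] by (simp add: path_Obj path_functor_simp(1))
qed (simp_all add: path_simplicial_category path_Hom_simplicial path_act path_Ident path_Comp
      restrict_eq_iff delta_map_def path_functor_simp image_Un)

lemma simplicial_functor_ident_at: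
  assumes F: "simplicial_functor C D F" and x: "x \<in> Obj C"
  shows "fhom F x x n (ident_at C x n) = ident_at D (fobj F x) n"
proof -
  interpret C: simplicial_category C using F by (simp add: simplicial_functor_def)
  have "delta_map n 0 (\<lambda>_. 0)" by (simp add: delta_map_def)
  then show ?thesis using assms C.Ident_closed[OF x]
    unfolding simplicial_functor_def ident_at_def simplicial_map_def by metis
qed

lemma path_functor_ident_at:
  "fhom (path_functor \<alpha>) i i k (ident_at (path_category m) i k) = ident_at (path_category n) (\<alpha> i) k"
  by (simp add: path_functor_simp path_ident_at restrict_eq_iff)

lemma ident_at_closed:
  assumes "simplicial_category C" "x \<in> Obj C"
  shows "ident_at C x n \<in> Simp (Hom C x x) n"
proof -
  interpret simplicial_category C by fact
  interpret simplicial_set "Hom C x x" using Hom_simplicial assms(2) by blast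
  show ?thesis unfolding ident_at_def by (rule act_closed) (auto simp: delta_map_def Ident_closed assms)
qed

lemma path_ident_at_closed: "ident_at (path_category n) i k \<in> Simp (Hom (path_category n) i i) k"
  by (auto simp: path_ident_at path_simp_iff)

lemma path_Comp_closed:
  assumes "i \<le> n" "j \<le> n" "l \<le> n" "S \<in> Simp (Hom (path_category n) i j) k"
    "T \<in> Simp (Hom (path_category n) j l) k"
  shows "Comp (path_category n) i j l k T S \<in> Simp (Hom (path_category n) i l) k"
  using simplicial_category.Comp_closed[OF path_simplicial_category, of i n j l S k T] assms
  by (simp add: path_Obj)

lemma op_Simp: "Simp (op_sset X) = Simp X"
  by (simp add: op_sset_def)

lemma op_act: "act (op_sset X) m n \<alpha> = act X m n (\<lambda>i. n - \<alpha> (m - i))"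
  by (simp add: op_sset_def)

lemma simplicial_set_op:
  assumes "simplicial_set X" shows "simplicial_set (op_sset X)"
proof -
  interpret simplicial_set X by fact
  show ?thesis
  proof
    fix m n \<alpha> x assume "delta_map m n \<alpha>" "x \<in> Simp (op_sset X) n"
    then show "act (op_sset X) m n \<alpha> x \<in> Simp (op_sset X) m"
      by (simp add: op_sset_def act_closed delta_map_rev)
  next
    fix m n \<alpha> \<beta> x assume "delta_map m n \<alpha>" "\<And>i. i \<le> m \<Longrightarrow> \<alpha> i = \<beta> i" "x \<in> Simp (op_sset X) n"
    then show "act (op_sset X) m n \<alpha> x = act (op_sset X) m n \<beta> x"
      by (simp add: op_sset_def)
  next
    fix n x assume x: "x \<in> Simp (op_sset X) n"
    have "act X n n (\<lambda>i. n - (n - i)) x = act X n n (\<lambda>i. i) x"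
      by (rule act_cong) (use x in \<open>auto simp: op_sset_def delta_map_def\<close>)
    then show "act (op_sset X) n n (\<lambda>i. i) x = x" using x by (simp add: op_sset_def act_id)
  next
    fix k m \<beta> n \<alpha> x
    assume b: "delta_map k m \<beta>" and a: "delta_map m n \<alpha>" and x: "x \<in> Simp (op_sset X) n"
    have x': "x \<in> Simp X n" using x by (simp add: op_sset_def)
    have "act X k n (\<lambda>i. n - \<alpha> (\<beta> (k - i))) x = act X k n (\<lambda>i. n - \<alpha> (m - (m - \<beta> (k - i)))) x"
      by (rule act_cong[OF _ _ x']) (use b a in \<open>auto simp: delta_map_def intro!: diff_le_mono2\<close>)
    also have "\<dots> = act X k m (\<lambda>i. m - \<beta> (k - i)) (act X m n (\<lambda>i. n - \<alpha> (m - i)) x)"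
      by (rule act_comp[OF delta_map_rev[OF b] delta_map_rev[OF a] x'])
    finally show "act (op_sset X) k n (\<lambda>i. \<alpha> (\<beta> i)) x =
        act (op_sset X) k m \<beta> (act (op_sset X) m n \<alpha> x)"
      by (simp add: op_sset_def)
  qed
qed

lemma path_rev_closed:
  assumes "i \<le> n" "j \<le> n" "T \<in> Simp (Hom (path_category n) i j) k"
  shows "restrict (\<lambda>l. (\<lambda>t. n - t) ` T l) {..k} \<in> Simp (Hom (path_category n) (n - j) (n - i)) k"
proof -
  have "(\<lambda>t. n - t) ` T l \<subseteq> {n - j..n - i}" if "l \<le> k" for l
    using assms(3) that unfolding path_simp_iff by (auto simp: subset_iff intro!: diff_le_mono2)
  moreover have "(\<lambda>t. n - t) ` T l \<subseteq> (\<lambda>t. n - t) ` T l'" if "l \<le> l'" "l' \<le> k" for l l'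
    using assms(3) that unfolding path_simp_iff by blast
  ultimately show ?thesis using assms(3) by (auto simp: path_simp_iff)
qed

context simplicial_set
begin

lemma vertex_closed: "\<sigma> \<in> Simp X n \<Longrightarrow> i \<le> n \<Longrightarrow> vertex X n \<sigma> i \<in> Simp X 0"
  unfolding vertex_def by (rule act_closed) (auto simp: delta_map_def)

lemma vertex_act:
  assumes "delta_map m n \<alpha>" "\<sigma> \<in> Simp X n" "i \<le> m"
  shows "vertex X m (act X m n \<alpha> \<sigma>) i = vertex X n \<sigma> (\<alpha> i)"
  unfolding vertex_def
  using act_comp[of 0 m "\<lambda>_. i" n \<alpha> \<sigma>] assms by (auto simp: delta_map_def)

lemma vertex_0: "x \<in> Simp X 0 \<Longrightarrow> vertex X 0 x 0 = x"
  unfolding vertex_def using act_cong[of 0 0 "\<lambda>_. 0" "\<lambda>i. i" x] act_id[of x 0]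
  by (simp add: delta_map_def)

lemma rig_word_ends: "rig_word X k x y w \<Longrightarrow> x \<in> Simp X 0 \<and> y \<in> Simp X 0"
proof (induction w arbitrary: x)
  case (Cons e w)
  then show ?case by (cases e) (auto simp: vertex_closed)
qed auto

lemma rig_word_append:
  "rig_word X k x y (v @ w) \<longleftrightarrow> (\<exists>z. rig_word X k x z v \<and> rig_word X k z y w)"
  by (induction v arbitrary: x) (auto dest: rig_word_ends)

lemma rig_eq_words:
  "rig_eq X k x y v w \<Longrightarrow> rig_word X k x y v \<and> rig_word X k x y w"
proof (induction rule: rig_eq.induct)
  case (rig_comp \<sigma> n i j l S T)
  then show ?case by (auto simp: vertex_closed path_Comp_closed)
next
  case (rig_act \<sigma> n m \<alpha> i j T)
  then show ?case
    by (auto simp: vertex_closed vertex_act act_closed path_functor_closed delta_mapD)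
qed (auto simp: rig_word_append path_ident_at_closed vertex_closed)

lemma rig_class_self: "rig_word X k x y w \<Longrightarrow> w \<in> rig_class X k x y w"
  by (simp add: rig_class_def rig_refl)

lemma rig_class_eqI: "rig_eq X k x y v w \<Longrightarrow> rig_class X k x y v = rig_class X k x y w"
  unfolding rig_class_def by (blast intro: rig_sym rig_trans)

lemma rig_class_eqD:
  "rig_class X k x y v = rig_class X k x y w \<Longrightarrow> rig_word X k x y w \<Longrightarrow> rig_eq X k x y v w"
  unfolding rig_class_def by (metis mem_Collect_eq rig_refl)

text \<open>A word operation compatible with \<^const>\<open>rig_eq\<close> descends to classes.\<close>

lemma rig_class_UN:
  assumes "rig_word X k x y w"
    and "\<And>v. rig_eq X k x y w v \<Longrightarrow> rig_eq Y k' x' y' (h w) (h v)"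
  shows "(\<Union>v\<in>rig_class X k x y w. rig_class Y k' x' y' (h v)) = rig_class Y k' x' y' (h w)"
proof -
  have "rig_class Y k' x' y' (h v) = rig_class Y k' x' y' (h w)" if "v \<in> rig_class X k x y w" for v
    using assms(2)[of v] that unfolding rig_class_def by (blast intro: rig_eq.intros)
  then show ?thesis using rig_class_self[OF assms(1)] by blast
qed

lemma rig_class_UN2:
  assumes "rig_word X k x y v" "rig_word X k y z w"
  shows "(\<Union>v'\<in>rig_class X k x y v. \<Union>w'\<in>rig_class X k y z w. rig_class X k x z (v' @ w')) =
     rig_class X k x z (v @ w)"
proof -
  have "rig_class X k x z (v' @ w') = rig_class X k x z (v @ w)"
    if "v' \<in> rig_class X k x y v" "w' \<in> rig_class X k y z w" for v' w'
    using that unfolding rig_class_def[of _ _ x y] rig_class_def[of _ _ y z] mem_Collect_eq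
    by (metis rig_append rig_class_eqI)
  then show ?thesis using rig_class_self[OF assms(1)] rig_class_self[OF assms(2)] by blast
qed

lemma rig_eq_gen_act:
  assumes a: "delta_map k' k \<alpha>"
  shows "rig_eq X k x y v w \<Longrightarrow>
    rig_eq X k' x y (map (gen_act k' k \<alpha>) v) (map (gen_act k' k \<alpha>) w)"
proof (induction rule: rig_eq.induct)
  case (rig_refl x y w)
  have closed: "act (Hom (path_category n) i j) k' k \<alpha> T \<in> Simp (Hom (path_category n) i j) k'"
    if "T \<in> Simp (Hom (path_category n) i j) k" for n i j T
    using simplicial_set.act_closed[OF path_Hom_simplicial] a that by blast
  have "rig_word X k x y w \<Longrightarrow> rig_word X k' x y (map (gen_act k' k \<alpha>) w)"
    by (induction w arbitrary: x) (auto simp: closed)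
  then show ?case using rig_refl by (simp add: rig_eq.rig_refl)
next
  case (rig_ident \<sigma> n i)
  have "act (Hom (path_category n) i i) k' k \<alpha> (ident_at (path_category n) i k) =
      ident_at (path_category n) i k'"
    using a by (auto simp: path_act path_ident_at restrict_eq_iff delta_map_def)
  then show ?case using rig_eq.rig_ident[OF rig_ident] by simp
next
  case (rig_comp \<sigma> n i j l S T)
  have "act (Hom (path_category n) i j) k' k \<alpha> S \<in> Simp (Hom (path_category n) i j) k'"
    "act (Hom (path_category n) j l) k' k \<alpha> T \<in> Simp (Hom (path_category n) j l) k'"
    using simplicial_set.act_closed[OF path_Hom_simplicial] a rig_comp by blast+
  moreover have "act (Hom (path_category n) i l) k' k \<alpha> (Comp (path_category n) i j l k T S) =
     Comp (path_category n) i j l k' (act (Hom (path_category n) j l) k' k \<alpha> T)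
       (act (Hom (path_category n) i j) k' k \<alpha> S)"
    using simplicial_category.Comp_act[OF path_simplicial_category, of i n j l k' k \<alpha> S T]
      rig_comp a by (simp add: path_Obj)
  ultimately show ?case using rig_comp by (auto intro: rig_eq.rig_comp)
next
  case (rig_act \<sigma> n m \<beta> i j T)
  have "act (Hom (path_category m) i j) k' k \<alpha> T \<in> Simp (Hom (path_category m) i j) k'"
    using simplicial_set.act_closed[OF path_Hom_simplicial] a rig_act by blast
  moreover have "act (Hom (path_category n) (\<beta> i) (\<beta> j)) k' k \<alpha> (fhom (path_functor \<beta>) i j k T) =
     fhom (path_functor \<beta>) i j k' (act (Hom (path_category m) i j) k' k \<alpha> T)"
    using a by (auto simp: path_act path_functor_simp restrict_eq_iff delta_map_def)
  ultimately show ?case using rig_act by (auto intro: rig_eq.rig_act)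
next
  case (rig_append x y v v' z w w')
  then show ?case by (auto intro: rig_eq.rig_append)
qed (blast intro: rig_sym rig_trans)+

lemma rig_eq_gen_map:
  assumes f: "simplicial_map X Y f"
  shows "rig_eq X k x y v w \<Longrightarrow> rig_eq Y k (f 0 x) (f 0 y) (map (gen_map f) v) (map (gen_map f) w)"
proof -
  have fv: "f 0 (vertex X n \<sigma> i) = vertex Y n (f n \<sigma>) i" if "\<sigma> \<in> Simp X n" "i \<le> n" for n \<sigma> i
    using f that unfolding simplicial_map_def vertex_def by (auto simp: delta_map_def)
  have fc: "f n \<sigma> \<in> Simp Y n" if "\<sigma> \<in> Simp X n" for n \<sigma>
    using f that unfolding simplicial_map_def by blast
  show "rig_eq X k x y v w \<Longrightarrow> rig_eq Y k (f 0 x) (f 0 y) (map (gen_map f) v) (map (gen_map f) w)"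
  proof (induction rule: rig_eq.induct)
    case (rig_refl x y w)
    have "rig_word X k x y w \<Longrightarrow> rig_word Y k (f 0 x) (f 0 y) (map (gen_map f) w)"
    proof (induction w arbitrary: x)
      case (Cons e w)
      then show ?case using Cons.IH[of "gen_tgt X e"] by (cases e) (auto simp: fv fc)
    qed (auto simp: fc)
    then show ?case using rig_refl by (simp add: rig_eq.rig_refl)
  next
    case (rig_act \<sigma> n m \<alpha> i j T)
    have "f m (act X m n \<alpha> \<sigma>) = act Y m n \<alpha> (f n \<sigma>)"
      using f rig_act unfolding simplicial_map_def by blast
    then show ?case using rig_act rig_eq.rig_act[OF fc, of \<sigma> n m \<alpha> i j T k]
      by (auto simp: fv delta_mapD)
  next
    case (rig_append x y v v' z w w')
    then show ?case by (auto intro: rig_eq.rig_append)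
  qed (auto simp: fv fc intro: rig_sym rig_trans rig_ident rig_comp)
qed

lemma vertex_op: "vertex (op_sset X) n \<sigma> i = vertex X n \<sigma> (n - i)"
  by (simp add: vertex_def op_sset_def)

lemma rig_word_rev:
  "rig_word (op_sset X) k x y w \<Longrightarrow> rig_word X k y x (rev (map (gen_rev k) w))"
proof (induction w arbitrary: x)
  case Nil
  then show ?case by (auto simp: op_Simp)
next
  case (Cons e w)
  obtain n \<sigma> i j T where e: "e = (n, \<sigma>, i, j, T)" by (cases e)
  have "rig_word X k (vertex X n \<sigma> (n - j)) x [gen_rev k e]"
    using Cons.prems by (auto simp: e vertex_op op_Simp op_act path_rev_closed vertex_closed)
  then show ?case using Cons by (auto simp: e rig_word_append vertex_op)
qed

lemma rig_eq_gen_rev: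
  "rig_eq (op_sset X) k x y v w \<Longrightarrow>
   rig_eq X k y x (rev (map (gen_rev k) v)) (rev (map (gen_rev k) w))"
proof (induction rule: rig_eq.induct)
  case (rig_refl x y w)
  then show ?case by (intro rig_eq.rig_refl rig_word_rev)
next
  case (rig_ident \<sigma> n i)
  have "restrict (\<lambda>l. (\<lambda>t. n - t) ` ident_at (path_category n) i k l) {..k} =
      ident_at (path_category n) (n - i) k"
    by (simp add: path_ident_at restrict_eq_iff)
  then show ?case using rig_ident rig_eq.rig_ident[of \<sigma> X n "n - i" k]
    by (simp add: vertex_op op_Simp op_act)
next
  case (rig_comp \<sigma> n i j l S T)
  let ?r = "\<lambda>T. restrict (\<lambda>l. (\<lambda>t. n - t) ` T l) {..k}"
  have "?r (Comp (path_category n) i j l k T S) =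
      Comp (path_category n) (n - l) (n - j) (n - i) k (?r S) (?r T)"
    by (simp add: path_Comp restrict_eq_iff image_Un Un_commute)
  then show ?case
    using rig_comp rig_eq.rig_comp[of \<sigma> X n "n - l" "n - j" "n - i" "?r T" k "?r S"]
    by (simp add: vertex_op path_rev_closed op_Simp op_act)
next
  case (rig_act \<sigma> n m \<beta> i j T)
  let ?r = "\<lambda>n T. restrict (\<lambda>l. (\<lambda>t. n - t) ` T l) {..k}"
  let ?b = "\<lambda>i. n - \<beta> (m - i)"
  have "T l \<subseteq> {..m}" if "l \<le> k" for l
    using rig_act that unfolding path_simp_iff by fastforce
  then have "(\<lambda>t. n - \<beta> t) ` T l = (\<lambda>t. n - \<beta> (m - (m - t))) ` T l" if "l \<le> k" for l
    by (intro image_cong refl) (use that in \<open>force dest: subsetD\<close>)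
  then have "?r n (fhom (path_functor \<beta>) i j k T) = fhom (path_functor ?b) (m - j) (m - i) k (?r m T)"
    by (auto simp: path_functor_simp image_image restrict_eq_iff)
  then show ?case
    using rig_act rig_eq.rig_act[of \<sigma> X n m ?b "m - j" "m - i" "?r m T" k]
    by (simp add: vertex_op path_rev_closed op_Simp op_act delta_map_rev)
next
  case (rig_append x y v v' z w w')
  then show ?case by (auto intro: rig_eq.rig_append)
qed (blast intro: rig_sym rig_trans)+

lemma rig_Obj: "Obj (rigidification X) = Simp X 0"
  by (simp add: rigidification_def)

lemma rig_simp_iff:
  "c \<in> Simp (Hom (rigidification X) x y) k \<longleftrightarrow> (\<exists>w. rig_word X k x y w \<and> c = rig_class X k x y w)"
  by (auto simp: rigidification_def)

lemma rig_act_class: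
  assumes "delta_map k' k \<alpha>" "rig_word X k x y w"
  shows "act (Hom (rigidification X) x y) k' k \<alpha> (rig_class X k x y w) =
    rig_class X k' x y (map (gen_act k' k \<alpha>) w)"
  unfolding rigidification_def
  using rig_class_UN[OF assms(2) rig_eq_gen_act[OF assms(1)]] by simp

lemma rig_Comp_class:
  assumes "rig_word X k x y v" "rig_word X k y z w"
  shows "Comp (rigidification X) x y z k (rig_class X k y z w) (rig_class X k x y v) =
    rig_class X k x z (v @ w)"
  unfolding rigidification_def using rig_class_UN2[OF assms] by simp

lemma rig_ident_at: "x \<in> Simp X 0 \<Longrightarrow> ident_at (rigidification X) x k = rig_class X k x x []"
  unfolding ident_at_def using rig_act_class[of k 0 "\<lambda>_. 0" x x "[]"]
  by (simp add: delta_map_def rigidification_def)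

lemma rig_word_gen_act:
  "delta_map k' k \<alpha> \<Longrightarrow> rig_word X k x y w \<Longrightarrow> rig_word X k' x y (map (gen_act k' k \<alpha>) w)"
  using rig_eq_words[OF rig_eq_gen_act[OF _ rig_refl]] by blast

lemma rig_Hom_simplicial: "simplicial_set (Hom (rigidification X) x y)"
proof
  fix m n \<alpha> c assume "delta_map m n \<alpha>" "c \<in> Simp (Hom (rigidification X) x y) n"
  then show "act (Hom (rigidification X) x y) m n \<alpha> c \<in> Simp (Hom (rigidification X) x y) m"
    unfolding rig_simp_iff using rig_act_class rig_word_gen_act by metis
next
  fix m n \<alpha> \<beta> c
  assume a: "delta_map m n \<alpha>" and ab: "\<And>i. i \<le> m \<Longrightarrow> \<alpha> i = \<beta> i"
    and c: "c \<in> Simp (Hom (rigidification X) x y) n"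
  have b: "delta_map m n \<beta>"
    unfolding delta_map_def
  proof (intro conjI allI impI)
    fix i assume "i \<le> m" then show "\<beta> i \<le> n" using delta_mapD(1)[OF a] ab by metis
  next
    fix i j assume "i \<le> j \<and> j \<le> m" then show "\<beta> i \<le> \<beta> j"
      using delta_mapD(2)[OF a, of i j] ab[of i] ab[of j] by simp
  qed
  have "gen_act m n \<alpha> e = gen_act m n \<beta> e" for e :: "'a gen"
    by (cases e) (auto simp: path_act restrict_eq_iff ab)
  then have "map (gen_act m n \<alpha>) w = map (gen_act m n \<beta>) w" for w :: "'a gen list" by simp
  then show "act (Hom (rigidification X) x y) m n \<alpha> c = act (Hom (rigidification X) x y) m n \<beta> c"
    using c a b rig_act_class unfolding rig_simp_iff by metis
next
  fix n c assume "c \<in> Simp (Hom (rigidification X) x y) n"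
  then obtain w where w: "rig_word X n x y w" "c = rig_class X n x y w" by (auto simp: rig_simp_iff)
  have "rig_word X n x y w \<Longrightarrow> map (gen_act n n (\<lambda>i. i)) w = w"
  proof (induction w arbitrary: x)
    case (Cons e w)
    then show ?case by (cases e) (auto simp: path_act path_simp_iff extensional_restrict)
  qed simp
  then show "act (Hom (rigidification X) x y) n n (\<lambda>i. i) c = c"
    using w rig_act_class[of n n "\<lambda>i. i" x y w] by (simp add: delta_map_def)
next
  fix k m \<beta> n \<alpha> c
  assume b: "delta_map k m \<beta>" and a: "delta_map m n \<alpha>"
    and c: "c \<in> Simp (Hom (rigidification X) x y) n"
  obtain w where w: "rig_word X n x y w" "c = rig_class X n x y w" using c by (auto simp: rig_simp_iff)
  have "gen_act k n (\<lambda>i. \<alpha> (\<beta> i)) e = gen_act k m \<beta> (gen_act m n \<alpha> e)" for e :: "'a gen"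
    using b by (cases e) (auto simp: path_act restrict_eq_iff delta_map_def)
  then have "map (gen_act k n (\<lambda>i. \<alpha> (\<beta> i))) w = map (gen_act k m \<beta>) (map (gen_act m n \<alpha>) w)"
    unfolding map_map o_def by simp
  then show "act (Hom (rigidification X) x y) k n (\<lambda>i. \<alpha> (\<beta> i)) c =
      act (Hom (rigidification X) x y) k m \<beta> (act (Hom (rigidification X) x y) m n \<alpha> c)"
    using rig_act_class[OF delta_map_comp[OF b a] w(1)] rig_act_class[OF a w(1)]
      rig_act_class[OF b rig_word_gen_act[OF a w(1)]] w(2) by (simp del: map_map)
qed

lemma rigidification_simplicial_category: "simplicial_category (rigidification X)"
proof (rule simplicial_category.intro)
  fix x assume x: "x \<in> Obj (rigidification X)"
  have "rig_word X 0 x x []" using x by (simp add: rig_Obj)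
  moreover have "Ident (rigidification X) x = rig_class X 0 x x []" by (simp add: rigidification_def)
  ultimately show "Ident (rigidification X) x \<in> Simp (Hom (rigidification X) x x) 0"
    unfolding rig_simp_iff by blast
next
  fix x y z f n g
  assume "f \<in> Simp (Hom (rigidification X) x y) n" "g \<in> Simp (Hom (rigidification X) y z) n"
  then show "Comp (rigidification X) x y z n g f \<in> Simp (Hom (rigidification X) x z) n"
    unfolding rig_simp_iff using rig_Comp_class rig_word_append by metis
next
  fix x y z m n \<alpha> f g
  assume a: "delta_map m n \<alpha>"
    and "f \<in> Simp (Hom (rigidification X) x y) n" "g \<in> Simp (Hom (rigidification X) y z) n"
  then obtain v w where vw: "rig_word X n x y v" "f = rig_class X n x y v"
    "rig_word X n y z w" "g = rig_class X n y z w" unfolding rig_simp_iff by blast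
  have "rig_word X n x z (v @ w)" using vw rig_word_append by blast
  then show "act (Hom (rigidification X) x z) m n \<alpha> (Comp (rigidification X) x y z n g f) =
       Comp (rigidification X) x y z m (act (Hom (rigidification X) y z) m n \<alpha> g)
        (act (Hom (rigidification X) x y) m n \<alpha> f)"
    using vw a by (simp add: rig_Comp_class rig_act_class rig_word_gen_act)
next
  fix x y z w f n g h
  assume "f \<in> Simp (Hom (rigidification X) x y) n" "g \<in> Simp (Hom (rigidification X) y z) n"
    "h \<in> Simp (Hom (rigidification X) z w) n"
  then obtain t u v where "rig_word X n x y t" "f = rig_class X n x y t"
    "rig_word X n y z u" "g = rig_class X n y z u" "rig_word X n z w v" "h = rig_class X n z w v"
    unfolding rig_simp_iff by blast
  moreover from this have "rig_word X n x z (t @ u)" "rig_word X n y w (u @ v)"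
    using rig_word_append by blast+
  ultimately show "Comp (rigidification X) x z w n h (Comp (rigidification X) x y z n g f) =
       Comp (rigidification X) x y w n (Comp (rigidification X) y z w n h g) f"
    by (simp add: rig_Comp_class)
next
  fix x y f n
  assume x: "x \<in> Obj (rigidification X)" and y: "y \<in> Obj (rigidification X)"
    and f: "f \<in> Simp (Hom (rigidification X) x y) n"
  obtain w where w: "rig_word X n x y w" "f = rig_class X n x y w" using f rig_simp_iff by blast
  show "Comp (rigidification X) x x y n f (ident_at (rigidification X) x n) = f"
    using x w rig_Comp_class[of n x x "[]" y w] by (simp add: rig_Obj rig_ident_at)
  show "Comp (rigidification X) x y y n (ident_at (rigidification X) y n) f = f"
    using y w rig_Comp_class[of n x y w y "[]"] by (simp add: rig_Obj rig_ident_at)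
qed (rule rig_Hom_simplicial)

end

lemma rigidification_map_class:
  assumes f: "simplicial_map X Y f" and w: "rig_word X k x y w"
  shows "fhom (rigidification_map Y f) x y k (rig_class X k x y w) =
      rig_class Y k (f 0 x) (f 0 y) (map (gen_map f) w)"
    and "rig_word Y k (f 0 x) (f 0 y) (map (gen_map f) w)"
proof -
  interpret X: simplicial_set X using f by (simp add: simplicial_map_def)
  interpret Y: simplicial_set Y using f by (simp add: simplicial_map_def)
  note eq = X.rig_eq_gen_map[OF f]
  show "fhom (rigidification_map Y f) x y k (rig_class X k x y w) =
      rig_class Y k (f 0 x) (f 0 y) (map (gen_map f) w)"
    unfolding rigidification_map_def
    using X.rig_class_UN[where h = "map (gen_map f)", OF w eq] by simp
  show "rig_word Y k (f 0 x) (f 0 y) (map (gen_map f) w)"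
    using Y.rig_eq_words[OF eq[OF rig_refl[OF w]]] by blast
qed

lemma rigidification_map_functor:
  assumes f: "simplicial_map X Y f"
  shows "simplicial_functor (rigidification X) (rigidification Y) (rigidification_map Y f)"
proof -
  interpret X: simplicial_set X using f by (simp add: simplicial_map_def)
  interpret Y: simplicial_set Y using f by (simp add: simplicial_map_def)
  have ob: "fobj (rigidification_map Y f) = f 0" by (simp add: rigidification_map_def)
  have f0: "f 0 x \<in> Simp Y 0" if "x \<in> Simp X 0" for x using f that by (simp add: simplicial_map_def)
  note cls = rigidification_map_class[OF f]
  show ?thesis
    unfolding simplicial_functor_def simplicial_map_def ob
  proof (intro conjI ballI allI impI)
    fix x y n c assume "c \<in> Simp (Hom (rigidification X) x y) n"
    then show "fhom (rigidification_map Y f) x y n c \<in> Simp (Hom (rigidification Y) (f 0 x) (f 0 y)) n"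
      unfolding X.rig_simp_iff Y.rig_simp_iff using cls by blast
  next
    fix x y m n \<alpha> c
    assume c: "c \<in> Simp (Hom (rigidification X) x y) n" and a: "delta_map m n \<alpha>"
    then obtain w where w: "rig_word X n x y w" "c = rig_class X n x y w"
      unfolding X.rig_simp_iff by blast
    have "gen_map f (gen_act m n \<alpha> e) = gen_act m n \<alpha> (gen_map f e)" for e by (cases e) simp
    then show "fhom (rigidification_map Y f) x y m (act (Hom (rigidification X) x y) m n \<alpha> c) =
       act (Hom (rigidification Y) (f 0 x) (f 0 y)) m n \<alpha> (fhom (rigidification_map Y f) x y n c)"
      using w a by (simp add: X.rig_act_class Y.rig_act_class cls X.rig_word_gen_act o_def)
  next
    fix x assume "x \<in> Obj (rigidification X)"
    then show "fhom (rigidification_map Y f) x x 0 (Ident (rigidification X) x) =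
        Ident (rigidification Y) (f 0 x)"
      using cls(1)[of 0 x x "[]"] by (simp add: rigidification_def)
  next
    fix x y z n c d
    assume "c \<in> Simp (Hom (rigidification X) x y) n" "d \<in> Simp (Hom (rigidification X) y z) n"
    then obtain v w where vw: "rig_word X n x y v" "c = rig_class X n x y v"
      "rig_word X n y z w" "d = rig_class X n y z w" unfolding X.rig_simp_iff by blast
    have "rig_word X n x z (v @ w)" using vw X.rig_word_append by blast
    then show "fhom (rigidification_map Y f) x z n (Comp (rigidification X) x y z n d c) =
       Comp (rigidification Y) (f 0 x) (f 0 y) (f 0 z) n (fhom (rigidification_map Y f) y z n d)
        (fhom (rigidification_map Y f) x y n c)"
      using vw by (simp add: X.rig_Comp_class Y.rig_Comp_class cls)
  qed (simp_all add: X.rigidification_simplicial_category Y.rigidification_simplicial_category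
        X.rig_Hom_simplicial Y.rig_Hom_simplicial X.rig_Obj Y.rig_Obj f0)
qed

lemma op_scat_simplicial_category:
  assumes "simplicial_category C" shows "simplicial_category (op_scat C)"
proof -
  interpret simplicial_category C by fact
  have i: "ident_at (op_scat C) x n = ident_at C x n" for x n by (simp add: op_scat_def ident_at_def)
  show ?thesis
    by (rule simplicial_category.intro) (simp_all add: i, simp_all add: op_scat_def Hom_simplicial Ident_closed Comp_closed
        Comp_act Comp_assoc Comp_ident_left Comp_ident_right)
qed

context simplicial_set
begin

lemma rigidification_op_class:
  assumes w: "rig_word (op_sset X) k x y w"
  shows "fhom (rigidification_op X) x y k (rig_class (op_sset X) k x y w) =
      rig_class X k y x (rev (map (gen_rev k) w))"
proof -
  interpret op: simplicial_set "op_sset X" by (rule simplicial_set_op) unfold_locales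
  show ?thesis
    unfolding rigidification_op_def
    using op.rig_class_UN[where h = "\<lambda>w. rev (map (gen_rev k) w)", OF w rig_eq_gen_rev] by simp
qed

lemma gen_rev_act:
  "delta_map m n \<alpha> \<Longrightarrow> gen_rev m (gen_act m n \<alpha> e) = gen_act m n \<alpha> (gen_rev n e)"
  by (cases e) (auto simp: path_act restrict_eq_iff delta_map_def)

lemma rigidification_op_functor:
  "simplicial_functor (rigidification (op_sset X)) (op_scat (rigidification X)) (rigidification_op X)"
proof -
  interpret op: simplicial_set "op_sset X" by (rule simplicial_set_op) unfold_locales
  have ob: "fobj (rigidification_op X) x = x" for x by (simp add: rigidification_op_def)
  have Hom: "Hom (op_scat (rigidification X)) x y = Hom (rigidification X) y x" for x y
    by (simp add: op_scat_def)
  have op_Obj: "Obj (op_scat (rigidification X)) = Simp X 0"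
    by (simp add: op_scat_def rig_Obj)
  note cls = rigidification_op_class rig_word_rev
  show ?thesis
    unfolding simplicial_functor_def simplicial_map_def ob Hom
  proof (intro conjI ballI allI impI)
    fix x y n c assume "c \<in> Simp (Hom (rigidification (op_sset X)) x y) n"
    then show "fhom (rigidification_op X) x y n c \<in> Simp (Hom (rigidification X) y x) n"
      unfolding op.rig_simp_iff rig_simp_iff using cls by blast
  next
    fix x y m n \<alpha> c
    assume c: "c \<in> Simp (Hom (rigidification (op_sset X)) x y) n" and a: "delta_map m n \<alpha>"
    then obtain w where w: "rig_word (op_sset X) n x y w" "c = rig_class (op_sset X) n x y w"
      unfolding op.rig_simp_iff by blast
    show "fhom (rigidification_op X) x y m (act (Hom (rigidification (op_sset X)) x y) m n \<alpha> c) =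
       act (Hom (rigidification X) y x) m n \<alpha> (fhom (rigidification_op X) x y n c)"
      using w a rig_act_class[OF a cls(2)[OF w(1)]]
      by (simp add: op.rig_act_class cls(1) op.rig_word_gen_act o_def gen_rev_act rev_map)
  next
    fix x assume "x \<in> Obj (rigidification (op_sset X))"
    then show "fhom (rigidification_op X) x x 0 (Ident (rigidification (op_sset X)) x) =
        Ident (op_scat (rigidification X)) x"
      using cls(1)[of 0 x x "[]"] by (simp add: rigidification_def op_scat_def)
  next
    fix x y z n c d
    assume "c \<in> Simp (Hom (rigidification (op_sset X)) x y) n"
      "d \<in> Simp (Hom (rigidification (op_sset X)) y z) n"
    then obtain v w where vw: "rig_word (op_sset X) n x y v" "c = rig_class (op_sset X) n x y v"
      "rig_word (op_sset X) n y z w" "d = rig_class (op_sset X) n y z w"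
      unfolding op.rig_simp_iff by blast
    have "rig_word (op_sset X) n x z (v @ w)" using vw op.rig_word_append by blast
    then show "fhom (rigidification_op X) x z n (Comp (rigidification (op_sset X)) x y z n d c) =
       Comp (op_scat (rigidification X)) x y z n (fhom (rigidification_op X) y z n d)
        (fhom (rigidification_op X) x y n c)"
      using vw by (simp add: op.rig_Comp_class rig_Comp_class cls op_scat_def)
  qed (simp_all add: rigidification_simplicial_category op.rigidification_simplicial_category
        op_scat_simplicial_category rig_Hom_simplicial op.rig_Hom_simplicial rig_Obj op.rig_Obj
        op_Obj op_Simp)
qed

end

lemma dagger_rigidification_scat:
  "Obj (dagger_rigidification X) = Simp X 0"
  "Hom (dagger_rigidification X) = Hom (rigidification X)"
  "Comp (dagger_rigidification X) = Comp (rigidification X)"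
  "Ident (dagger_rigidification X) = Ident (rigidification X)"
  by (simp_all add: dagger_rigidification_def scat.defs dscat.defs rigidification_def)

lemma simplicial_category_dagger_rigidification:
  assumes "simplicial_set X" shows "simplicial_category (dagger_rigidification X)"
proof -
  interpret X: simplicial_set X by fact
  interpret R: simplicial_category "rigidification X" by (rule X.rigidification_simplicial_category)
  have i: "ident_at (dagger_rigidification X) x n = ident_at (rigidification X) x n" for x n
    by (simp add: ident_at_def dagger_rigidification_scat)
  show ?thesis
    by (rule simplicial_category.intro) (simp_all add: i, simp_all add: dagger_rigidification_scat X.rig_Obj[symmetric]
        R.Hom_simplicial R.Ident_closed R.Comp_closed R.Comp_act R.Comp_assoc R.Comp_ident_left
        R.Comp_ident_right)
qed

context dagger_simplicial_set
begin

lemma dagger_rigidification_class: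
  assumes w: "rig_word X k x y w"
  shows "Dag (dagger_rigidification X) x y k (rig_class X k x y w) =
      rig_class X k y x (rev (map (gen_rev k) (map (gen_map (dag X)) w)))"
    and "rig_word X k y x (rev (map (gen_rev k) (map (gen_map (dag X)) w)))"
proof -
  note m = rigidification_map_class[OF dag_map w]
  have xy: "dag X 0 x = x" "dag X 0 y = y" using rig_word_ends[OF w] dag_vertex by auto
  then show "rig_word X k y x (rev (map (gen_rev k) (map (gen_map (dag X)) w)))"
    using m(2) rig_word_rev[of k x y "map (gen_map (dag X)) w"] by simp
  have ob: "fobj (rigidification_map (op_sset X) (dag X)) = dag X 0"
    by (simp add: rigidification_map_def)
  show "Dag (dagger_rigidification X) x y k (rig_class X k x y w) =
      rig_class X k y x (rev (map (gen_rev k) (map (gen_map (dag X)) w)))"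
    using m xy rigidification_op_class[of k x y "map (gen_map (dag X)) w"]
    by (simp add: dagger_rigidification_def scat.defs dscat.defs sfun_comp_def ob)
qed

lemma dagger_rigidification_category: "dagger_simplicial_category (dagger_rigidification X)"
proof -
  interpret R: simplicial_category "dagger_rigidification X"
    by (rule simplicial_category_dagger_rigidification) unfold_locales
  note cls = dagger_rigidification_class
  show ?thesis
  proof
    fix x y assume "x \<in> Obj (dagger_rigidification X)" "y \<in> Obj (dagger_rigidification X)"
    show "simplicial_map (Hom (dagger_rigidification X) x y) (Hom (dagger_rigidification X) y x)
        (Dag (dagger_rigidification X) x y)"
      unfolding simplicial_map_def dagger_rigidification_scat
    proof (intro conjI ballI allI impI)
      fix n c assume "c \<in> Simp (Hom (rigidification X) x y) n"
      then show "Dag (dagger_rigidification X) x y n c \<in> Simp (Hom (rigidification X) y x) n"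
        unfolding rig_simp_iff using cls by blast
    next
      fix m n \<alpha> c
      assume c: "c \<in> Simp (Hom (rigidification X) x y) n" and a: "delta_map m n \<alpha>"
      then obtain w where w: "rig_word X n x y w" "c = rig_class X n x y w"
        unfolding rig_simp_iff by blast
      have "gen_map (dag X) (gen_act m n \<alpha> e) = gen_act m n \<alpha> (gen_map (dag X) e)" for e
        by (cases e) simp
      then show "Dag (dagger_rigidification X) x y m (act (Hom (rigidification X) x y) m n \<alpha> c) =
         act (Hom (rigidification X) y x) m n \<alpha> (Dag (dagger_rigidification X) x y n c)"
        using w a rig_act_class[OF a cls(2)[OF w(1)]]
        by (simp add: rig_act_class cls(1) rig_word_gen_act o_def gen_rev_act rev_map)
    qed (rule rig_Hom_simplicial)+
  next
    fix x y c n assume "c \<in> Simp (Hom (dagger_rigidification X) x y) n"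
    then obtain w where w: "rig_word X n x y w" "c = rig_class X n x y w"
      unfolding rig_simp_iff dagger_rigidification_scat by blast
    have "gen_rev n (gen_map (dag X) (gen_rev n (gen_map (dag X) e))) = e" if "rig_gen X n e" for e
    proof -
      obtain p \<sigma> i j T where e: "e = (p, \<sigma>, i, j, T)" by (cases e)
      have "(\<lambda>t. p - (p - t)) ` T l = T l" if "l \<le> n" for l
      proof -
        have "T l \<subseteq> {..p}" using \<open>rig_gen X n e\<close> that by (fastforce simp: e path_simp_iff)
        then have "(\<lambda>t. p - (p - t)) ` T l = (\<lambda>t. t) ` T l" by (intro image_cong) auto
        then show ?thesis by simp
      qed
      then have "restrict (\<lambda>l. (\<lambda>t. p - t) ` restrict (\<lambda>l. (\<lambda>t. p - t) ` T l) {..n} l) {..n} = restrict T {..n}"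
        by (simp add: restrict_eq_iff image_image)
      then show ?thesis using that by (simp add: e dag_dag path_simp_iff extensional_restrict)
    qed
    then have "rig_word X n x y w \<Longrightarrow>
        map (\<lambda>e. gen_rev n (gen_map (dag X) (gen_rev n (gen_map (dag X) e)))) w = w"
      by (induction w arbitrary: x) auto
    then show "Dag (dagger_rigidification X) y x n (Dag (dagger_rigidification X) x y n c) = c"
      using w cls(1)[OF cls(2)[OF w(1)]] by (simp add: cls(1) rev_map o_def)
  next
    fix x assume "x \<in> Obj (dagger_rigidification X)"
    then show "Dag (dagger_rigidification X) x x 0 (Ident (dagger_rigidification X) x) =
        Ident (dagger_rigidification X) x"
      using cls(1)[of 0 x x "[]"] unfolding dagger_rigidification_scat by (simp add: rigidification_def)
  next
    fix x y z c n d
    assume "c \<in> Simp (Hom (dagger_rigidification X) x y) n"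
      "d \<in> Simp (Hom (dagger_rigidification X) y z) n"
    then obtain v w where vw: "rig_word X n x y v" "c = rig_class X n x y v"
      "rig_word X n y z w" "d = rig_class X n y z w"
      unfolding rig_simp_iff dagger_rigidification_scat by blast
    have "rig_word X n x z (v @ w)" using vw rig_word_append by blast
    then show "Dag (dagger_rigidification X) x z n (Comp (dagger_rigidification X) x y z n d c) =
       Comp (dagger_rigidification X) z y x n (Dag (dagger_rigidification X) x y n c)
        (Dag (dagger_rigidification X) y z n d)"
      using vw rig_Comp_class[OF cls(2)[OF vw(3)] cls(2)[OF vw(1)]] unfolding dagger_rigidification_scat
      by (simp add: rig_Comp_class cls(1))
  qed
qed

end

lemma dagger_rigidification_functor:
  assumes f: "dagger_map X Y f"
  shows "dagger_functor (dagger_rigidification X) (dagger_rigidification Y) (rigidification_map Y f)"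
proof -
  interpret X: dagger_simplicial_set X using f by (simp add: dagger_map_def)
  interpret Y: dagger_simplicial_set Y using f by (simp add: dagger_map_def)
  have m: "simplicial_map X Y f" using f by (simp add: dagger_map_def)
  note cls = rigidification_map_class[OF m]
  have ob: "fobj (rigidification_map Y f) = f 0" by (simp add: rigidification_map_def)
  have sf: "simplicial_functor (dagger_rigidification X) (dagger_rigidification Y)
      (rigidification_map Y f)"
    using rigidification_map_functor[OF m]
    by (simp add: simplicial_functor_def dagger_rigidification_scat X.rig_Obj Y.rig_Obj
        simplicial_category_dagger_rigidification X.simplicial_set_axioms Y.simplicial_set_axioms)
  show ?thesis
    unfolding dagger_functor_def ob
  proof (intro conjI ballI allI)
    fix x y n c assume c: "c \<in> Simp (Hom (dagger_rigidification X) x y) n"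
    obtain w where w: "rig_word X n x y w" "c = rig_class X n x y w"
      using c unfolding X.rig_simp_iff dagger_rigidification_scat by blast
    have "gen_map f (gen_rev n (gen_map (dag X) e)) = gen_rev n (gen_map (dag Y) (gen_map f e))"
      if "rig_gen X n e" for e
      using that f by (cases e) (simp add: dagger_map_def)
    then have "rig_word X n x y w \<Longrightarrow> map (\<lambda>e. gen_map f (gen_rev n (gen_map (dag X) e))) (rev w) =
        map (\<lambda>e. gen_rev n (gen_map (dag Y) (gen_map f e))) (rev w)"
      by (induction w arbitrary: x) auto
    then show "fhom (rigidification_map Y f) y x n (Dag (dagger_rigidification X) x y n c) =
       Dag (dagger_rigidification Y) (f 0 x) (f 0 y) n (fhom (rigidification_map Y f) x y n c)"
      using w cls(1)[OF X.dagger_rigidification_class(2)[OF w(1)]]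
        Y.dagger_rigidification_class(1)[OF cls(2)[OF w(1)]]
      by (simp add: X.dagger_rigidification_class(1) cls(1) rev_map o_def del: map_eq_conv)
  qed (simp_all add: X.dagger_rigidification_category Y.dagger_rigidification_category sf)
qed



section \<open>Monomorphisms of dagger simplicial sets\<close>

text \<open>Degreewise injections, as in \<^const>\<open>dagger_mono\<close>, are exactly the left-cancellable morphisms.\<close>

lemma dagger_mono_cancel:
  assumes f: "dagger_mono X Y f" and g: "dagger_map Z X g" and h: "dagger_map Z X h"
    and eq: "\<And>n z. z \<in> Simp Z n \<Longrightarrow> f n (g n z) = f n (h n z)" and z: "z \<in> Simp Z n"
  shows "g n z = h n z"
proof -
  have "g n z \<in> Simp X n" "h n z \<in> Simp X n"
    using g h z by (simp_all add: dagger_map_def simplicial_map_def)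
  then show ?thesis using f eq[OF z] by (auto simp: dagger_mono_def dest: inj_onD)
qed

lemma dagger_monoI:
  fixes X :: "('a, 'y) dsset_scheme"
  assumes f: "dagger_map X Y f"
    and c: "\<And>(Z :: ('a \<times> 'a) dsset) g h n z. dagger_map Z X g \<Longrightarrow> dagger_map Z X h \<Longrightarrow>
      (\<And>n z. z \<in> Simp Z n \<Longrightarrow> f n (g n z) = f n (h n z)) \<Longrightarrow> z \<in> Simp Z n \<Longrightarrow> g n z = h n z"
  shows "dagger_mono X Y f"
proof -
  interpret X: dagger_simplicial_set X using f by (simp add: dagger_map_def)
  let ?Z = "\<lparr>Simp = (\<lambda>n. {(x, y). x \<in> Simp X n \<and> y \<in> Simp X n \<and> f n x = f n y}),
    act = (\<lambda>m n \<alpha>. map_prod (act X m n \<alpha>) (act X m n \<alpha>)), dag = (\<lambda>n. map_prod (dag X n) (dag X n))\<rparr>"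
  have fa: "f m (act X m n \<alpha> x) = act Y m n \<alpha> (f n x)" if "x \<in> Simp X n" "delta_map m n \<alpha>" for m n \<alpha> x
    using f that by (simp add: dagger_map_def simplicial_map_def)
  have fd: "f n (dag X n x) = dag Y n (f n x)" if "x \<in> Simp X n" for n x
    using f that by (simp add: dagger_map_def)
  have dc: "dag X n x \<in> Simp X n" if "x \<in> Simp X n" for n x
    using X.dag_map that by (simp add: simplicial_map_def op_Simp)
  have da: "dag X m (act X m n \<alpha> x) = act X m n (\<lambda>i. n - \<alpha> (m - i)) (dag X n x)"
    if "x \<in> Simp X n" "delta_map m n \<alpha>" for m n \<alpha> x
    using X.dag_map that by (simp add: simplicial_map_def op_act)
  interpret Z: simplicial_set ?Z
  proof
    fix m n \<alpha> \<beta> x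
    assume "delta_map m n \<alpha>" "\<And>i. i \<le> m \<Longrightarrow> \<alpha> i = \<beta> i" "x \<in> Simp ?Z n"
    then show "act ?Z m n \<alpha> x = act ?Z m n \<beta> x"
      using X.act_cong[of m n \<alpha> \<beta> "fst x"] X.act_cong[of m n \<alpha> \<beta> "snd x"] by (cases x) simp
  qed (auto simp: X.act_closed X.act_id X.act_comp fa)
  have dZ: "dagger_simplicial_set ?Z"
    by (intro dagger_simplicial_set.intro dagger_simplicial_set_axioms.intro Z.simplicial_set_axioms)
       (auto simp: simplicial_map_def Z.simplicial_set_axioms simplicial_set_op op_Simp op_act dc da fd
         X.dag_dag X.dag_vertex)
  have "dagger_map ?Z X (\<lambda>_. fst)" "dagger_map ?Z X (\<lambda>_. snd)"
    by (auto simp: dagger_map_def simplicial_map_def dZ Z.simplicial_set_axioms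
        X.dagger_simplicial_set_axioms X.simplicial_set_axioms)
  from c[OF this] have "x = y" if "x \<in> Simp X n" "y \<in> Simp X n" "f n x = f n y" for n x y
    using that by (force simp: split_beta)
  then show ?thesis using f by (auto simp: dagger_mono_def inj_on_def)
qed


section \<open>Rigidification is left adjoint to the homotopy coherent nerve\<close>

text \<open>
  An \<open>n\<close>-simplex of the coherent nerve of \<open>D\<close> is a simplicial functor from \<open>\<CC>[\<Delta>\<^sup>n]\<close> to \<open>D\<close>; functors
  are made canonical by fixing their values outside the category.
\<close>

definition sfun_restrict ::
  "('o, 'm, 'z) scat_scheme \<Rightarrow> ('o, 'm, 'p, 'q) sfun \<Rightarrow> ('o, 'm, 'p, 'q) sfun" where
  "sfun_restrict C F = \<lparr>fobj = restrict (fobj F) (Obj C),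
     fhom = (\<lambda>x y n f. if x \<in> Obj C \<and> y \<in> Obj C \<and> f \<in> Simp (Hom C x y) n
                        then fhom F x y n f else undefined)\<rparr>"

definition coherent_nerve ::
  "('p, 'q, 'z) scat_scheme \<Rightarrow> (nat, nat \<Rightarrow> nat set, 'p, 'q) sfun sset" where
  "coherent_nerve D =
     \<lparr>Simp = (\<lambda>n. {F. simplicial_functor (path_category n) D F \<and> sfun_restrict (path_category n) F = F}),
      act = (\<lambda>m n \<alpha> F. sfun_restrict (path_category m) (sfun_comp F (path_functor \<alpha>)))\<rparr>"

lemma sfun_restrict_eq_iff: "sfun_restrict C F = sfun_restrict C G \<longleftrightarrow> sfun_eq C F G"
proof
  assume e: "sfun_restrict C F = sfun_restrict C G"
  have "fobj F x = fobj G x" if "x \<in> Obj C" for x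
    using arg_cong[OF e, of "\<lambda>H. fobj H x"] that by (simp add: sfun_restrict_def)
  moreover have "fhom F x y n f = fhom G x y n f"
    if "x \<in> Obj C" "y \<in> Obj C" "f \<in> Simp (Hom C x y) n" for x y n f
    using arg_cong[OF e, of "\<lambda>H. fhom H x y n f"] that by (simp add: sfun_restrict_def)
  ultimately show "sfun_eq C F G" by (simp add: sfun_eq_def)
next
  assume "sfun_eq C F G"
  then show "sfun_restrict C F = sfun_restrict C G"
    by (auto simp: sfun_eq_def sfun_restrict_def fun_eq_iff)
qed

lemma sfun_eq_restrict: "sfun_eq C (sfun_restrict C F) F"
  by (simp add: sfun_eq_def sfun_restrict_def)

lemma simplicial_functor_cong:
  assumes F: "simplicial_functor C D F" and e: "sfun_eq C F G"
  shows "simplicial_functor C D G"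
proof -
  interpret C: simplicial_category C using F by (simp add: simplicial_functor_def)
  have o: "fobj G x = fobj F x" if "x \<in> Obj C" for x using e that by (simp add: sfun_eq_def)
  have h: "fhom G x y n f = fhom F x y n f"
    if "x \<in> Obj C" "y \<in> Obj C" "f \<in> Simp (Hom C x y) n" for x y n f
    using e that by (simp add: sfun_eq_def)
  have "simplicial_map (Hom C x y) (Hom D (fobj G x) (fobj G y)) (fhom G x y)"
    if xy: "x \<in> Obj C" "y \<in> Obj C" for x y
  proof -
    have "simplicial_map (Hom C x y) (Hom D (fobj F x) (fobj F y)) (fhom F x y)"
      using F xy by (simp add: simplicial_functor_def)
    then show ?thesis using simplicial_set.act_closed[OF C.Hom_simplicial[OF xy]]
      by (simp add: simplicial_map_def o h xy)
  qed
  then show ?thesis using F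
    by (simp add: simplicial_functor_def o h C.Ident_closed C.Comp_closed)
qed

lemma simplicial_functor_comp:
  assumes F: "simplicial_functor C D F" and G: "simplicial_functor D E G"
  shows "simplicial_functor C E (sfun_comp G F)"
proof -
  have Fh: "fhom F x y n f \<in> Simp (Hom D (fobj F x) (fobj F y)) n"
    if "x \<in> Obj C" "y \<in> Obj C" "f \<in> Simp (Hom C x y) n" for x y n f
    using F that by (simp add: simplicial_functor_def simplicial_map_def)
  have "simplicial_map (Hom C x y) (Hom E (fobj G (fobj F x)) (fobj G (fobj F y)))
      (\<lambda>n f. fhom G (fobj F x) (fobj F y) n (fhom F x y n f))"
    if xy: "x \<in> Obj C" "y \<in> Obj C" for x y
  proof -
    have "simplicial_map (Hom C x y) (Hom D (fobj F x) (fobj F y)) (fhom F x y)"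
      using F xy by (simp add: simplicial_functor_def)
    moreover have "simplicial_map (Hom D (fobj F x) (fobj F y))
       (Hom E (fobj G (fobj F x)) (fobj G (fobj F y))) (fhom G (fobj F x) (fobj F y))"
      using F G xy by (simp add: simplicial_functor_def)
    ultimately show ?thesis by (simp add: simplicial_map_def)
  qed
  then show ?thesis using F G Fh
    by (simp add: simplicial_functor_def sfun_comp_def)
qed

lemma sfun_eq_comp:
  assumes "simplicial_functor C D F" "sfun_eq C F F'" "sfun_eq D G G'"
  shows "sfun_eq C (sfun_comp G F) (sfun_comp G' F')"
  using assms by (auto simp: sfun_eq_def sfun_comp_def simplicial_functor_def simplicial_map_def)

lemma sfun_eq_refl: "sfun_eq C F F" by (simp add: sfun_eq_def)

lemma sfun_eq_sym: "sfun_eq C F G \<Longrightarrow> sfun_eq C G F" by (simp add: sfun_eq_def)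

lemma sfun_eq_trans: "sfun_eq C F G \<Longrightarrow> sfun_eq C G H \<Longrightarrow> sfun_eq C F H"
  by (simp add: sfun_eq_def)

lemma path_functor_comp:
  "sfun_comp (path_functor \<alpha>) (path_functor \<beta>) = path_functor (\<lambda>i. \<alpha> (\<beta> i))"
  by (auto simp: sfun_comp_def path_functor_def fun_eq_iff image_image restrict_def)

lemma path_functor_eq:
  assumes "\<And>i. i \<le> m \<Longrightarrow> \<alpha> i = \<beta> i"
  shows "sfun_eq (path_category m) (path_functor \<alpha>) (path_functor \<beta>)"
proof -
  have "\<alpha> ` T l = \<beta> ` T l" if "j \<le> m" "T \<in> Simp (Hom (path_category m) i j) k" "l \<le> k" for i j T k l
  proof (rule image_cong)
    fix t assume "t \<in> T l"
    moreover have "T l \<subseteq> {i..j}" using that unfolding path_simp_iff by blast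
    ultimately show "\<alpha> t = \<beta> t" using assms that by auto
  qed simp
  then show ?thesis using assms
    by (auto simp: sfun_eq_def path_Obj path_functor_simp restrict_eq_iff)
qed

lemma sfun_comp_assoc: "sfun_comp H (sfun_comp G F) = sfun_comp (sfun_comp H G) F"
  by (simp add: sfun_comp_def)

lemma coherent_nerve_simp_iff:
  "F \<in> Simp (coherent_nerve D) n \<longleftrightarrow>
     simplicial_functor (path_category n) D F \<and> sfun_restrict (path_category n) F = F"
  by (simp add: coherent_nerve_def)

lemma coherent_nerve_act:
  "act (coherent_nerve D) m n \<alpha> F = sfun_restrict (path_category m) (sfun_comp F (path_functor \<alpha>))"
  by (simp add: coherent_nerve_def)

lemma coherent_nerve_simplicial_set: "simplicial_set (coherent_nerve D)"
proof
  fix m n \<alpha> F assume a: "delta_map m n \<alpha>" and F: "F \<in> Simp (coherent_nerve D) n"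
  have "simplicial_functor (path_category m) D (sfun_comp F (path_functor \<alpha>))"
    using simplicial_functor_comp path_functor_functor[OF a] F coherent_nerve_simp_iff by blast
  then show "act (coherent_nerve D) m n \<alpha> F \<in> Simp (coherent_nerve D) m"
    unfolding coherent_nerve_simp_iff coherent_nerve_act
    using simplicial_functor_cong sfun_eq_sym[OF sfun_eq_restrict] sfun_eq_restrict
    by (simp add: sfun_restrict_eq_iff) blast
next
  fix m n \<alpha> \<beta> F
  assume a: "delta_map m n \<alpha>" and "\<And>i. i \<le> m \<Longrightarrow> \<alpha> i = \<beta> i" and F: "F \<in> Simp (coherent_nerve D) n"
  then show "act (coherent_nerve D) m n \<alpha> F = act (coherent_nerve D) m n \<beta> F"
    unfolding coherent_nerve_act sfun_restrict_eq_iff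
    by (intro sfun_eq_comp[OF path_functor_functor[OF a]] path_functor_eq sfun_eq_refl)
next
  fix n F assume F: "F \<in> Simp (coherent_nerve D) n"
  have "sfun_eq (path_category n) (sfun_comp F (path_functor (\<lambda>i. i))) F"
    by (simp add: sfun_eq_def sfun_comp_def path_functor_simp path_simp_iff extensional_restrict)
  then show "act (coherent_nerve D) n n (\<lambda>i. i) F = F"
    using F unfolding coherent_nerve_act coherent_nerve_simp_iff
    by (metis sfun_restrict_eq_iff)
next
  fix k m \<beta> n \<alpha> F
  assume b: "delta_map k m \<beta>" and a: "delta_map m n \<alpha>" and "F \<in> Simp (coherent_nerve D) n"
  have "sfun_eq (path_category k) (sfun_comp (sfun_comp F (path_functor \<alpha>)) (path_functor \<beta>))
      (sfun_comp (sfun_restrict (path_category m) (sfun_comp F (path_functor \<alpha>))) (path_functor \<beta>))"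
    by (intro sfun_eq_comp[OF path_functor_functor[OF b]] sfun_eq_refl sfun_eq_sym[OF sfun_eq_restrict])
  then show "act (coherent_nerve D) k n (\<lambda>i. \<alpha> (\<beta> i)) F =
      act (coherent_nerve D) k m \<beta> (act (coherent_nerve D) m n \<alpha> F)"
    unfolding coherent_nerve_act sfun_restrict_eq_iff path_functor_comp[symmetric] sfun_comp_assoc .
qed

definition rigidification_unit ::
  "('a, 'z) sset_scheme \<Rightarrow> nat \<Rightarrow> 'a \<Rightarrow> (nat, nat \<Rightarrow> nat set, 'a, 'a gen list set) sfun" where
  "rigidification_unit X n \<sigma> = sfun_restrict (path_category n)
     \<lparr>fobj = vertex X n \<sigma>,
      fhom = (\<lambda>i j k T. rig_class X k (vertex X n \<sigma> i) (vertex X n \<sigma> j) [(n, \<sigma>, i, j, T)])\<rparr>"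

context simplicial_set
begin

lemma rigidification_unit_simp:
  "i \<le> n \<Longrightarrow> fobj (rigidification_unit X n \<sigma>) i = vertex X n \<sigma> i"
  "i \<le> n \<Longrightarrow> j \<le> n \<Longrightarrow> T \<in> Simp (Hom (path_category n) i j) k \<Longrightarrow>
   fhom (rigidification_unit X n \<sigma>) i j k T =
     rig_class X k (vertex X n \<sigma> i) (vertex X n \<sigma> j) [(n, \<sigma>, i, j, T)]"
  by (simp_all add: rigidification_unit_def sfun_restrict_def path_Obj)

lemma rigidification_unit_functor:
  assumes s: "\<sigma> \<in> Simp X n"
  shows "simplicial_functor (path_category n) (rigidification X) (rigidification_unit X n \<sigma>)"
proof -
  have w: "rig_word X k (vertex X n \<sigma> i) (vertex X n \<sigma> j) [(n, \<sigma>, i, j, T)]"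
    if "i \<le> n" "j \<le> n" "T \<in> Simp (Hom (path_category n) i j) k" for i j k T
    using that s vertex_closed by simp
  note us = rigidification_unit_simp
  have ac: "act (Hom (path_category n) i j) k' k \<alpha> T \<in> Simp (Hom (path_category n) i j) k'"
    if "delta_map k' k \<alpha>" "T \<in> Simp (Hom (path_category n) i j) k" for i j k k' \<alpha> T
    using simplicial_set.act_closed[OF path_Hom_simplicial] that by blast
  show ?thesis
    unfolding simplicial_functor_def simplicial_map_def path_Obj
  proof (intro conjI ballI allI impI)
    fix i j k T
    assume a: "i \<in> {..n}" "j \<in> {..n}" "T \<in> Simp (Hom (path_category n) i j) k"
    then have "rig_word X k (vertex X n \<sigma> i) (vertex X n \<sigma> j) [(n, \<sigma>, i, j, T)]" by (intro w) auto
    then show "fhom (rigidification_unit X n \<sigma>) i j k T \<in> Simp (Hom (rigidification X)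
        (fobj (rigidification_unit X n \<sigma>) i) (fobj (rigidification_unit X n \<sigma>) j)) k"
      unfolding rig_simp_iff using a us by (metis atMost_iff)
  next
    fix i j k' k \<alpha> T assume "i \<in> {..n}" "j \<in> {..n}" "T \<in> Simp (Hom (path_category n) i j) k"
      "delta_map k' k \<alpha>"
    then show "fhom (rigidification_unit X n \<sigma>) i j k' (act (Hom (path_category n) i j) k' k \<alpha> T) =
       act (Hom (rigidification X) (fobj (rigidification_unit X n \<sigma>) i)
          (fobj (rigidification_unit X n \<sigma>) j)) k' k \<alpha> (fhom (rigidification_unit X n \<sigma>) i j k T)"
      using w[of i j T k] ac by (simp add: us rig_act_class)
  next
    fix i assume i: "i \<in> {..n}"
    have "ident_at (path_category n) i 0 = Ident (path_category n) i"
      by (simp add: path_ident_at path_Ident)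
    then have "rig_class X 0 (vertex X n \<sigma> i) (vertex X n \<sigma> i) [(n, \<sigma>, i, i, Ident (path_category n) i)] =
       rig_class X 0 (vertex X n \<sigma> i) (vertex X n \<sigma> i) []"
      using rig_class_eqI[OF rig_ident[OF s, of i 0]] i by simp
    then show "fhom (rigidification_unit X n \<sigma>) i i 0 (Ident (path_category n) i) =
         Ident (rigidification X) (fobj (rigidification_unit X n \<sigma>) i)"
      using i simplicial_category.Ident_closed[OF path_simplicial_category, of i n]
      by (simp add: us rigidification_def path_Obj)
  next
    fix i j l k S T assume "i \<in> {..n}" "j \<in> {..n}" "l \<in> {..n}"
      "S \<in> Simp (Hom (path_category n) i j) k" "T \<in> Simp (Hom (path_category n) j l) k"
    then show "fhom (rigidification_unit X n \<sigma>) i l k (Comp (path_category n) i j l k T S) =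
       Comp (rigidification X) (fobj (rigidification_unit X n \<sigma>) i)
        (fobj (rigidification_unit X n \<sigma>) j) (fobj (rigidification_unit X n \<sigma>) l) k
        (fhom (rigidification_unit X n \<sigma>) j l k T) (fhom (rigidification_unit X n \<sigma>) i j k S)"
      using w[of i j S k] w[of j l T k] rig_class_eqI[OF rig_comp[OF s, of i j l S k T]]
      by (simp add: us rig_Comp_class path_Comp_closed)
  qed (auto simp: path_simplicial_category rigidification_simplicial_category path_Hom_simplicial
        rig_Hom_simplicial rig_Obj us vertex_closed s)
qed

lemma rigidification_unit_restrict:
  "sfun_restrict (path_category n) (rigidification_unit X n \<sigma>) = rigidification_unit X n \<sigma>"
  by (simp add: rigidification_unit_def sfun_restrict_eq_iff sfun_eq_restrict)

lemma rigidification_unit_map: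
  "simplicial_map X (coherent_nerve (rigidification X)) (rigidification_unit X)"
  unfolding simplicial_map_def
proof (intro conjI ballI allI impI)
  fix n \<sigma> assume "\<sigma> \<in> Simp X n"
  then show "rigidification_unit X n \<sigma> \<in> Simp (coherent_nerve (rigidification X)) n"
    unfolding coherent_nerve_simp_iff
    by (simp add: rigidification_unit_functor rigidification_unit_restrict)
next
  fix m n \<alpha> \<sigma> assume s: "\<sigma> \<in> Simp X n" and a: "delta_map m n \<alpha>"
  have "sfun_eq (path_category m) (rigidification_unit X m (act X m n \<alpha> \<sigma>))
     (sfun_comp (rigidification_unit X n \<sigma>) (path_functor \<alpha>))"
    unfolding sfun_eq_def path_Obj
  proof (intro conjI ballI allI)
    fix i assume "i \<in> {..m}"
    then show "fobj (rigidification_unit X m (act X m n \<alpha> \<sigma>)) i =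
         fobj (sfun_comp (rigidification_unit X n \<sigma>) (path_functor \<alpha>)) i"
      using a s by (simp add: sfun_comp_def path_functor_simp rigidification_unit_simp vertex_act delta_mapD(1))
  next
    fix i j k T assume ij: "i \<in> {..m}" "j \<in> {..m}" "T \<in> Simp (Hom (path_category m) i j) k"
    then show "fhom (rigidification_unit X m (act X m n \<alpha> \<sigma>)) i j k T =
         fhom (sfun_comp (rigidification_unit X n \<sigma>) (path_functor \<alpha>)) i j k T"
      using a s rig_class_eqI[OF rig_act[OF s a, of i j T k]] path_functor_closed[OF a _ _ ij(3)]
      by (simp add: sfun_comp_def rigidification_unit_simp vertex_act delta_mapD(1)
          path_functor_simp(1))
  qed
  then show "rigidification_unit X m (act X m n \<alpha> \<sigma>) =
      act (coherent_nerve (rigidification X)) m n \<alpha> (rigidification_unit X n \<sigma>)"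
    unfolding coherent_nerve_act by (metis rigidification_unit_restrict sfun_restrict_eq_iff)
qed (simp_all add: simplicial_set_axioms coherent_nerve_simplicial_set)

end

fun word_eval ::
  "('a, 'z) sset_scheme \<Rightarrow> ('p, 'q, 'y) scat_scheme \<Rightarrow>
   (nat \<Rightarrow> 'a \<Rightarrow> (nat, nat \<Rightarrow> nat set, 'p, 'q) sfun) \<Rightarrow> nat \<Rightarrow> 'a \<Rightarrow> 'a \<Rightarrow> 'a gen list \<Rightarrow> 'q" where
  "word_eval X D g k x y [] = ident_at D (fobj (g 0 x) 0) k"
| "word_eval X D g k x y ((n, \<sigma>, i, j, T) # w) =
     Comp D (fobj (g 0 x) 0) (fobj (g 0 (vertex X n \<sigma> j)) 0) (fobj (g 0 y) 0) k
       (word_eval X D g k (vertex X n \<sigma> j) y w) (fhom (g n \<sigma>) i j k T)"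

locale rigidification_adjunct = simplicial_set X + D: simplicial_category D
  for X :: "('a, 'z) sset_scheme" and D :: "('p, 'q, 'y) scat_scheme" +
  fixes g :: "nat \<Rightarrow> 'a \<Rightarrow> (nat, nat \<Rightarrow> nat set, 'p, 'q) sfun"
  assumes g: "simplicial_map X (coherent_nerve D) g"
begin

abbreviation ob :: "'a \<Rightarrow> 'p" where "ob x \<equiv> fobj (g 0 x) 0"

abbreviation ev :: "nat \<Rightarrow> 'a \<Rightarrow> 'a \<Rightarrow> 'a gen list \<Rightarrow> 'q" where "ev \<equiv> word_eval X D g"

lemma g_functor: "\<sigma> \<in> Simp X n \<Longrightarrow> simplicial_functor (path_category n) D (g n \<sigma>)"
  using g by (simp add: simplicial_map_def coherent_nerve_simp_iff)

lemma g_natural: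
  assumes "delta_map m n \<alpha>" "\<sigma> \<in> Simp X n"
  shows "sfun_eq (path_category m) (g m (act X m n \<alpha> \<sigma>)) (sfun_comp (g n \<sigma>) (path_functor \<alpha>))"
proof -
  have "g m (act X m n \<alpha> \<sigma>) = sfun_restrict (path_category m) (sfun_comp (g n \<sigma>) (path_functor \<alpha>))"
    using g assms by (simp add: simplicial_map_def coherent_nerve_act)
  then show ?thesis by (simp add: sfun_eq_restrict)
qed

lemma ob_vertex:
  assumes "\<sigma> \<in> Simp X n" "i \<le> n" shows "ob (vertex X n \<sigma> i) = fobj (g n \<sigma>) i"
  using g_natural[of 0 n "\<lambda>_. i" \<sigma>] assms
  by (simp add: delta_map_def vertex_def sfun_eq_def path_Obj sfun_comp_def path_functor_simp(1))

lemma ob_closed: "x \<in> Simp X 0 \<Longrightarrow> ob x \<in> Obj D"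
  using g_functor[of x 0] by (simp add: simplicial_functor_def path_Obj)

lemma gen_closed:
  assumes "\<sigma> \<in> Simp X n" "i \<le> n" "j \<le> n" "T \<in> Simp (Hom (path_category n) i j) k"
  shows "fhom (g n \<sigma>) i j k T \<in> Simp (Hom D (ob (vertex X n \<sigma> i)) (ob (vertex X n \<sigma> j))) k"
  using g_functor[OF assms(1)] assms
  by (simp add: ob_vertex simplicial_functor_def simplicial_map_def path_Obj)

lemma ident_closed: "x \<in> Simp X 0 \<Longrightarrow> ident_at D (ob x) k \<in> Simp (Hom D (ob x) (ob x)) k"
  by (rule ident_at_closed[OF D.simplicial_category_axioms ob_closed])

lemma ev_closed: "rig_word X k x y w \<Longrightarrow> ev k x y w \<in> Simp (Hom D (ob x) (ob y)) k"
proof (induction w arbitrary: x)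
  case Nil
  then show ?case by (auto simp: ident_closed)
next
  case (Cons e w)
  obtain n \<sigma> i j T where e: "e = (n, \<sigma>, i, j, T)" by (cases e)
  have p: "\<sigma> \<in> Simp X n" "i \<le> n" "j \<le> n" "T \<in> Simp (Hom (path_category n) i j) k"
    "vertex X n \<sigma> i = x" "rig_word X k (vertex X n \<sigma> j) y w" using Cons.prems by (simp_all add: e)
  have "x \<in> Simp X 0" "vertex X n \<sigma> j \<in> Simp X 0" "y \<in> Simp X 0"
    using rig_word_ends[OF Cons.prems] rig_word_ends[OF p(6)] by auto
  then show ?case
    using D.Comp_closed[OF ob_closed ob_closed ob_closed] gen_closed[OF p(1-4)] Cons.IH[OF p(6)] p(5)
    by (simp add: e)
qed

lemma ev_single:
  assumes "\<sigma> \<in> Simp X n" "i \<le> n" "j \<le> n" "T \<in> Simp (Hom (path_category n) i j) k"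
  shows "ev k (vertex X n \<sigma> i) (vertex X n \<sigma> j) [(n, \<sigma>, i, j, T)] = fhom (g n \<sigma>) i j k T"
  using D.Comp_ident_left[OF ob_closed ob_closed gen_closed[OF assms]] assms vertex_closed by simp

lemma ev_append:
  "rig_word X k x y v \<Longrightarrow> rig_word X k y z w \<Longrightarrow>
   ev k x z (v @ w) = Comp D (ob x) (ob y) (ob z) k (ev k y z w) (ev k x y v)"
proof (induction v arbitrary: x)
  case Nil
  then have "x = y" "y \<in> Simp X 0" "z \<in> Simp X 0" using rig_word_ends[OF Nil(2)] by auto
  then show ?case using D.Comp_ident_right[OF ob_closed ob_closed ev_closed[OF Nil(2)]] by simp
next
  case (Cons e v)
  obtain n \<sigma> i j T where e: "e = (n, \<sigma>, i, j, T)" by (cases e)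
  have p: "\<sigma> \<in> Simp X n" "i \<le> n" "j \<le> n" "T \<in> Simp (Hom (path_category n) i j) k"
    "vertex X n \<sigma> i = x" "rig_word X k (vertex X n \<sigma> j) y v" using Cons.prems by (simp_all add: e)
  have o: "x \<in> Simp X 0" "vertex X n \<sigma> j \<in> Simp X 0" "y \<in> Simp X 0" "z \<in> Simp X 0"
    using rig_word_ends[OF Cons.prems(1)] rig_word_ends[OF p(6)] rig_word_ends[OF Cons.prems(2)]
    by auto
  have gc: "fhom (g n \<sigma>) i j k T \<in> Simp (Hom D (ob x) (ob (vertex X n \<sigma> j))) k"
    using gen_closed[OF p(1-4)] p(5) by simp
  show ?case
    using Cons.IH[OF p(6) Cons.prems(2)]
      D.Comp_assoc[OF ob_closed[OF o(1)] ob_closed[OF o(2)] ob_closed[OF o(3)] ob_closed[OF o(4)]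
        gc ev_closed[OF p(6)] ev_closed[OF Cons.prems(2)]]
    by (simp add: e)
qed

lemma ev_eq: "rig_eq X k x y v w \<Longrightarrow> ev k x y v = ev k x y w"
proof (induction rule: rig_eq.induct)
  case (rig_append x y v v' z w w')
  then show ?case
    using rig_eq_words[OF rig_append.hyps(1)] rig_eq_words[OF rig_append.hyps(2)]
      ev_append[of k x y v z w] ev_append[of k x y v' z w'] rig_append.IH by metis
next
  case (rig_ident \<sigma> n i)
  then show ?case
    using ev_single[OF rig_ident(1,2,2) path_ident_at_closed[of n i k]]
      simplicial_functor_ident_at[OF g_functor[OF rig_ident(1)], of i k]
    by (simp add: path_Obj ob_vertex)
next
  case (rig_comp \<sigma> n i j l S T)
  have w: "rig_word X k (vertex X n \<sigma> i) (vertex X n \<sigma> j) [(n, \<sigma>, i, j, S)]"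
    "rig_word X k (vertex X n \<sigma> j) (vertex X n \<sigma> l) [(n, \<sigma>, j, l, T)]"
    using rig_comp vertex_closed by auto
  have "ev k (vertex X n \<sigma> i) (vertex X n \<sigma> l) ([(n, \<sigma>, i, j, S)] @ [(n, \<sigma>, j, l, T)]) =
     Comp D (fobj (g n \<sigma>) i) (fobj (g n \<sigma>) j) (fobj (g n \<sigma>) l) k
       (fhom (g n \<sigma>) j l k T) (fhom (g n \<sigma>) i j k S)"
    unfolding ev_append[OF w] using rig_comp by (simp only: ev_single ob_vertex)
  also have "\<dots> = fhom (g n \<sigma>) i l k (Comp (path_category n) i j l k T S)"
    using g_functor[OF rig_comp(1)] rig_comp by (simp add: simplicial_functor_def path_Obj)
  finally show ?case using rig_comp by (simp only: ev_single path_Comp_closed append.simps)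
next
  case (rig_act \<sigma> n m \<alpha> i j T)
  have a: "act X m n \<alpha> \<sigma> \<in> Simp X m" using act_closed rig_act by blast
  have v: "vertex X n \<sigma> (\<alpha> i) = vertex X m (act X m n \<alpha> \<sigma>) i"
    "vertex X n \<sigma> (\<alpha> j) = vertex X m (act X m n \<alpha> \<sigma>) j" using rig_act by (simp_all add: vertex_act)
  have "fhom (g m (act X m n \<alpha> \<sigma>)) i j k T = fhom (g n \<sigma>) (\<alpha> i) (\<alpha> j) k (fhom (path_functor \<alpha>) i j k T)"
    using g_natural[OF rig_act(2,1)] rig_act
    by (simp add: sfun_eq_def sfun_comp_def path_Obj path_functor_simp(1))
  moreover have "ev k (vertex X m (act X m n \<alpha> \<sigma>) i) (vertex X m (act X m n \<alpha> \<sigma>) j)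
      [(m, act X m n \<alpha> \<sigma>, i, j, T)] = fhom (g m (act X m n \<alpha> \<sigma>)) i j k T"
    by (rule ev_single) (use a rig_act in auto)
  moreover have "ev k (vertex X n \<sigma> (\<alpha> i)) (vertex X n \<sigma> (\<alpha> j))
      [(n, \<sigma>, \<alpha> i, \<alpha> j, fhom (path_functor \<alpha>) i j k T)] =
      fhom (g n \<sigma>) (\<alpha> i) (\<alpha> j) k (fhom (path_functor \<alpha>) i j k T)"
    by (rule ev_single) (use rig_act delta_mapD path_functor_closed in auto)
  ultimately show ?case by (simp only: v)
qed auto

lemma ev_gen_act:
  assumes a: "delta_map k' k \<alpha>"
  shows "rig_word X k x y w \<Longrightarrow>
    ev k' x y (map (gen_act k' k \<alpha>) w) = act (Hom D (ob x) (ob y)) k' k \<alpha> (ev k x y w)"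
proof (induction w arbitrary: x)
  case Nil
  then have x: "x = y" "ob y \<in> Obj D" by (auto simp: ob_closed)
  interpret H: simplicial_set "Hom D (ob y) (ob y)" using D.Hom_simplicial x by blast
  have "act (Hom D (ob y) (ob y)) k' 0 (\<lambda>_. 0) (Ident D (ob y)) =
      act (Hom D (ob y) (ob y)) k' k \<alpha> (act (Hom D (ob y) (ob y)) k 0 (\<lambda>_. 0) (Ident D (ob y)))"
    using H.act_comp[OF a, of 0 "\<lambda>_. 0" "Ident D (ob y)"] D.Ident_closed[OF x(2)]
    by (simp add: delta_map_def)
  then show ?case by (simp add: x ident_at_def)
next
  case (Cons e w)
  obtain n \<sigma> i j T where e: "e = (n, \<sigma>, i, j, T)" by (cases e)
  have p: "\<sigma> \<in> Simp X n" "i \<le> n" "j \<le> n" "T \<in> Simp (Hom (path_category n) i j) k"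
    "vertex X n \<sigma> i = x" "rig_word X k (vertex X n \<sigma> j) y w" using Cons.prems by (simp_all add: e)
  have o: "x \<in> Simp X 0" "vertex X n \<sigma> j \<in> Simp X 0" "y \<in> Simp X 0"
    using rig_word_ends[OF Cons.prems(1)] rig_word_ends[OF p(6)] by auto
  have gc: "fhom (g n \<sigma>) i j k T \<in> Simp (Hom D (ob x) (ob (vertex X n \<sigma> j))) k"
    using gen_closed[OF p(1-4)] p(5) by simp
  have "fhom (g n \<sigma>) i j k' (act (Hom (path_category n) i j) k' k \<alpha> T) =
     act (Hom D (ob x) (ob (vertex X n \<sigma> j))) k' k \<alpha> (fhom (g n \<sigma>) i j k T)"
    using g_functor[OF p(1)] p ob_vertex[OF p(1,2)] ob_vertex[OF p(1,3)] a
    by (simp add: simplicial_functor_def simplicial_map_def path_Obj)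
  then show ?case
    using Cons.IH[OF p(6)]
      D.Comp_act[OF ob_closed[OF o(1)] ob_closed[OF o(2)] ob_closed[OF o(3)] a gc ev_closed[OF p(6)]]
    by (simp add: e)
qed

definition adjunct :: "('a, 'a gen list set, 'p, 'q) sfun" where
  "adjunct = \<lparr>fobj = ob, fhom = (\<lambda>x y k c. ev k x y (SOME w. w \<in> c))\<rparr>"

lemma adjunct_class:
  assumes "rig_word X k x y w"
  shows "fhom adjunct x y k (rig_class X k x y w) = ev k x y w"
proof -
  have "(SOME v. v \<in> rig_class X k x y w) \<in> rig_class X k x y w"
    using rig_class_self[OF assms] by (rule someI)
  then show ?thesis by (simp add: adjunct_def rig_class_def ev_eq)
qed

lemma adjunct_functor: "simplicial_functor (rigidification X) D adjunct"
proof -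
  have ao: "fobj adjunct = ob" by (simp add: adjunct_def)
  show ?thesis
    unfolding simplicial_functor_def simplicial_map_def ao
  proof (intro conjI ballI allI impI)
    fix x y n c assume "c \<in> Simp (Hom (rigidification X) x y) n"
    then show "fhom adjunct x y n c \<in> Simp (Hom D (ob x) (ob y)) n"
      unfolding rig_simp_iff using adjunct_class ev_closed by metis
  next
    fix x y m n \<alpha> c assume "c \<in> Simp (Hom (rigidification X) x y) n" "delta_map m n \<alpha>"
    then show "fhom adjunct x y m (act (Hom (rigidification X) x y) m n \<alpha> c) =
        act (Hom D (ob x) (ob y)) m n \<alpha> (fhom adjunct x y n c)"
      unfolding rig_simp_iff
      by (auto simp: rig_act_class adjunct_class rig_word_gen_act ev_gen_act)
  next
    fix x assume x: "x \<in> Obj (rigidification X)"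
    then have o: "ob x \<in> Obj D" by (simp add: rig_Obj ob_closed)
    interpret H: simplicial_set "Hom D (ob x) (ob x)" using D.Hom_simplicial o by blast
    have "act (Hom D (ob x) (ob x)) 0 0 (\<lambda>_. 0) (Ident D (ob x)) =
        act (Hom D (ob x) (ob x)) 0 0 (\<lambda>i. i) (Ident D (ob x))"
      by (rule H.act_cong) (auto simp: delta_map_def D.Ident_closed o)
    then have "ident_at D (ob x) 0 = Ident D (ob x)"
      by (simp add: ident_at_def H.act_id D.Ident_closed o)
    then show "fhom adjunct x x 0 (Ident (rigidification X) x) = Ident D (ob x)"
      using x adjunct_class[of 0 x x "[]"] by (simp add: rigidification_def)
  next
    fix x y z n c d
    assume "c \<in> Simp (Hom (rigidification X) x y) n" "d \<in> Simp (Hom (rigidification X) y z) n"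
    then obtain v w where vw: "rig_word X n x y v" "c = rig_class X n x y v"
      "rig_word X n y z w" "d = rig_class X n y z w" unfolding rig_simp_iff by blast
    have "rig_word X n x z (v @ w)" using vw rig_word_append by blast
    then show "fhom adjunct x z n (Comp (rigidification X) x y z n d c) =
       Comp D (ob x) (ob y) (ob z) n (fhom adjunct y z n d) (fhom adjunct x y n c)"
      using vw by (simp add: rig_Comp_class adjunct_class ev_append)
  qed (simp_all add: rigidification_simplicial_category D.simplicial_category_axioms
        rig_Hom_simplicial D.Hom_simplicial rig_Obj ob_closed)
qed

lemma adjunct_unit:
  assumes s: "\<sigma> \<in> Simp X n"
  shows "sfun_restrict (path_category n) (sfun_comp adjunct (rigidification_unit X n \<sigma>)) = g n \<sigma>"
proof -
  have "sfun_eq (path_category n) (sfun_comp adjunct (rigidification_unit X n \<sigma>)) (g n \<sigma>)"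
    unfolding sfun_eq_def path_Obj
  proof (intro conjI ballI allI)
    fix i assume "i \<in> {..n}"
    then show "fobj (sfun_comp adjunct (rigidification_unit X n \<sigma>)) i = fobj (g n \<sigma>) i"
      using s by (simp add: sfun_comp_def adjunct_def rigidification_unit_simp ob_vertex)
  next
    fix i j k T
    assume a: "i \<in> {..n}" "j \<in> {..n}" "T \<in> Simp (Hom (path_category n) i j) k"
    have "rig_word X k (vertex X n \<sigma> i) (vertex X n \<sigma> j) [(n, \<sigma>, i, j, T)]"
      using a s vertex_closed by simp
    then show "fhom (sfun_comp adjunct (rigidification_unit X n \<sigma>)) i j k T = fhom (g n \<sigma>) i j k T"
      using a s ev_single[OF s _ _ a(3)] adjunct_class
      by (simp add: sfun_comp_def rigidification_unit_simp del: word_eval.simps)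
  qed
  moreover have "sfun_restrict (path_category n) (g n \<sigma>) = g n \<sigma>"
    using g s by (simp add: simplicial_map_def coherent_nerve_simp_iff)
  ultimately show ?thesis by (metis sfun_restrict_eq_iff)
qed

lemma adjunct_unique:
  assumes F: "simplicial_functor (rigidification X) D F"
    and u: "\<And>n \<sigma>. \<sigma> \<in> Simp X n \<Longrightarrow>
      sfun_restrict (path_category n) (sfun_comp F (rigidification_unit X n \<sigma>)) = g n \<sigma>"
  shows "sfun_eq (rigidification X) F adjunct"
proof -
  have e: "sfun_eq (path_category n) (g n \<sigma>) (sfun_comp F (rigidification_unit X n \<sigma>))"
    if "\<sigma> \<in> Simp X n" for n \<sigma>
    using sfun_eq_restrict u[OF that] by metis
  have o: "fobj F x = ob x" if "x \<in> Simp X 0" for x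
    using e[OF that] that
    by (simp add: sfun_eq_def sfun_comp_def path_Obj rigidification_unit_simp vertex_0)
  have "rig_word X k x y w \<Longrightarrow> fhom F x y k (rig_class X k x y w) = ev k x y w" for k x y w
  proof (induction w arbitrary: x)
    case Nil
    then have x: "x = y" "y \<in> Simp X 0" by auto
    then show ?case
      using simplicial_functor_ident_at[OF F, of y k] by (simp add: rig_ident_at rig_Obj o)
  next
    case (Cons f w)
    obtain n \<sigma> i j T where f: "f = (n, \<sigma>, i, j, T)" by (cases f)
    have p: "\<sigma> \<in> Simp X n" "i \<le> n" "j \<le> n" "T \<in> Simp (Hom (path_category n) i j) k"
      "vertex X n \<sigma> i = x" "rig_word X k (vertex X n \<sigma> j) y w" using Cons.prems by (simp_all add: f)
    have V: "x \<in> Simp X 0" "vertex X n \<sigma> j \<in> Simp X 0" "y \<in> Simp X 0"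
      using rig_word_ends[OF Cons.prems(1)] rig_word_ends[OF p(6)] by auto
    have w1: "rig_word X k x (vertex X n \<sigma> j) [f]" using p V by (simp add: f)
    have "fhom F x (vertex X n \<sigma> j) k (rig_class X k x (vertex X n \<sigma> j) [f]) = fhom (g n \<sigma>) i j k T"
      using e[OF p(1)] p(2-5) by (simp add: sfun_eq_def sfun_comp_def path_Obj rigidification_unit_simp f)
    moreover have "rig_class X k x y (f # w) = Comp (rigidification X) x (vertex X n \<sigma> j) y k
        (rig_class X k (vertex X n \<sigma> j) y w) (rig_class X k x (vertex X n \<sigma> j) [f])"
      using rig_Comp_class[OF w1 p(6)] by simp
    moreover have "rig_class X k (vertex X n \<sigma> j) y w \<in> Simp (Hom (rigidification X) (vertex X n \<sigma> j) y) k"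
      "rig_class X k x (vertex X n \<sigma> j) [f] \<in> Simp (Hom (rigidification X) x (vertex X n \<sigma> j)) k"
      unfolding rig_simp_iff using w1 p(6) by blast+
    ultimately show ?case
      using F Cons.IH[OF p(6)] V by (simp add: simplicial_functor_def rig_Obj o f)
  qed
  then have "fhom F x y k c = fhom adjunct x y k c"
    if "c \<in> Simp (Hom (rigidification X) x y) k" for x y k c
    using that adjunct_class unfolding rig_simp_iff by metis
  moreover have "fobj adjunct = ob" by (simp add: adjunct_def)
  ultimately show ?thesis unfolding sfun_eq_def rig_Obj using o by simp
qed

end

text \<open>\<^term>\<open>rigidification_unit X\<close> is the unit of the adjunction.\<close>

theorem rigidification_universal:
  assumes X: "simplicial_set X" and D: "simplicial_category D"
    and g: "simplicial_map X (coherent_nerve D) g"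
  defines "extends \<equiv> \<lambda>F. simplicial_functor (rigidification X) D F \<and> (\<forall>n. \<forall>\<sigma>\<in>Simp X n.
      sfun_restrict (path_category n) (sfun_comp F (rigidification_unit X n \<sigma>)) = g n \<sigma>)"
  shows "\<exists>F. extends F \<and> (\<forall>G. extends G \<longrightarrow> sfun_eq (rigidification X) G F)"
proof -
  interpret rigidification_adjunct X D g
    by (intro rigidification_adjunct.intro rigidification_adjunct_axioms.intro X D g)
  show ?thesis unfolding extends_def using adjunct_functor adjunct_unit adjunct_unique by blast
qed

end

theory Submission
  imports Defs "HOL-Library.Countable" "HOL-Library.Product_Plus"
begin

text \<open>
  The cofibration statement is a statement about self-adjoint morphisms. A dagger functor out of
  \<^term>\<open>E_sa\<close> is a self-adjoint endomorphism, so if \<^term>\<open>terminal_to_E_sa\<close> were a cofibration, then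
  along every trivial fibration self-adjoint endomorphisms would lift to self-adjoint ones. Nothing
  in the notion of a trivial fibration guarantees this: an endomorphism \<open>b\<close> with \<open>b\<^sup>\<dagger> = b\<close> has a
  contractible space of lifts, but the dagger acts on this space as an involution, and an involution
  of a contractible space need not fix a vertex.
  
  For a counterexample, let \<open>q\<close> be a surjective homomorphism of commutative monoids that commutes with
  involutions (on a commutative monoid a dagger is an involutive automorphism). Its Cech nerve, whose
  \<open>k\<close>-simplices are the \<open>(k + 1)\<close>-tuples contained in one fibre of \<open>q\<close>, is a simplicial monoid with
  involution, and its projection to the discrete target of \<open>q\<close> is a trivial Kan fibration because
  every fibre is the nerve of a nonempty codiscrete groupoid (\<open>proj_trivial_kan_fibration\<close>). A lift
  against it exhibits, for each fixed point \<open>b\<close> of the involution below, a fixed point above in the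
  fibre of \<open>b\<close> (\<open>self_adjoint_lift\<close>). This fails for addition \<open>\<nat> \<times> \<nat> \<rightarrow> \<nat>\<close> with the swap on the source
  and the trivial involution on the target: the fixed points \<open>(n, n)\<close> have even sums, and \<open>1\<close> is odd.
  
  It remains to identify the rigidification of the inclusion of the boundary with
  \<^term>\<open>terminal_to_E_sa\<close>. As a simplicial set \<^term>\<open>Q1\<close> is the circle: a monotone or antitone map to
  \<open>[1]\<close> is, up to the flip of \<open>[1]\<close>, a monotone one, and the two constant maps become equal. So every
  simplex is pulled back from a single edge, whence every morphism of the rigidification is a power of
  the loop \<open>\<ell>\<close> given by this edge; conversely the number of times that a word runs through the edge is
  invariant under the defining relations. Hence words are equal exactly if their winding numbers agree
  (\<open>rig_eq_iff_degree\<close>), and the winding number is the isomorphism to \<^term>\<open>E_sa\<close> (\<open>winding_iso\<close>). It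
  respects the daggers because the edge is self-conjugate.
\<close>

section \<open>Dagger functors, isomorphisms and cofibrations\<close>

lemma dagger_functor_comp:
  assumes F: "dagger_functor C D F" and G: "dagger_functor D E G"
  shows "dagger_functor C E (sfun_comp G F)"
proof -
  have "simplicial_functor C E (sfun_comp G F)"
    using F G simplicial_functor_comp unfolding dagger_functor_def by blast
  moreover have "fobj F x \<in> Obj D" if "x \<in> Obj C" for x
    using F that by (simp add: dagger_functor_def simplicial_functor_def)
  moreover have "fhom F x y n f \<in> Simp (Hom D (fobj F x) (fobj F y)) n"
    if "x \<in> Obj C" "y \<in> Obj C" "f \<in> Simp (Hom C x y) n" for x y n f
    using F that by (simp add: dagger_functor_def simplicial_functor_def simplicial_map_def)
  ultimately show ?thesis
    using F G by (simp add: dagger_functor_def sfun_comp_def)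
qed

text \<open>
  The inverse bijections automatically form a dagger functor, so isomorphisms can be recognised
  without writing down an inverse functor.
\<close>

lemma dagger_isoI:
  assumes F: "dagger_functor C D F"
    and ob: "bij_betw (fobj F) (Obj C) (Obj D)"
    and hom: "\<And>x y n. x \<in> Obj C \<Longrightarrow> y \<in> Obj C \<Longrightarrow>
      bij_betw (fhom F x y n) (Simp (Hom C x y) n) (Simp (Hom D (fobj F x) (fobj F y)) n)"
  shows "dagger_iso C D F"
proof -
  interpret C: dagger_simplicial_category C using F by (simp add: dagger_functor_def)
  interpret D: dagger_simplicial_category D using F by (simp add: dagger_functor_def)
  define h where "h = inv_into (Obj C) (fobj F)"
  define k where "k x y n = inv_into (Simp (Hom C (h x) (h y)) n) (fhom F (h x) (h y) n)" for x y n
  define G where "G = \<lparr>fobj = h, fhom = k\<rparr>"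
  have h: "h x \<in> Obj C" "fobj F (h x) = x" if "x \<in> Obj D" for x
    using ob that unfolding h_def bij_betw_def
    by (metis inv_into_into, metis f_inv_into_f)
  have hF: "h (fobj F x) = x" if "x \<in> Obj C" for x
    using ob that unfolding h_def bij_betw_def by (metis inv_into_f_f)
  have k: "k x y n f \<in> Simp (Hom C (h x) (h y)) n" "fhom F (h x) (h y) n (k x y n f) = f"
    if "x \<in> Obj D" "y \<in> Obj D" "f \<in> Simp (Hom D x y) n" for x y n f
    using hom[OF h(1)[OF that(1)] h(1)[OF that(2)], of n] that(3) h(2)[OF that(1)] h(2)[OF that(2)]
    unfolding k_def bij_betw_def by (metis inv_into_into, metis f_inv_into_f)
  have inj: "f = g" if "x \<in> Obj C" "y \<in> Obj C" "f \<in> Simp (Hom C x y) n" "g \<in> Simp (Hom C x y) n"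
    "fhom F x y n f = fhom F x y n g" for x y n f g
    using hom[OF that(1,2), of n] that(3-) unfolding bij_betw_def by (blast dest: inj_onD)
  have kF: "k (fobj F x) (fobj F y) n (fhom F x y n f) = f"
    if "x \<in> Obj C" "y \<in> Obj C" "f \<in> Simp (Hom C x y) n" for x y n f
    using hom[OF that(1,2), of n] that unfolding k_def bij_betw_def
    by (simp add: hF)
  have Fact: "fhom F x y m (act (Hom C x y) m n \<alpha> f) =
      act (Hom D (fobj F x) (fobj F y)) m n \<alpha> (fhom F x y n f)"
    if "x \<in> Obj C" "y \<in> Obj C" "f \<in> Simp (Hom C x y) n" "delta_map m n \<alpha>" for x y m n \<alpha> f
    using F that by (simp add: dagger_functor_def simplicial_functor_def simplicial_map_def)
  have FComp: "fhom F x z n (Comp C x y z n g f) =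
      Comp D (fobj F x) (fobj F y) (fobj F z) n (fhom F y z n g) (fhom F x y n f)"
    if "x \<in> Obj C" "y \<in> Obj C" "z \<in> Obj C" "f \<in> Simp (Hom C x y) n" "g \<in> Simp (Hom C y z) n"
    for x y z n f g
    using F that by (simp add: dagger_functor_def simplicial_functor_def)
  have FIdent: "fhom F x x 0 (Ident C x) = Ident D (fobj F x)" if "x \<in> Obj C" for x
    using F that by (simp add: dagger_functor_def simplicial_functor_def)
  have FDag: "fhom F y x n (Dag C x y n f) = Dag D (fobj F x) (fobj F y) n (fhom F x y n f)"
    if "x \<in> Obj C" "y \<in> Obj C" "f \<in> Simp (Hom C x y) n" for x y n f
    using F that by (simp add: dagger_functor_def)
  have CDag: "Dag C x y n f \<in> Simp (Hom C y x) n"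
    if "x \<in> Obj C" "y \<in> Obj C" "f \<in> Simp (Hom C x y) n" for x y n f
    using C.Dag_map that by (simp add: simplicial_map_def)
  have DDag: "Dag D x y n f \<in> Simp (Hom D y x) n"
    if "x \<in> Obj D" "y \<in> Obj D" "f \<in> Simp (Hom D x y) n" for x y n f
    using D.Dag_map that by (simp add: simplicial_map_def)
  have Cact: "act (Hom C x y) m n \<alpha> f \<in> Simp (Hom C x y) m"
    if "x \<in> Obj C" "y \<in> Obj C" "f \<in> Simp (Hom C x y) n" "delta_map m n \<alpha>" for x y m n \<alpha> f
    using simplicial_set.act_closed[OF C.Hom_simplicial] that by blast
  have Dact: "act (Hom D x y) m n \<alpha> f \<in> Simp (Hom D x y) m"
    if "x \<in> Obj D" "y \<in> Obj D" "f \<in> Simp (Hom D x y) n" "delta_map m n \<alpha>" for x y m n \<alpha> f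
    using simplicial_set.act_closed[OF D.Hom_simplicial] that by blast
  \<comment> \<open>Each equation for \<^term>\<open>G\<close> is checked after applying \<^term>\<open>F\<close>, which is faithful.\<close>
  have G: "dagger_functor D C G"
    unfolding dagger_functor_def simplicial_functor_def simplicial_map_def
  proof (intro conjI ballI allI impI)
    fix x y m n \<alpha> f
    assume a: "x \<in> Obj D" "y \<in> Obj D" "f \<in> Simp (Hom D x y) n" "delta_map m n \<alpha>"
    show "fhom G x y m (act (Hom D x y) m n \<alpha> f) =
        act (Hom C (fobj G x) (fobj G y)) m n \<alpha> (fhom G x y n f)"
      using a h[OF a(1)] h[OF a(2)] k[OF a(1,2,3)] k[OF a(1,2) Dact[OF a]]
      by (auto simp: G_def Fact Cact intro!: inj[of "h x" "h y"])
  next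
    fix x assume a: "x \<in> Obj D"
    show "fhom G x x 0 (Ident D x) = Ident C (fobj G x)"
      using a h[OF a] k[OF a a D.Ident_closed[OF a]]
      by (auto simp: G_def FIdent C.Ident_closed intro!: inj[of "h x" "h x"])
  next
    fix x y z n f g
    assume a: "x \<in> Obj D" "y \<in> Obj D" "z \<in> Obj D" "f \<in> Simp (Hom D x y) n" "g \<in> Simp (Hom D y z) n"
    show "fhom G x z n (Comp D x y z n g f) =
       Comp C (fobj G x) (fobj G y) (fobj G z) n (fhom G y z n g) (fhom G x y n f)"
      using a h[OF a(1)] h[OF a(2)] h[OF a(3)] k[OF a(1,2,4)] k[OF a(2,3,5)]
        k[OF a(1,3) D.Comp_closed[OF a]]
      by (auto simp: G_def FComp C.Comp_closed intro!: inj[of "h x" "h z"])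
  next
    fix x y n f
    assume a: "x \<in> Obj D" "y \<in> Obj D" "f \<in> Simp (Hom D x y) n"
    show "fhom G y x n (Dag D x y n f) = Dag C (fobj G x) (fobj G y) n (fhom G x y n f)"
      using a h[OF a(1)] h[OF a(2)] k[OF a] k[OF a(2,1) DDag[OF a]]
      by (auto simp: G_def FDag CDag intro!: inj[of "h y" "h x"])
  qed (simp_all add: C.dagger_simplicial_category_axioms D.dagger_simplicial_category_axioms
      C.simplicial_category_axioms D.simplicial_category_axioms C.Hom_simplicial D.Hom_simplicial
      G_def h k)
  moreover have "sfun_eq C (sfun_comp G F) sfun_id" "sfun_eq D (sfun_comp F G) sfun_id"
    by (simp_all add: sfun_eq_def sfun_comp_def sfun_id_def G_def h hF k kF)
  ultimately show ?thesis using F unfolding dagger_iso_def by blast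
qed

text \<open>
  A lifting property depends only on the isomorphism class of an arrow: a lifting problem for \<open>F'\<close> is
  transported to one for \<open>F\<close> by precomposition with \<open>\<Phi>\<close> and \<open>\<Psi>\<close>, and its solution is transported back by
  precomposition with the inverse of \<open>\<Psi>\<close>.
\<close>

lemma dagger_bergner_cofibration_arrow_iso:
  assumes cof: "dagger_bergner_cofibration TYPE('u) A B F"
    and iso: "dagger_arrow_iso A B F A' B' F'"
  shows "dagger_bergner_cofibration TYPE('u) A' B' F'"
proof -
  obtain \<Phi> \<Phi>' \<Psi> \<Psi>' where \<Phi>: "dagger_functor A A' \<Phi>" "dagger_functor A' A \<Phi>'"
      "sfun_eq A' (sfun_comp \<Phi> \<Phi>') sfun_id"
    and \<Psi>: "dagger_functor B B' \<Psi>" "dagger_functor B' B \<Psi>'"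
      "sfun_eq B (sfun_comp \<Psi>' \<Psi>) sfun_id" "sfun_eq B' (sfun_comp \<Psi> \<Psi>') sfun_id"
    and sq: "sfun_eq A (sfun_comp \<Psi> F) (sfun_comp F' \<Phi>)"
    and F: "dagger_functor A B F" and F': "dagger_functor A' B' F'"
    using iso unfolding dagger_arrow_iso_def dagger_iso_def by blast
  note fs = \<Phi>(1,2) \<Psi>(1,2) F F'
  have S: "simplicial_functor C D H" if "dagger_functor C D H" for C D H
    using that by (simp add: dagger_functor_def)
  have idl: "sfun_comp sfun_id H = H" and idr: "sfun_comp H sfun_id = H" for H
    by (simp_all add: sfun_comp_def sfun_id_def)
  \<comment> \<open>The square read backwards: the inverses also form an isomorphism of arrows.\<close>
  have sq': "sfun_eq A' (sfun_comp \<Psi>' F') (sfun_comp F \<Phi>')"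
  proof -
    have "sfun_eq A' (sfun_comp \<Psi>' F') (sfun_comp (sfun_comp \<Psi>' F') (sfun_comp \<Phi> \<Phi>'))"
      using sfun_eq_comp[OF S[OF dagger_functor_comp[OF \<Phi>(2,1)]] \<Phi>(3) sfun_eq_refl, of "sfun_comp \<Psi>' F'"]
      unfolding idr by (rule sfun_eq_sym)
    also have "sfun_comp (sfun_comp \<Psi>' F') (sfun_comp \<Phi> \<Phi>') = sfun_comp \<Psi>' (sfun_comp (sfun_comp F' \<Phi>) \<Phi>')"
      by (simp add: sfun_comp_assoc)
    finally have 1: "sfun_eq A' (sfun_comp \<Psi>' F') \<dots>" .
    have "sfun_eq A' (sfun_comp (sfun_comp F' \<Phi>) \<Phi>') (sfun_comp (sfun_comp \<Psi> F) \<Phi>')"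
      by (rule sfun_eq_comp[OF S[OF \<Phi>(2)] sfun_eq_refl sfun_eq_sym[OF sq]])
    from sfun_eq_comp[OF S this sfun_eq_refl, of B' \<Psi>']
    have 2: "sfun_eq A' (sfun_comp \<Psi>' (sfun_comp (sfun_comp F' \<Phi>) \<Phi>'))
        (sfun_comp (sfun_comp \<Psi>' \<Psi>) (sfun_comp F \<Phi>'))"
      using fs by (simp add: sfun_comp_assoc dagger_functor_comp)
    have 3: "sfun_eq A' (sfun_comp (sfun_comp \<Psi>' \<Psi>) (sfun_comp F \<Phi>')) (sfun_comp F \<Phi>')"
      using sfun_eq_comp[OF S[OF dagger_functor_comp[OF \<Phi>(2) F]] sfun_eq_refl \<Psi>(3)]
      unfolding idl .
    show ?thesis using 1 2 3 sfun_eq_trans by blast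
  qed
  show ?thesis
    unfolding dagger_bergner_cofibration_def
  proof (intro conjI allI impI F', elim conjE)
    fix P Q :: "('u, 'u) dscat" and p u v
    assume p: "dagger_trivial_fibration P Q p" and u: "dagger_functor A' P u"
      and v: "dagger_functor B' Q v" and e: "sfun_eq A' (sfun_comp p u) (sfun_comp v F')"
    have "sfun_eq A (sfun_comp (sfun_comp p u) \<Phi>) (sfun_comp (sfun_comp v F') \<Phi>)"
      by (rule sfun_eq_comp[OF S[OF \<Phi>(1)] sfun_eq_refl e])
    moreover have "sfun_eq A (sfun_comp v (sfun_comp F' \<Phi>)) (sfun_comp v (sfun_comp \<Psi> F))"
      by (rule sfun_eq_comp[OF S[OF dagger_functor_comp[OF \<Phi>(1) F']] sfun_eq_sym[OF sq] sfun_eq_refl])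
    ultimately have "sfun_eq A (sfun_comp p (sfun_comp u \<Phi>)) (sfun_comp (sfun_comp v \<Psi>) F)"
      unfolding sfun_comp_assoc by (rule sfun_eq_trans)
    then obtain w where w: "dagger_functor B P w" "sfun_eq A (sfun_comp w F) (sfun_comp u \<Phi>)"
      "sfun_eq B (sfun_comp p w) (sfun_comp v \<Psi>)"
      using cof p dagger_functor_comp[OF \<Phi>(1) u] dagger_functor_comp[OF \<Psi>(1) v]
      unfolding dagger_bergner_cofibration_def by blast
    show "\<exists>w. dagger_functor B' P w \<and> sfun_eq A' (sfun_comp w F') u \<and> sfun_eq B' (sfun_comp p w) v"
    proof (intro exI conjI)
      show "dagger_functor B' P (sfun_comp w \<Psi>')" by (rule dagger_functor_comp[OF \<Psi>(2) w(1)])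
      have "sfun_eq A' (sfun_comp w (sfun_comp \<Psi>' F')) (sfun_comp w (sfun_comp F \<Phi>'))"
        by (rule sfun_eq_comp[OF S[OF dagger_functor_comp[OF F' \<Psi>(2)]] sq' sfun_eq_refl])
      moreover have "sfun_eq A' (sfun_comp (sfun_comp w F) \<Phi>') (sfun_comp (sfun_comp u \<Phi>) \<Phi>')"
        by (rule sfun_eq_comp[OF S[OF \<Phi>(2)] sfun_eq_refl w(2)])
      moreover have "sfun_eq A' (sfun_comp u (sfun_comp \<Phi> \<Phi>')) u"
        using sfun_eq_comp[OF S[OF dagger_functor_comp[OF \<Phi>(2,1)]] \<Phi>(3) sfun_eq_refl, of u]
        unfolding idr .
      ultimately show "sfun_eq A' (sfun_comp (sfun_comp w \<Psi>') F') u"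
        unfolding sfun_comp_assoc by (blast intro: sfun_eq_trans)
      have "sfun_eq B' (sfun_comp (sfun_comp p w) \<Psi>') (sfun_comp (sfun_comp v \<Psi>) \<Psi>')"
        by (rule sfun_eq_comp[OF S[OF \<Psi>(2)] sfun_eq_refl w(3)])
      moreover have "sfun_eq B' (sfun_comp v (sfun_comp \<Psi> \<Psi>')) v"
        using sfun_eq_comp[OF S[OF dagger_functor_comp[OF \<Psi>(2,1)]] \<Psi>(4) sfun_eq_refl, of v]
        unfolding idr .
      ultimately show "sfun_eq B' (sfun_comp p (sfun_comp w \<Psi>')) v"
        unfolding sfun_comp_assoc by (rule sfun_eq_trans)
    qed
  qed
qed

lemma terminal_dscat_category: "dagger_simplicial_category terminal_dscat"
  by unfold_locales (auto simp: terminal_dscat_def simplicial_map_def intro: simplicial_set.intro)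

lemma E_sa_category: "dagger_simplicial_category E_sa"
  by unfold_locales (auto simp: E_sa_def simplicial_map_def ident_at_def intro: simplicial_set.intro)

lemma to_terminal_functor:
  assumes "dagger_simplicial_category C"
  shows "dagger_functor C terminal_dscat \<lparr>fobj = \<lambda>_. (), fhom = \<lambda>_ _ _ _. ()\<rparr>"
proof -
  interpret dagger_simplicial_category C by fact
  interpret T: dagger_simplicial_category terminal_dscat by (rule terminal_dscat_category)
  have t: "() \<in> Obj terminal_dscat" "() \<in> Simp (Hom terminal_dscat () ()) n" for n
    by (simp_all add: terminal_dscat_def)
  then show ?thesis
    by (simp add: dagger_functor_def simplicial_functor_def simplicial_map_def Hom_simplicial
      T.Hom_simplicial dagger_simplicial_category_axioms simplicial_category_axioms
      T.dagger_simplicial_category_axioms T.simplicial_category_axioms)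
qed

section \<open>The self-conjugate 1-simplex\<close>

lemma orbit_restrict:
  "orbit m (restrict \<sigma> {..m}) = {restrict \<sigma> {..m}, restrict (\<lambda>i. 1 - \<sigma> i) {..m}}"
  by (auto simp: orbit_def restrict_eq_iff)

text \<open>
  Flipping \<open>[1]\<close> exchanges monotone and antitone maps, so every orbit contains a monotone map.
\<close>

lemma Q1_simp_iff: "c \<in> Simp Q1 n \<longleftrightarrow> (\<exists>\<sigma>. delta_map n 1 \<sigma> \<and> c = orbit n (restrict \<sigma> {..n}))"
proof
  assume "c \<in> Simp Q1 n"
  then obtain \<sigma> where \<sigma>: "\<sigma> \<in> extensional {..n}" "delta_map n 1 \<sigma> \<or> delta_antimap n 1 \<sigma>" "c = orbit n \<sigma>"
    by (auto simp: Q1_def dagger_simplex_def)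
  then have r: "restrict \<sigma> {..n} = \<sigma>" by (simp add: extensional_restrict)
  show "\<exists>\<sigma>. delta_map n 1 \<sigma> \<and> c = orbit n (restrict \<sigma> {..n})"
  proof (cases "delta_map n 1 \<sigma>")
    case True
    then show ?thesis using \<sigma>(3) r by auto
  next
    case False
    then have a: "delta_antimap n 1 \<sigma>" using \<sigma>(2) by blast
    then have "delta_map n 1 (\<lambda>i. 1 - \<sigma> i)"
      by (auto simp: delta_map_def delta_antimap_def intro: diff_le_mono2)
    moreover have "restrict (\<lambda>i. 1 - (1 - \<sigma> i)) {..n} = \<sigma>"
      using a by (subst r[symmetric]) (auto simp: restrict_eq_iff delta_antimap_def)
    then have "c = orbit n (restrict (\<lambda>i. 1 - \<sigma> i) {..n})"
      using \<sigma>(3) r orbit_restrict[of n \<sigma>] orbit_restrict[of n "\<lambda>i. 1 - \<sigma> i"] by (simp add: insert_commute)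
    ultimately show ?thesis by blast
  qed
next
  assume "\<exists>\<sigma>. delta_map n 1 \<sigma> \<and> c = orbit n (restrict \<sigma> {..n})"
  then obtain \<sigma> where s: "delta_map n 1 \<sigma>" "c = orbit n (restrict \<sigma> {..n})" by blast
  have "delta_map n 1 (restrict \<sigma> {..n})"
    using s(1) by (auto simp: delta_map_def)
  then show "c \<in> Simp Q1 n" using s(2) by (auto simp: Q1_def dagger_simplex_def)
qed

lemma Q1_act:
  assumes "delta_map m n \<alpha>"
  shows "act Q1 m n \<alpha> (orbit n (restrict \<sigma> {..n})) = orbit m (restrict (\<lambda>i. \<sigma> (\<alpha> i)) {..m})"
  using assms by (auto simp: orbit_restrict Q1_def dagger_simplex_def restrict_eq_iff delta_map_def)

lemma Q1_dag: "dag Q1 n (orbit n (restrict \<sigma> {..n})) = orbit n (restrict (\<lambda>i. \<sigma> (n - i)) {..n})"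
  by (auto simp: orbit_restrict Q1_def dagger_simplex_def restrict_eq_iff)

text \<open>
  Both maps of an orbit represent it. This is used to restore monotonicity after the dagger, which
  turns monotone representatives into antitone ones.
\<close>

lemma orbit_flip:
  assumes "\<And>i. i \<le> n \<Longrightarrow> \<sigma> i \<le> 1"
  shows "orbit n (restrict (\<lambda>i. 1 - \<sigma> i) {..n}) = orbit n (restrict \<sigma> {..n})"
proof -
  have "restrict (\<lambda>i. 1 - (1 - \<sigma> i)) {..n} = restrict \<sigma> {..n}"
    using assms by (simp add: restrict_eq_iff)
  then show ?thesis by (simp add: orbit_restrict insert_commute)
qed

lemma Q1_dag_monotone:
  assumes "delta_map n 1 \<sigma>"
  shows "dag Q1 n (orbit n (restrict \<sigma> {..n})) = orbit n (restrict (\<lambda>i. 1 - \<sigma> (n - i)) {..n})"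
  unfolding Q1_dag using assms by (subst orbit_flip) (auto simp: delta_map_def)

lemma Q1_dag_closed:
  assumes "c \<in> Simp Q1 n" shows "dag Q1 n c \<in> Simp Q1 n"
proof -
  obtain \<sigma> where s: "delta_map n 1 \<sigma>" "c = orbit n (restrict \<sigma> {..n})" using assms Q1_simp_iff by blast
  then show ?thesis unfolding Q1_simp_iff using delta_map_rev Q1_dag_monotone by blast
qed

lemma Q1_act_closed: "c \<in> Simp Q1 n \<Longrightarrow> delta_map m n \<alpha> \<Longrightarrow> act Q1 m n \<alpha> c \<in> Simp Q1 m"
  unfolding Q1_simp_iff using Q1_act delta_map_comp by blast

lemma delta_map_cong: "delta_map m n \<alpha> \<Longrightarrow> (\<And>i. i \<le> m \<Longrightarrow> \<alpha> i = \<beta> i) \<Longrightarrow> delta_map m n \<beta>"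
  by (simp add: delta_map_def)

lemma Q1_simplicial_set: "simplicial_set Q1"
proof
  fix m n \<alpha> \<beta> c assume a: "delta_map m n \<alpha>" "\<And>i. i \<le> m \<Longrightarrow> \<alpha> i = \<beta> i" and "c \<in> Simp Q1 n"
  then obtain \<sigma> where c: "c = orbit n (restrict \<sigma> {..n})" using Q1_simp_iff by blast
  have "restrict (\<lambda>i. \<sigma> (\<alpha> i)) {..m} = restrict (\<lambda>i. \<sigma> (\<beta> i)) {..m}"
    using a(2) by (simp add: restrict_eq_iff)
  then show "act Q1 m n \<alpha> c = act Q1 m n \<beta> c"
    unfolding c using Q1_act[OF a(1)] Q1_act[OF delta_map_cong[OF a]] by simp
next
  fix c n assume "c \<in> Simp Q1 n"
  then show "act Q1 n n (\<lambda>i. i) c = c"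
    using Q1_act[of n n "\<lambda>i. i"] by (auto simp: Q1_simp_iff delta_map_def)
next
  fix k m \<beta> n \<alpha> c assume "delta_map k m \<beta>" "delta_map m n \<alpha>" "c \<in> Simp Q1 n"
  then show "act Q1 k n (\<lambda>i. \<alpha> (\<beta> i)) c = act Q1 k m \<beta> (act Q1 m n \<alpha> c)"
    by (auto simp: Q1_simp_iff Q1_act delta_map_comp)
qed (rule Q1_act_closed)

lemma Q1_dagger: "dagger_simplicial_set Q1"
proof (intro dagger_simplicial_set.intro dagger_simplicial_set_axioms.intro)
  show "simplicial_map Q1 (op_sset Q1) (dag Q1)"
    unfolding simplicial_map_def
  proof (intro conjI ballI allI impI)
    fix m n \<alpha> c assume c: "c \<in> Simp Q1 n" and a: "delta_map m n \<alpha>"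
    obtain \<sigma> where s: "c = orbit n (restrict \<sigma> {..n})" using c Q1_simp_iff by blast
    have "restrict (\<lambda>i. \<sigma> (\<alpha> (m - i))) {..m} = restrict (\<lambda>i. \<sigma> (n - (n - \<alpha> (m - i)))) {..m}"
      using a by (simp add: restrict_eq_iff delta_map_def)
    then show "dag Q1 m (act Q1 m n \<alpha> c) = act (op_sset Q1) m n \<alpha> (dag Q1 n c)"
      by (simp add: s op_act Q1_act a Q1_dag delta_map_rev)
  qed (simp_all add: Q1_simplicial_set simplicial_set_op op_Simp Q1_dag_closed)
next
  fix c n assume "c \<in> Simp Q1 n"
  then obtain \<sigma> where s: "c = orbit n (restrict \<sigma> {..n})" using Q1_simp_iff by blast
  have "restrict (\<lambda>i. \<sigma> (n - (n - i))) {..n} = restrict \<sigma> {..n}" by (simp add: restrict_eq_iff)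
  then show "dag Q1 n (dag Q1 n c) = c" by (simp add: s Q1_dag)
next
  fix c assume "c \<in> Simp Q1 0"
  then obtain \<sigma> where s: "c = orbit 0 (restrict \<sigma> {..0})" using Q1_simp_iff by blast
  have "restrict (\<lambda>i. \<sigma> (0 - i)) {..0} = restrict \<sigma> {..0}" by (simp add: restrict_eq_iff)
  then show "dag Q1 0 c = c" by (simp only: s Q1_dag)
qed (rule Q1_simplicial_set)

text \<open>
  The degenerate simplices over the only vertex: the constant maps to \<open>0\<close> and to \<open>1\<close> form one orbit.
\<close>

definition Q1_vertex :: "nat \<Rightarrow> (nat \<Rightarrow> nat) set" where
  "Q1_vertex n = orbit n (restrict (\<lambda>_. 0) {..n})"

lemma Q1_vertex_const:
  assumes "a \<le> 1" "\<And>i. i \<le> n \<Longrightarrow> \<sigma> i = a"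
  shows "orbit n (restrict \<sigma> {..n}) = Q1_vertex n"
proof -
  have r: "restrict \<sigma> {..n} = restrict (\<lambda>_. a) {..n}" using assms(2) by (simp add: restrict_eq_iff)
  have "a = 0 \<or> a = 1" using assms(1) by auto
  then show ?thesis using orbit_flip[of n "\<lambda>_. 0"] by (auto simp: r Q1_vertex_def)
qed

lemma Q1_vertex_simp: "Q1_vertex n \<in> Simp Q1 n"
  unfolding Q1_vertex_def Q1_simp_iff by (auto simp: delta_map_def)

lemma Q1_Simp_0: "Simp Q1 0 = {Q1_vertex 0}"
proof -
  have "c = Q1_vertex 0" if c: "c \<in> Simp Q1 0" for c
  proof -
    obtain \<sigma> where s: "delta_map 0 1 \<sigma>" "c = orbit 0 (restrict \<sigma> {..0})" using c Q1_simp_iff by blast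
    have "\<sigma> 0 \<le> 1" using delta_mapD(1)[OF s(1)] by blast
    moreover have "\<sigma> i = \<sigma> 0" if "i \<le> 0" for i using that by simp
    ultimately show ?thesis unfolding s(2) by (rule Q1_vertex_const)
  qed
  then show ?thesis using Q1_vertex_simp[of 0] by blast
qed

lemma Q1_vertex_act: "delta_map m n \<alpha> \<Longrightarrow> act Q1 m n \<alpha> (Q1_vertex n) = Q1_vertex m"
  by (simp add: Q1_vertex_def Q1_act)

lemma Q1_vertex_dag: "dag Q1 n (Q1_vertex n) = Q1_vertex n"
  by (simp add: Q1_vertex_def Q1_dag)

text \<open>
  A map to \<open>[1]\<close> that is not surjective is constant, so the boundary is a point.
\<close>

lemma boundary_Q1_Simp: "Simp boundary_Q1 n = {Q1_vertex n}"
proof -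
  have "orbit n \<sigma> = Q1_vertex n"
    if s: "\<sigma> \<in> Simp (dagger_simplex 1) n" "\<sigma> ` {..n} \<noteq> {..1}" for \<sigma>
  proof -
    have e: "restrict \<sigma> {..n} = \<sigma>" using s(1) by (simp add: dagger_simplex_def extensional_restrict)
    have le: "\<sigma> i \<le> 1" if "i \<le> n" for i
      using s(1) that
      by (auto simp: dagger_simplex_def delta_map_def delta_antimap_def)
    then have "\<sigma> ` {..n} \<subseteq> {..1}" by auto
    then obtain b where b: "b \<le> 1" "b \<notin> \<sigma> ` {..n}" using s(2) by auto
    have "\<sigma> i = 1 - b" if "i \<le> n" for i
    proof -
      have "\<sigma> i \<noteq> b" using b(2) that by auto
      then show ?thesis using le[OF that] b(1) by linarith
    qed
    then show ?thesis using Q1_vertex_const[of "1 - b" n \<sigma>] e by simp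
  qed
  moreover have "\<exists>\<sigma>. \<sigma> \<in> Simp (dagger_simplex 1) n \<and> \<sigma> ` {..n} \<noteq> {..1} \<and> Q1_vertex n = orbit n \<sigma>"
  proof (intro exI conjI)
    show "restrict (\<lambda>_. 0) {..n} \<in> Simp (dagger_simplex 1) n"
      by (simp add: dagger_simplex_def delta_map_def)
    have "(1::nat) \<notin> restrict (\<lambda>_. 0) {..n} ` {..n}" by auto
    then show "restrict (\<lambda>_. 0::nat) {..n} ` {..n} \<noteq> {..1}" by (metis atMost_iff order_refl)
  qed (rule Q1_vertex_def)
  ultimately show ?thesis by (auto simp: boundary_Q1_def)
qed

lemma boundary_Q1_act: "act boundary_Q1 = act Q1" and boundary_Q1_dag: "dag boundary_Q1 = dag Q1"
  by (simp_all add: boundary_Q1_def)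

lemma boundary_Q1_dagger: "dagger_simplicial_set boundary_Q1"
proof -
  interpret Q: dagger_simplicial_set Q1 by (rule Q1_dagger)
  interpret B: simplicial_set boundary_Q1
  proof
    fix m n \<alpha> \<beta> c assume "delta_map m n \<alpha>" "\<And>i. i \<le> m \<Longrightarrow> \<alpha> i = \<beta> i" "c \<in> Simp boundary_Q1 n"
    then show "act boundary_Q1 m n \<alpha> c = act boundary_Q1 m n \<beta> c"
      using Q.act_cong[of m n \<alpha> \<beta> c] by (simp add: boundary_Q1_act boundary_Q1_Simp Q1_vertex_simp)
  qed (simp_all add: boundary_Q1_act boundary_Q1_Simp Q1_vertex_act Q1_vertex_simp Q.act_id Q.act_comp)
  show ?thesis
    by unfold_locales (simp_all add: simplicial_map_def B.simplicial_set_axioms simplicial_set_op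
        op_Simp op_act boundary_Q1_Simp boundary_Q1_act boundary_Q1_dag Q1_vertex_act
        Q1_vertex_dag delta_map_rev)
qed

lemma boundary_Q1_incl_mono: "dagger_mono boundary_Q1 Q1 boundary_Q1_incl"
  using boundary_Q1_dagger Q1_dagger
  by (simp add: dagger_mono_def dagger_map_def simplicial_map_def boundary_Q1_incl_def
      boundary_Q1_Simp Q1_vertex_simp boundary_Q1_act boundary_Q1_dag dagger_simplicial_set_def)

section \<open>The winding number\<close>

text \<open>
  The number of times, \<open>0\<close> or \<open>1\<close>, that a generator runs through the edge of the circle: its simplex
  is a path from \<open>\<sigma> i\<close> to \<open>\<sigma> j\<close> in \<open>[1]\<close>. Only the ends count because
  the mapping space of \<open>\<CC>[\<Delta>\<^sup>1]\<close> from \<open>0\<close> to \<open>1\<close> is a point. The two elements \<open>\<sigma>\<close> of an orbit give the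
  same answer.
\<close>

fun gen_degree :: "(nat \<Rightarrow> nat) set gen \<Rightarrow> nat" where
  "gen_degree (n, c, i, j, T) = (if \<exists>\<sigma>\<in>c. \<sigma> i \<noteq> \<sigma> j then 1 else 0)"

definition degree :: "(nat \<Rightarrow> nat) set gen list \<Rightarrow> nat" where
  "degree w = sum_list (map gen_degree w)"

lemma gen_degree_orbit:
  assumes "delta_map n 1 \<sigma>" "i \<le> n" "j \<le> n"
  shows "gen_degree (n, orbit n (restrict \<sigma> {..n}), i, j, T) = (if \<sigma> i = \<sigma> j then 0 else 1)"
proof -
  have "\<sigma> i \<le> 1" "\<sigma> j \<le> 1" using assms by (auto simp: delta_map_def)
  then show ?thesis using assms(2,3) by (auto simp: orbit_restrict)
qed

lemma path_simp_le: "T \<in> Simp (Hom (path_category n) i j) k \<Longrightarrow> i \<le> j"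
  unfolding path_simp_iff by (metis atLeastAtMost_iff le0 subsetD)

lemma degree_simps: "degree [] = 0" "degree (e # w) = gen_degree e + degree w"
  "degree (v @ w) = degree v + degree w"
  by (simp_all add: degree_def)

lemma degree_rev: "degree (rev w) = degree w"
  by (induction w) (simp_all add: degree_simps)

text \<open>
  For the relation that composes generators one needs \<open>i \<le> j \<le> l\<close>, which holds as otherwise there is no
  chain of subsets; then the jump of a monotone map to \<open>[1]\<close> between \<open>i\<close> and \<open>l\<close>, if there is one,
  occurs in exactly one of the two steps.
\<close>

lemma degree_rig_eq: "rig_eq Q1 k x y v w \<Longrightarrow> degree v = degree w"
proof (induction rule: rig_eq.induct)
  case (rig_comp c n i j l S T)
  obtain \<sigma> where s: "delta_map n 1 \<sigma>" "c = orbit n (restrict \<sigma> {..n})"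
    using rig_comp(1) Q1_simp_iff by blast
  have "i \<le> j" "j \<le> l" using rig_comp path_simp_le by blast+
  then have "\<sigma> i \<le> \<sigma> j" "\<sigma> j \<le> \<sigma> l" "\<sigma> l \<le> 1" using s(1) rig_comp by (auto simp: delta_map_def)
  then show ?case
    using rig_comp s by (simp add: degree_simps gen_degree_orbit del: gen_degree.simps)
next
  case (rig_act c n m \<alpha> i j T)
  obtain \<sigma> where s: "delta_map n 1 \<sigma>" "c = orbit n (restrict \<sigma> {..n})"
    using rig_act(1) Q1_simp_iff by blast
  then show ?case
    using rig_act delta_map_comp[OF rig_act(2) s(1)] delta_mapD(1)[OF rig_act(2)]
    by (simp add: degree_simps gen_degree_orbit Q1_act del: gen_degree.simps)
qed (simp_all add: degree_simps)

text \<open>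
  The image of the identity of \<open>[1]\<close>, the universal simplex of \<^term>\<open>Q1\<close>.
\<close>

definition Q1_edge :: "(nat \<Rightarrow> nat) set" where
  "Q1_edge = orbit 1 (restrict (\<lambda>i. i) {..1})"

lemma Q1_edge_simp: "Q1_edge \<in> Simp Q1 1"
proof -
  have "delta_map 1 1 (\<lambda>i. i)" by (simp add: delta_map_def)
  then show ?thesis unfolding Q1_edge_def Q1_simp_iff by blast
qed

lemma Q1_vertex_unique: "c \<in> Simp Q1 n \<Longrightarrow> i \<le> n \<Longrightarrow> vertex Q1 n c i = Q1_vertex 0"
  using simplicial_set.vertex_closed[OF Q1_simplicial_set] Q1_Simp_0 by blast

definition loop :: "nat \<Rightarrow> (nat \<Rightarrow> nat) set gen" where
  "loop k = (1, Q1_edge, 0, 1, restrict (\<lambda>_. {0, 1}) {..k})"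

lemma rig_gen_loop: "rig_gen Q1 k (loop k)"
  using Q1_edge_simp by (simp add: loop_def path_simp_iff)

lemma gen_degree_loop: "gen_degree (loop k) = 1"
proof -
  have "delta_map 1 1 (\<lambda>i. i)" by (simp add: delta_map_def)
  then show ?thesis unfolding loop_def Q1_edge_def by (subst gen_degree_orbit) simp_all
qed

lemma rig_word_loops: "rig_word Q1 k (Q1_vertex 0) (Q1_vertex 0) (replicate d (loop k))"
proof (induction d)
  case (Suc d)
  have "gen_src Q1 (loop k) = Q1_vertex 0" "gen_tgt Q1 (loop k) = Q1_vertex 0"
    using Q1_vertex_unique[OF Q1_edge_simp] by (simp_all add: loop_def)
  then show ?case using Suc by (simp add: rig_gen_loop)
qed (simp add: Q1_vertex_simp)

lemma degree_loops: "degree (replicate d (loop k)) = d"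
  by (induction d) (simp_all add: degree_simps gen_degree_loop)

text \<open>
  A monotone representative \<open>\<sigma>\<close> of a simplex exhibits it as the pullback of the edge along \<open>\<sigma>\<close>, so the
  relation for simplicial operators moves the generator to the edge. There it is either constant, hence
  an identity, or it goes from \<open>0\<close> to \<open>1\<close>, hence is the loop.
\<close>

lemma rig_eq_loop:
  assumes e: "rig_gen Q1 k e"
  shows "rig_eq Q1 k (Q1_vertex 0) (Q1_vertex 0) [e] (replicate (gen_degree e) (loop k))"
proof -
  obtain n c i j T where e': "e = (n, c, i, j, T)" by (cases e)
  then have c: "c \<in> Simp Q1 n" and ij: "i \<le> n" "j \<le> n"
    and T: "T \<in> Simp (Hom (path_category n) i j) k" using e by simp_all
  obtain \<sigma> where s: "delta_map n 1 \<sigma>" "c = orbit n (restrict \<sigma> {..n})"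
    using c Q1_simp_iff by blast
  define S where "S = fhom (path_functor \<sigma>) i j k T"
  have c': "act Q1 n 1 \<sigma> Q1_edge = c" using s by (simp add: Q1_edge_def Q1_act)
  have v: "vertex Q1 1 Q1_edge (\<sigma> i) = Q1_vertex 0" "vertex Q1 1 Q1_edge (\<sigma> j) = Q1_vertex 0"
    using Q1_vertex_unique[OF Q1_edge_simp] delta_mapD(1)[OF s(1)] ij by blast+
  have step: "rig_eq Q1 k (Q1_vertex 0) (Q1_vertex 0) [e] [(1, Q1_edge, \<sigma> i, \<sigma> j, S)]"
    using rig_act[OF Q1_edge_simp s(1) ij T] by (simp only: c' v e' S_def)
  have S: "S \<in> Simp (Hom (path_category 1) (\<sigma> i) (\<sigma> j)) k"
    unfolding S_def by (rule path_functor_closed[OF s(1) ij T])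
  have le: "\<sigma> i \<le> \<sigma> j" "\<sigma> j \<le> 1" using path_simp_le[OF S] s(1) ij by (auto simp: delta_map_def)
  show ?thesis
  proof (cases "\<sigma> i = \<sigma> j")
    case True
    have "S = ident_at (path_category 1) (\<sigma> i) k"
    proof (rule extensionalityI[of _ "{..k}"])
      fix l assume l: "l \<in> {..k}"
      have "S l \<subseteq> {\<sigma> i..\<sigma> i}" "\<sigma> i \<in> S l" using S l True unfolding path_simp_iff by auto
      then show "S l = ident_at (path_category 1) (\<sigma> i) k l" using l by (auto simp: path_ident_at)
    qed (use S in \<open>simp_all add: path_simp_iff path_ident_at\<close>)
    then have "rig_eq Q1 k (Q1_vertex 0) (Q1_vertex 0) [(1, Q1_edge, \<sigma> i, \<sigma> j, S)] []"
      using rig_ident[OF Q1_edge_simp delta_mapD(1)[OF s(1) ij(1)], of k]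
      by (simp only: v True[symmetric])
    then show ?thesis
      using rig_trans[OF step] gen_degree_orbit[OF s(1) ij] True s(2) e' by simp
  next
    case False
    then have ends: "\<sigma> i = 0" "\<sigma> j = 1" using le by auto
    have "S = restrict (\<lambda>_. {0, 1}) {..k}"
    proof (rule extensionalityI[of _ "{..k}"])
      fix l assume l: "l \<in> {..k}"
      have "S l \<subseteq> {0..1}" "0 \<in> S l" "1 \<in> S l" using S l ends unfolding path_simp_iff by auto
      moreover have "{0..1} = {0, 1::nat}" by auto
      ultimately show "S l = restrict (\<lambda>_. {0, 1}) {..k} l" using l by auto
    qed (use S in \<open>simp_all add: path_simp_iff\<close>)
    then have "(1, Q1_edge, \<sigma> i, \<sigma> j, S) = loop k" by (simp add: loop_def ends)
    then show ?thesis
      using step gen_degree_orbit[OF s(1) ij] False s(2) e' by simp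
  qed
qed

lemma rig_eq_loops:
  assumes "rig_word Q1 k x y w"
  shows "rig_eq Q1 k (Q1_vertex 0) (Q1_vertex 0) w (replicate (degree w) (loop k))"
  using assms
proof (induction w arbitrary: x)
  case Nil
  then show ?case by (simp add: degree_simps rig_refl Q1_vertex_simp)
next
  case (Cons e w)
  then have "rig_eq Q1 k (Q1_vertex 0) (Q1_vertex 0) ([e] @ w)
     (replicate (gen_degree e) (loop k) @ replicate (degree w) (loop k))"
    by (intro rig_append[OF rig_eq_loop]) auto
  then show ?case by (simp add: degree_simps replicate_add)
qed

lemma rig_eq_iff_degree:
  assumes "rig_word Q1 k x y v" "rig_word Q1 k x y w"
  shows "rig_eq Q1 k x y v w \<longleftrightarrow> degree v = degree w"
proof
  assume d: "degree v = degree w"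
  have "x = Q1_vertex 0" "y = Q1_vertex 0"
    using simplicial_set.rig_word_ends[OF Q1_simplicial_set assms(1)] Q1_Simp_0 by auto
  then show "rig_eq Q1 k x y v w"
    using rig_eq_loops[OF assms(1)] rig_eq_loops[OF assms(2)] d by (metis rig_sym rig_trans)
qed (rule degree_rig_eq)

section \<open>Rigidifying the inclusion of the boundary\<close>

text \<open>
  By \<open>degree_rig_eq\<close> all words in a class \<open>c\<close> have the same degree.
\<close>

definition winding :: "((nat \<Rightarrow> nat) set, (nat \<Rightarrow> nat) set gen list set, unit, nat) sfun" where
  "winding = \<lparr>fobj = (\<lambda>_. ()), fhom = (\<lambda>_ _ _ c. degree (SOME w. w \<in> c))\<rparr>"

lemma winding_class:
  assumes "rig_word Q1 k x y w"
  shows "fhom winding x y k (rig_class Q1 k x y w) = degree w"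
proof -
  have "w \<in> rig_class Q1 k x y w" using assms by (simp add: rig_class_def rig_refl)
  then have "(SOME v. v \<in> rig_class Q1 k x y w) \<in> rig_class Q1 k x y w" by (rule someI)
  then show ?thesis by (simp add: winding_def rig_class_def degree_rig_eq)
qed

lemma degree_gen_act: "degree (map (gen_act m n \<alpha>) w) = degree w"
proof (induction w)
  case (Cons e w)
  then show ?case by (cases e) (simp add: degree_simps)
qed simp

text \<open>
  The dagger reverses the direction of a path and reflects the ends of the interval, and these two
  effects cancel: a word and its dagger wind around the circle equally often in the same direction.
\<close>

lemma degree_dagger:
  assumes "rig_word Q1 k x y w"
  shows "degree (rev (map (gen_rev k) (map (gen_map (dag Q1)) w))) = degree w"
proof -
  have "gen_degree (gen_rev k (gen_map (dag Q1) e)) = gen_degree e" if e: "rig_gen Q1 k e" for e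
  proof -
    obtain n c i j T where e': "e = (n, c, i, j, T)" by (cases e)
    then have c: "c \<in> Simp Q1 n" and ij: "i \<le> n" "j \<le> n" using e by simp_all
    obtain \<sigma> where s: "delta_map n 1 \<sigma>" "c = orbit n (restrict \<sigma> {..n})"
      using c Q1_simp_iff by blast
    have "\<sigma> i \<le> 1" "\<sigma> j \<le> 1" using delta_mapD(1)[OF s(1)] ij by blast+
    then have "1 - \<sigma> (n - (n - j)) = 1 - \<sigma> (n - (n - i)) \<longleftrightarrow> \<sigma> i = \<sigma> j" using ij by auto
    then show ?thesis
      unfolding e' s(2) gen_map.simps gen_rev.simps Q1_dag_monotone[OF s(1)] gen_degree_orbit[OF s(1) ij]
      using ij by (subst gen_degree_orbit[OF delta_map_rev[OF s(1)]]) simp_all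
  qed
  then have "rig_word Q1 k x y w \<Longrightarrow> degree (map (gen_rev k) (map (gen_map (dag Q1)) w)) = degree w"
    by (induction w arbitrary: x) (auto simp: degree_simps)
  then show ?thesis using assms by (simp add: degree_rev)
qed

lemma winding_functor: "dagger_functor (dagger_rigidification Q1) E_sa winding"
proof -
  interpret Q: dagger_simplicial_set Q1 by (rule Q1_dagger)
  interpret R: dagger_simplicial_category "dagger_rigidification Q1"
    by (rule Q.dagger_rigidification_category)
  interpret E: dagger_simplicial_category E_sa by (rule E_sa_category)
  have E: "Obj E_sa = {()}" "Simp (Hom E_sa x y) n = UNIV" "act (Hom E_sa x y) m n \<alpha> f = f"
    "Comp E_sa x y z n g f = g + f" "Ident E_sa x = 0" "Dag E_sa x y n f = f" for x y z n m \<alpha> f g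
    by (simp_all add: E_sa_def)
  have Es: "simplicial_set (Hom E_sa x y)" for x y by (rule E.Hom_simplicial) (simp_all add: E)
  note cls = winding_class
  show ?thesis
    unfolding dagger_functor_def simplicial_functor_def simplicial_map_def dagger_rigidification_scat
  proof (intro conjI ballI allI impI)
    fix x y m n \<alpha> c assume c: "c \<in> Simp (Hom (rigidification Q1) x y) n" and a: "delta_map m n \<alpha>"
    then obtain w where w: "rig_word Q1 n x y w" "c = rig_class Q1 n x y w"
      unfolding Q.rig_simp_iff by blast
    show "fhom winding x y m (act (Hom (rigidification Q1) x y) m n \<alpha> c) =
        act (Hom E_sa (fobj winding x) (fobj winding y)) m n \<alpha> (fhom winding x y n c)"
      using w a by (simp add: Q.rig_act_class cls Q.rig_word_gen_act degree_gen_act E)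
  next
    fix x assume "x \<in> Simp Q1 0"
    then have "rig_word Q1 0 x x []" by simp
    then show "fhom winding x x 0 (Ident (rigidification Q1) x) = Ident E_sa (fobj winding x)"
      using cls[of 0 x x "[]"] by (simp add: rigidification_def E degree_simps)
  next
    fix x y z n c d
    assume "c \<in> Simp (Hom (rigidification Q1) x y) n" "d \<in> Simp (Hom (rigidification Q1) y z) n"
    then obtain v w where vw: "rig_word Q1 n x y v" "c = rig_class Q1 n x y v"
      "rig_word Q1 n y z w" "d = rig_class Q1 n y z w" unfolding Q.rig_simp_iff by blast
    have "rig_word Q1 n x z (v @ w)" using vw Q.rig_word_append by blast
    then show "fhom winding x z n (Comp (rigidification Q1) x y z n d c) =
       Comp E_sa (fobj winding x) (fobj winding y) (fobj winding z) n
        (fhom winding y z n d) (fhom winding x y n c)"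
      using vw by (simp add: Q.rig_Comp_class cls E degree_simps)
  next
    fix x y n c assume "c \<in> Simp (Hom (rigidification Q1) x y) n"
    then obtain w where w: "rig_word Q1 n x y w" "c = rig_class Q1 n x y w"
      unfolding Q.rig_simp_iff by blast
    show "fhom winding y x n (Dag (dagger_rigidification Q1) x y n c) =
        Dag E_sa (fobj winding x) (fobj winding y) n (fhom winding x y n c)"
      unfolding w(2) Q.dagger_rigidification_class(1)[OF w(1)]
        cls[OF Q.dagger_rigidification_class(2)[OF w(1)]] cls[OF w(1)] degree_dagger[OF w(1)] E ..
  qed (simp_all add: R.dagger_simplicial_category_axioms E.dagger_simplicial_category_axioms
      R.simplicial_category_axioms E.simplicial_category_axioms Q.rig_Hom_simplicial Es E)
qed

lemma winding_iso: "dagger_iso (dagger_rigidification Q1) E_sa winding"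
proof (rule dagger_isoI[OF winding_functor])
  interpret Q: dagger_simplicial_set Q1 by (rule Q1_dagger)
  show "bij_betw (fobj winding) (Obj (dagger_rigidification Q1)) (Obj E_sa)"
    by (simp add: dagger_rigidification_scat Q1_Simp_0 winding_def E_sa_def)
  fix x y n
  assume "x \<in> Obj (dagger_rigidification Q1)" "y \<in> Obj (dagger_rigidification Q1)"
  then have xy: "x = Q1_vertex 0" "y = Q1_vertex 0"
    by (simp_all add: dagger_rigidification_scat Q1_Simp_0)
  have "inj_on (fhom winding x y n) (Simp (Hom (rigidification Q1) x y) n)"
  proof (rule inj_onI)
    fix c d assume "c \<in> Simp (Hom (rigidification Q1) x y) n" "d \<in> Simp (Hom (rigidification Q1) x y) n"
      and e: "fhom winding x y n c = fhom winding x y n d"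
    then obtain v w where vw: "rig_word Q1 n x y v" "c = rig_class Q1 n x y v"
      "rig_word Q1 n x y w" "d = rig_class Q1 n x y w" unfolding Q.rig_simp_iff by blast
    then have "degree v = degree w" using e by (simp add: winding_class)
    then show "c = d" using vw rig_eq_iff_degree Q.rig_class_eqI by metis
  qed
  moreover have "d \<in> fhom winding x y n ` Simp (Hom (rigidification Q1) x y) n" for d
  proof (rule image_eqI)
    have w: "rig_word Q1 n x y (replicate d (loop n))" using rig_word_loops xy by simp
    show "d = fhom winding x y n (rig_class Q1 n x y (replicate d (loop n)))"
      using winding_class[OF w] by (simp add: degree_loops)
    show "rig_class Q1 n x y (replicate d (loop n)) \<in> Simp (Hom (rigidification Q1) x y) n"
      unfolding Q.rig_simp_iff using w by blast
  qed
  ultimately show "bij_betw (fhom winding x y n) (Simp (Hom (dagger_rigidification Q1) x y) n)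
      (Simp (Hom E_sa (fobj winding x) (fobj winding y)) n)"
    unfolding bij_betw_def dagger_rigidification_scat by (auto simp: E_sa_def)
qed

text \<open>
  All simplices of the boundary are degeneracies of the vertex, so each generator is an identity.
\<close>

lemma rig_eq_boundary:
  assumes "rig_word boundary_Q1 k x y w"
  shows "x = Q1_vertex 0 \<and> y = Q1_vertex 0 \<and> rig_eq boundary_Q1 k x y w []"
  using assms
proof (induction w arbitrary: x)
  case Nil
  then show ?case by (auto simp: boundary_Q1_Simp intro: rig_refl)
next
  case (Cons e w)
  interpret B: dagger_simplicial_set boundary_Q1 by (rule boundary_Q1_dagger)
  obtain n c i j T where e: "e = (n, c, i, j, T)" by (cases e)
  have c: "c \<in> Simp boundary_Q1 n" and ij: "i \<le> n" "j \<le> n"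
    and T: "T \<in> Simp (Hom (path_category n) i j) k" and x: "x = vertex boundary_Q1 n c i"
    and w: "rig_word boundary_Q1 k (vertex boundary_Q1 n c j) y w" using Cons.prems by (auto simp: e)
  have v: "vertex boundary_Q1 m d l = Q1_vertex 0" if "d \<in> Simp boundary_Q1 m" "l \<le> m" for m d l
    using B.vertex_closed[OF that] boundary_Q1_Simp by simp
  have p: "Q1_vertex 0 \<in> Simp boundary_Q1 0" by (simp add: boundary_Q1_Simp)
  have d: "delta_map n 0 (\<lambda>_. 0)" by (simp add: delta_map_def)
  have c': "act boundary_Q1 n 0 (\<lambda>_. 0) (Q1_vertex 0) = c"
    using c by (simp add: boundary_Q1_act Q1_vertex_act[OF d] boundary_Q1_Simp)
  have "T l \<noteq> {}" if "l \<le> k" for l using T that unfolding path_simp_iff by blast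
  then have T': "fhom (path_functor (\<lambda>_. 0)) i j k T = ident_at (path_category 0) 0 k"
    by (auto simp: path_functor_simp path_ident_at restrict_eq_iff)
  have "rig_eq boundary_Q1 k (Q1_vertex 0) (Q1_vertex 0) [e]
      [(0, Q1_vertex 0, 0, 0, ident_at (path_category 0) 0 k)]"
    using rig_act[OF p d ij T] by (simp only: c' T' e v[OF p le_refl])
  moreover have "rig_eq boundary_Q1 k (Q1_vertex 0) (Q1_vertex 0)
      [(0, Q1_vertex 0, 0, 0, ident_at (path_category 0) 0 k)] []"
    using rig_ident[OF p le_refl, of k] by (simp only: v[OF p le_refl])
  ultimately have "rig_eq boundary_Q1 k (Q1_vertex 0) (Q1_vertex 0) [e] []" by (rule rig_trans)
  moreover have "y = Q1_vertex 0 \<and> rig_eq boundary_Q1 k (Q1_vertex 0) y w []"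
    using Cons.IH[OF w] unfolding v[OF c ij(2)] by blast
  ultimately have "rig_eq boundary_Q1 k (Q1_vertex 0) y ([e] @ w) ([] @ [])"
    by (blast intro: rig_append)
  then show ?case using x v[OF c ij(1)] \<open>y = Q1_vertex 0 \<and> _\<close> by simp
qed

lemma boundary_hom:
  assumes "c \<in> Simp (Hom (dagger_rigidification boundary_Q1) x y) n"
  shows "x = Q1_vertex 0 \<and> y = Q1_vertex 0 \<and> c = rig_class boundary_Q1 n x x []"
proof -
  interpret B: dagger_simplicial_set boundary_Q1 by (rule boundary_Q1_dagger)
  obtain w where w: "rig_word boundary_Q1 n x y w" "c = rig_class boundary_Q1 n x y w"
    using assms unfolding dagger_rigidification_scat B.rig_simp_iff by blast
  show ?thesis using rig_eq_boundary[OF w(1)] B.rig_class_eqI w(2) by auto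
qed

lemma boundary_iso:
  "dagger_iso (dagger_rigidification boundary_Q1) terminal_dscat \<lparr>fobj = \<lambda>_. (), fhom = \<lambda>_ _ _ _. ()\<rparr>"
proof -
  interpret B: dagger_simplicial_set boundary_Q1 by (rule boundary_Q1_dagger)
  have "Simp (Hom (dagger_rigidification boundary_Q1) x y) n = {rig_class boundary_Q1 n x x []}"
    if "x \<in> Obj (dagger_rigidification boundary_Q1)" "y \<in> Obj (dagger_rigidification boundary_Q1)" for x y n
  proof -
    have "x = y" "x \<in> Simp boundary_Q1 0"
      using that by (simp_all add: dagger_rigidification_scat B.rig_Obj boundary_Q1_Simp)
    then have "rig_class boundary_Q1 n x x [] \<in> Simp (Hom (dagger_rigidification boundary_Q1) x y) n"
      unfolding dagger_rigidification_scat B.rig_simp_iff by (intro exI[of _ "[]"]) simp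
    then show ?thesis using boundary_hom by blast
  qed
  then show ?thesis
    by (intro dagger_isoI to_terminal_functor B.dagger_rigidification_category)
       (simp_all add: dagger_rigidification_scat B.rig_Obj boundary_Q1_Simp terminal_dscat_def)
qed

lemma terminal_to_E_sa_functor: "dagger_functor terminal_dscat E_sa terminal_to_E_sa"
proof -
  interpret T: dagger_simplicial_category terminal_dscat by (rule terminal_dscat_category)
  interpret E: dagger_simplicial_category E_sa by (rule E_sa_category)
  have "simplicial_set (Hom terminal_dscat () ())" "simplicial_set (Hom E_sa () ())"
    by (rule T.Hom_simplicial E.Hom_simplicial; simp add: terminal_dscat_def E_sa_def)+
  then show ?thesis
    using T.dagger_simplicial_category_axioms T.simplicial_category_axioms
      E.dagger_simplicial_category_axioms E.simplicial_category_axioms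
    by (simp add: dagger_functor_def simplicial_functor_def simplicial_map_def)
       (simp add: terminal_dscat_def E_sa_def terminal_to_E_sa_def)
qed

lemma rigidification_boundary_Q1_incl:
  "dagger_arrow_iso (dagger_rigidification boundary_Q1) (dagger_rigidification Q1)
     (rigidification_map Q1 boundary_Q1_incl) terminal_dscat E_sa terminal_to_E_sa"
proof -
  have f: "dagger_map boundary_Q1 Q1 boundary_Q1_incl"
    using boundary_Q1_incl_mono by (simp add: dagger_mono_def)
  then have m: "simplicial_map boundary_Q1 Q1 boundary_Q1_incl" by (simp add: dagger_map_def)
  have ob: "fobj (rigidification_map Q1 boundary_Q1_incl) x = x" for x
    by (simp add: rigidification_map_def boundary_Q1_incl_def)
  have "sfun_eq (dagger_rigidification boundary_Q1)
     (sfun_comp winding (rigidification_map Q1 boundary_Q1_incl))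
     (sfun_comp terminal_to_E_sa \<lparr>fobj = \<lambda>_. (), fhom = \<lambda>_ _ _ _. ()\<rparr>)"
    unfolding sfun_eq_def
  proof (intro conjI ballI allI)
    fix x y n c assume "c \<in> Simp (Hom (dagger_rigidification boundary_Q1) x y) n"
    then have c: "x = Q1_vertex 0" "y = Q1_vertex 0" "c = rig_class boundary_Q1 n x x []"
      using boundary_hom by blast+
    have "rig_word boundary_Q1 n x x []" "rig_word Q1 n x x []"
      by (simp_all add: c boundary_Q1_Simp Q1_vertex_simp)
    then have "fhom winding x y n (fhom (rigidification_map Q1 boundary_Q1_incl) x y n c) = 0"
      using rigidification_map_class(1)[OF m, of n x x "[]"] winding_class[of n x x "[]"] c
      by (simp add: boundary_Q1_incl_def degree_simps)
    then show "fhom (sfun_comp winding (rigidification_map Q1 boundary_Q1_incl)) x y n c =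
        fhom (sfun_comp terminal_to_E_sa \<lparr>fobj = \<lambda>_. (), fhom = \<lambda>_ _ _ _. ()\<rparr>) x y n c"
      by (simp add: sfun_comp_def ob terminal_to_E_sa_def)
  qed simp
  then show ?thesis
    using dagger_rigidification_functor[OF f] terminal_to_E_sa_functor boundary_iso winding_iso
    unfolding dagger_arrow_iso_def by blast
qed

section \<open>Cech nerves\<close>

lemma nth_map_upt_Suc: "i \<le> k \<Longrightarrow> map f [0..<Suc k] ! i = f i"
  by (subst nth_map) (simp_all del: upt_Suc)

text \<open>
  The setting for the Cech nerve of \<open>q\<close>, whose \<open>k\<close>-simplices are lists of \<open>k + 1\<close> elements of one fibre.
  Additivity of \<open>q\<close> and compatibility with \<open>dg\<close> and \<open>dg'\<close> ensure that sums and images under \<open>dg\<close> of such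
  lists again lie in one fibre. The injection \<open>enc\<close> places the lists of all lengths in one given
  universe \<open>'u\<close>.
\<close>

locale cech_nerve =
  fixes enc :: "'m::comm_monoid_add list \<Rightarrow> 'u" and dg :: "'m \<Rightarrow> 'm"
    and dg' :: "'n::comm_monoid_add \<Rightarrow> 'n" and q :: "'m \<Rightarrow> 'n"
  assumes inj_enc: "inj enc"
    and dg_dg: "dg (dg a) = a" and dg_add: "dg (a + b) = dg a + dg b" and dg_zero: "dg 0 = 0"
    and q_add: "q (a + b) = q a + q b" and q_dg: "q (dg a) = dg' (q a)"
begin

definition fibre_lists :: "nat \<Rightarrow> 'm list set" where
  "fibre_lists k = {s. length s = Suc k \<and> (\<exists>b. \<forall>i\<le>k. q (s ! i) = b)}"

definition dec :: "'u \<Rightarrow> 'm list" where "dec = inv enc"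

definition cech_hom :: "'u sset" where
  "cech_hom = \<lparr>Simp = (\<lambda>k. enc ` fibre_lists k),
     act = (\<lambda>m n \<alpha> c. enc (map (\<lambda>i. dec c ! \<alpha> i) [0..<Suc m]))\<rparr>"

text \<open>
  A simplicial monoid viewed as a category with one object. Commutativity turns the automorphism \<open>dg\<close>
  into a dagger, which has to reverse products.
\<close>

definition cech :: "('u, 'u) dscat" where
  "cech = \<lparr>Obj = {undefined}, Hom = (\<lambda>_ _. cech_hom),
     Comp = (\<lambda>_ _ _ _ g f. enc (map2 (+) (dec g) (dec f))),
     Ident = (\<lambda>_. enc [0]), Dag = (\<lambda>_ _ _ c. enc (map dg (dec c)))\<rparr>"

lemma dec_enc [simp]: "dec (enc s) = s"
  by (simp add: dec_def inj_enc)

lemma enc_eq_iff [simp]: "enc s = enc t \<longleftrightarrow> s = t"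
  using inj_enc by (auto dest: injD)

lemma cech_hom_Simp: "Simp cech_hom k = enc ` fibre_lists k"
  by (simp add: cech_hom_def)

lemma cech_hom_act: "act cech_hom m n \<alpha> (enc s) = enc (map (\<lambda>i. s ! \<alpha> i) [0..<Suc m])"
  by (simp add: cech_hom_def)

lemma cech_hom_simplicial_set: "simplicial_set cech_hom"
proof
  fix m n \<alpha> x assume "delta_map m n \<alpha>" "x \<in> Simp cech_hom n"
  then show "act cech_hom m n \<alpha> x \<in> Simp cech_hom m"
    by (auto simp: cech_hom_Simp cech_hom_act fibre_lists_def nth_map_upt_Suc delta_map_def
        simp del: upt_Suc)
next
  fix n x assume "x \<in> Simp cech_hom n"
  then obtain s where s: "x = enc s" "length s = Suc n" by (auto simp: cech_hom_Simp fibre_lists_def)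
  then show "act cech_hom n n (\<lambda>i. i) x = x" using map_nth[of s] by (simp add: cech_hom_act del: upt_Suc)
next
  fix k m \<beta> n \<alpha> x assume "delta_map k m \<beta>" "delta_map m n \<alpha>" "x \<in> Simp cech_hom n"
  then show "act cech_hom k n (\<lambda>i. \<alpha> (\<beta> i)) x = act cech_hom k m \<beta> (act cech_hom m n \<alpha> x)"
    by (auto simp: cech_hom_Simp cech_hom_act nth_map_upt_Suc delta_map_def simp del: upt_Suc)
qed (auto simp: cech_hom_Simp cech_hom_act)

lemma cech_simps:
  "Obj cech = {undefined}" "Hom cech x y = cech_hom"
  "Comp cech x y z n (enc t) (enc s) = enc (map2 (+) t s)"
  "Ident cech x = enc [0]" "Dag cech x y n (enc s) = enc (map dg s)"
  by (simp_all add: cech_def)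

lemma cech_ident_at: "ident_at cech x n = enc (replicate (Suc n) 0)"
  by (simp add: ident_at_def cech_simps cech_hom_act map_replicate_const del: upt_Suc replicate_Suc)

lemma cech_category: "dagger_simplicial_category cech"
proof (intro dagger_simplicial_category.intro simplicial_category.intro
    dagger_simplicial_category_axioms.intro)
  fix x y z n f g assume "f \<in> Simp (Hom cech x y) n" "g \<in> Simp (Hom cech y z) n"
  then obtain s t where st: "f = enc s" "g = enc t" "s \<in> fibre_lists n" "t \<in> fibre_lists n"
    by (auto simp: cech_simps cech_hom_Simp)
  have "map2 (+) t s \<in> fibre_lists n"
    using st(3,4) by (auto simp: fibre_lists_def q_add)
  then show "Comp cech x y z n g f \<in> Simp (Hom cech x z) n"
    by (simp add: st cech_simps cech_hom_Simp)
  show "Dag cech x z n (Comp cech x y z n g f) = Comp cech z y x n (Dag cech x y n f) (Dag cech y z n g)"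
    using st by (simp add: cech_simps fibre_lists_def list_eq_iff_nth_eq dg_add add.commute)
  fix m \<alpha> assume "delta_map m n \<alpha>"
  then have "map (\<lambda>i. map2 (+) t s ! \<alpha> i) [0..<Suc m] =
      map2 (+) (map (\<lambda>i. t ! \<alpha> i) [0..<Suc m]) (map (\<lambda>i. s ! \<alpha> i) [0..<Suc m])"
    using st(3,4) by (simp add: list_eq_iff_nth_eq fibre_lists_def delta_map_def less_Suc_eq_le
        nth_map_upt_Suc del: upt_Suc)
  then show "act (Hom cech x z) m n \<alpha> (Comp cech x y z n g f) =
      Comp cech x y z m (act (Hom cech y z) m n \<alpha> g) (act (Hom cech x y) m n \<alpha> f)"
    unfolding st cech_simps cech_hom_act by simp
next
  fix x y z w f n g h
  assume "f \<in> Simp (Hom cech x y) n" "g \<in> Simp (Hom cech y z) n" "h \<in> Simp (Hom cech z w) n"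
  then show "Comp cech x z w n h (Comp cech x y z n g f) = Comp cech x y w n (Comp cech y z w n h g) f"
    by (auto simp: cech_simps cech_hom_Simp list_eq_iff_nth_eq fibre_lists_def add.assoc)
next
  fix x y f n assume "f \<in> Simp (Hom cech x y) n"
  then show "Comp cech x x y n f (ident_at cech x n) = f" "Comp cech x y y n (ident_at cech y n) f = f"
    by (auto simp: cech_simps cech_ident_at cech_hom_Simp list_eq_iff_nth_eq fibre_lists_def simp del: replicate_Suc)
next
  fix x y
  have "map dg s \<in> fibre_lists n" if "s \<in> fibre_lists n" for s n
    using that by (auto simp: fibre_lists_def q_dg)
  moreover have "map dg (map (\<lambda>i. s ! \<alpha> i) [0..<Suc m]) = map (\<lambda>i. map dg s ! \<alpha> i) [0..<Suc m]"
    if "s \<in> fibre_lists n" "delta_map m n \<alpha>" for s m n \<alpha>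
    using that by (simp add: list_eq_iff_nth_eq fibre_lists_def delta_map_def less_Suc_eq_le
        nth_map_upt_Suc del: upt_Suc)
  ultimately show "simplicial_map (Hom cech x y) (Hom cech y x) (Dag cech x y)"
    unfolding simplicial_map_def cech_simps cech_hom_Simp
    by (auto simp: cech_hom_simplicial_set cech_hom_act cech_simps simp del: upt_Suc)
qed (auto simp: cech_simps cech_hom_simplicial_set cech_hom_Simp fibre_lists_def dg_zero dg_dg o_def)

end

text \<open>
  The Cech nerve of the identity is the target of \<open>q\<close> as a discrete simplicial monoid, since a list in a
  fibre of the identity is constant. The Cech nerve of \<open>q\<close> projects to it.
\<close>

locale cech_projection =
  M: cech_nerve enc dg dg' q + N: cech_nerve enc' dg' dg' "\<lambda>b. b"
  for enc :: "'m::comm_monoid_add list \<Rightarrow> 'u" and enc' :: "'n::comm_monoid_add list \<Rightarrow> 'u"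
    and dg dg' and q :: "'m \<Rightarrow> 'n" +
  assumes q_zero: "q 0 = 0" and q_surj: "surj q"
begin

definition proj :: "('u, 'u, 'u, 'u) sfun" where
  "proj = \<lparr>fobj = (\<lambda>x. x), fhom = (\<lambda>_ _ _ c. enc' (map q (M.dec c)))\<rparr>"

lemma proj_simplicial_map: "simplicial_map M.cech_hom N.cech_hom (fhom proj x y)"
proof -
  have "map q (map (\<lambda>i. s ! \<alpha> i) [0..<Suc m]) = map (\<lambda>i. map q s ! \<alpha> i) [0..<Suc m]"
    if "s \<in> M.fibre_lists n" "delta_map m n \<alpha>" for s m n \<alpha>
    using that by (simp add: list_eq_iff_nth_eq M.fibre_lists_def delta_map_def less_Suc_eq_le
        nth_map_upt_Suc del: upt_Suc)
  moreover have "map q s \<in> N.fibre_lists n" if "s \<in> M.fibre_lists n" for s n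
    using that by (auto simp: M.fibre_lists_def N.fibre_lists_def)
  ultimately show ?thesis
    unfolding simplicial_map_def proj_def
    by (auto simp: M.cech_hom_simplicial_set N.cech_hom_simplicial_set M.cech_hom_Simp
        N.cech_hom_Simp M.cech_hom_act N.cech_hom_act simp del: upt_Suc)
qed

lemma proj_functor: "dagger_functor M.cech N.cech proj"
proof -
  interpret MC: dagger_simplicial_category M.cech by (rule M.cech_category)
  interpret NC: dagger_simplicial_category N.cech by (rule N.cech_category)
  have p: "fobj proj x = x" "fhom proj x y n (enc s) = enc' (map q s)" for x y n s
    by (simp_all add: proj_def)
  show ?thesis
    unfolding dagger_functor_def simplicial_functor_def p(1) M.cech_simps(2) N.cech_simps(2)
  proof (intro conjI ballI allI proj_simplicial_map)
    fix x y z n f g assume "f \<in> Simp M.cech_hom n" "g \<in> Simp M.cech_hom n"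
    then show "fhom proj x z n (Comp M.cech x y z n g f) =
        Comp N.cech x y z n (fhom proj y z n g) (fhom proj x y n f)"
      by (auto simp: M.cech_hom_Simp M.cech_simps N.cech_simps p list_eq_iff_nth_eq M.q_add
          M.fibre_lists_def)
  next
    fix x y n f assume "f \<in> Simp M.cech_hom n"
    then show "fhom proj y x n (Dag M.cech x y n f) = Dag N.cech x y n (fhom proj x y n f)"
      by (auto simp: M.cech_hom_Simp M.cech_simps N.cech_simps p M.q_dg)
  qed (simp_all add: MC.dagger_simplicial_category_axioms MC.simplicial_category_axioms p q_zero
      NC.dagger_simplicial_category_axioms NC.simplicial_category_axioms M.cech_simps N.cech_simps)
qed

text \<open>
  A simplex of the Cech nerve is an arbitrary tuple of elements in one fibre, so it is determined by its
  vertices, and every choice of vertices in that fibre is allowed. For \<open>n \<ge> 1\<close> a map on the boundary of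
  the \<open>n\<close>-simplex already prescribes all vertices, which gives the filler; for \<open>n = 0\<close> the boundary is
  empty, and a vertex exists as \<open>q\<close> is surjective.
\<close>

lemma proj_trivial_kan_fibration:
  "trivial_kan_fibration M.cech_hom N.cech_hom (fhom proj x y)"
  unfolding trivial_kan_fibration_def
proof (intro conjI allI impI proj_simplicial_map, elim conjE)
  fix n u v
  assume u: "simplicial_map (std_boundary n) M.cech_hom u"
    and v: "simplicial_map (std_simplex n) N.cech_hom v"
    and e: "\<forall>k. \<forall>s\<in>Simp (std_boundary n) k. fhom proj x y k (u k s) = v k s"
  have act: "act (std_simplex n) m k \<alpha> s = restrict (\<lambda>i. s (\<alpha> i)) {..m}"
    "act (std_boundary n) m k \<alpha> s = restrict (\<lambda>i. s (\<alpha> i)) {..m}" for m k \<alpha> s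
    by (simp_all add: std_simplex_def std_boundary_def)
  have simp: "s \<in> Simp (std_simplex n) k \<longleftrightarrow> s \<in> extensional {..k} \<and> delta_map k n s" for s k
    by (simp add: std_simplex_def)
  have bd: "s \<in> Simp (std_boundary n) k \<longleftrightarrow> s \<in> Simp (std_simplex n) k \<and> s ` {..k} \<noteq> {..n}" for s k
    by (simp add: std_boundary_def)
  \<comment> \<open>By naturality \<open>v\<close> is determined by its value on the universal simplex, which is constant.\<close>
  define \<iota> where "\<iota> = restrict (\<lambda>i. i) {..n}"
  have \<iota>: "\<iota> \<in> Simp (std_simplex n) n" by (simp add: simp \<iota>_def delta_map_def)
  then have "v n \<iota> \<in> Simp N.cech_hom n" using v by (simp add: simplicial_map_def)
  then obtain t b where t: "v n \<iota> = enc' t" "\<forall>i\<le>n. t ! i = b"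
    by (auto simp: N.cech_hom_Simp N.fibre_lists_def)
  have v_const: "v k s = enc' (replicate (Suc k) b)" if s: "s \<in> Simp (std_simplex n) k" for k s
  proof -
    have d: "delta_map k n s" using s simp by blast
    have "act (std_simplex n) k n s \<iota> = restrict s {..k}"
      using d by (simp add: act \<iota>_def restrict_eq_iff delta_map_def)
    then have "v k s = v k (act (std_simplex n) k n s \<iota>)" using s by (simp add: simp extensional_restrict)
    also have "\<dots> = act N.cech_hom k n s (enc' t)"
      using v \<iota> d t(1) by (simp add: simplicial_map_def)
    also have "map (\<lambda>i. t ! s i) [0..<Suc k] = replicate (Suc k) b"
      using d t(2) by (simp add: list_eq_iff_nth_eq nth_map_upt_Suc less_Suc_eq_le delta_map_def
          del: upt_Suc replicate_Suc)
    then have "act N.cech_hom k n s (enc' t) = enc' (replicate (Suc k) b)" by (simp only: N.cech_hom_act)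
    finally show ?thesis .
  qed
  define pt :: "nat \<Rightarrow> nat \<Rightarrow> nat" where "pt j = restrict (\<lambda>_. j) {..0}" for j
  have pt: "pt j \<in> Simp (std_boundary n) 0" if "j \<le> n" "n \<noteq> 0" for j
  proof -
    have "pt j ` {..0} = {j}" by (simp add: pt_def)
    moreover have "0 \<in> {..n}" "n \<in> {..n}" by simp_all
    ultimately have "pt j ` {..0} \<noteq> {..n}" using that(2) by (metis singletonD)
    then show ?thesis using that(1) by (simp add: bd simp pt_def delta_map_def)
  qed
  \<comment> \<open>The vertices of the filler.\<close>
  define a where "a j = (if n = 0 then SOME a. q a = b else M.dec (u 0 (pt j)) ! 0)" for j
  have qa: "q (a j) = b" if "j \<le> n" for j
  proof (cases "n = 0")
    case True
    then show ?thesis using q_surj someI_ex[of "\<lambda>a. q a = b"] by (simp add: a_def) (metis surjD)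
  next
    case False
    note P = pt[OF that False]
    have "u 0 (pt j) \<in> Simp M.cech_hom 0" using u P by (simp add: simplicial_map_def)
    then obtain s where s: "u 0 (pt j) = enc s" "length s = 1"
      by (auto simp: M.cech_hom_Simp M.fibre_lists_def)
    have "fhom proj x y 0 (u 0 (pt j)) = enc' [b]" using e P v_const[of "pt j" 0] bd by simp
    then have "map q s = [b]" by (simp add: s proj_def)
    then show ?thesis using False s by (auto simp: a_def)
  qed
  define w where "w k s = enc (map (\<lambda>i. a (s i)) [0..<Suc k])" for k s
  show "\<exists>w. simplicial_map (std_simplex n) M.cech_hom w \<and>
      (\<forall>k. \<forall>s\<in>Simp (std_boundary n) k. w k s = u k s) \<and>
      (\<forall>k. \<forall>s\<in>Simp (std_simplex n) k. fhom proj x y k (w k s) = v k s)"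
  proof (intro exI conjI allI ballI)
    have "map (\<lambda>i. a (s i)) [0..<Suc k] \<in> M.fibre_lists k" if "s \<in> Simp (std_simplex n) k" for k s
      using that by (auto simp: M.fibre_lists_def nth_map_upt_Suc qa simp delta_map_def simp del: upt_Suc)
    moreover have "map (\<lambda>i. a (restrict (\<lambda>i. s (\<alpha> i)) {..m} i)) [0..<Suc m] =
        map (\<lambda>i. map (\<lambda>i. a (s i)) [0..<Suc k] ! \<alpha> i) [0..<Suc m]"
      if "delta_map m k \<alpha>" for m k \<alpha> s
      using that by (simp add: list_eq_iff_nth_eq nth_map_upt_Suc less_Suc_eq_le delta_map_def del: upt_Suc)
    moreover have "simplicial_set (std_simplex n)" using v by (simp add: simplicial_map_def)
    ultimately show "simplicial_map (std_simplex n) M.cech_hom w"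
      unfolding simplicial_map_def act w_def M.cech_hom_act M.cech_hom_Simp
      by (simp add: M.cech_hom_simplicial_set del: upt_Suc)
  next
    fix k s assume s: "s \<in> Simp (std_boundary n) k"
    then have d: "delta_map k n s" and im: "s ` {..k} \<noteq> {..n}" by (simp_all add: bd simp)
    \<comment> \<open>The \<open>0\<close>-simplex has empty boundary.\<close>
    have n: "n \<noteq> 0"
    proof
      assume "n = 0"
      then have "s ` {..k} = {..n}" using d by (auto simp: delta_map_def image_iff intro: exI[of _ 0])
      then show False using im by blast
    qed
    have "u k s \<in> Simp M.cech_hom k" using u s by (simp add: simplicial_map_def)
    then obtain r where r: "u k s = enc r" "length r = Suc k"
      by (auto simp: M.cech_hom_Simp M.fibre_lists_def)
    have "a (s i) = r ! i" if i: "i \<le> k" for i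
    proof -
      have "act (std_boundary n) 0 k (\<lambda>_. i) s = pt (s i)" by (simp add: act pt_def)
      moreover have "delta_map 0 k (\<lambda>_. i)" using i by (simp add: delta_map_def)
      ultimately have "u 0 (pt (s i)) = act M.cech_hom 0 k (\<lambda>_. i) (enc r)"
        using u s r(1) unfolding simplicial_map_def by metis
      then show ?thesis using n by (simp add: a_def M.cech_hom_act)
    qed
    then have "map (\<lambda>i. a (s i)) [0..<Suc k] = r"
      using r(2) by (simp add: list_eq_iff_nth_eq nth_map_upt_Suc less_Suc_eq_le del: upt_Suc)
    then show "w k s = u k s" by (simp only: w_def r(1))
  next
    fix k s assume s: "s \<in> Simp (std_simplex n) k"
    then have "map q (map (\<lambda>i. a (s i)) [0..<Suc k]) = replicate (Suc k) b"
      by (simp add: list_eq_iff_nth_eq nth_map_upt_Suc less_Suc_eq_le simp delta_map_def qa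
          del: upt_Suc replicate_Suc)
    then show "fhom proj x y k (w k s) = v k s"
      using v_const[OF s] by (simp add: w_def proj_def del: upt_Suc replicate_Suc)
  qed
qed

lemma proj_trivial_fibration: "dagger_trivial_fibration M.cech N.cech proj"
  using proj_functor proj_trivial_kan_fibration
  by (simp add: dagger_trivial_fibration_def M.cech_simps N.cech_simps) (simp add: proj_def)

end

section \<open>Lifting self-adjoint elements\<close>

context cech_nerve
begin

text \<open>
  The dagger functor on \<^term>\<open>E_sa\<close> that classifies the self-adjoint element \<open>b\<close>: the generator \<open>1\<close> is sent
  to \<open>b\<close>, and \<open>m\<close> to the \<open>m\<close>-fold sum of \<open>b\<close>, as a degenerate simplex.
\<close>

definition power_functor :: "'m \<Rightarrow> (unit, nat, 'u, 'u) sfun" where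
  "power_functor b = \<lparr>fobj = (\<lambda>_. undefined),
     fhom = (\<lambda>_ _ k m. enc (replicate (Suc k) (((+) b ^^ m) 0)))\<rparr>"

lemma power_functor_functor:
  assumes b: "dg b = b"
  shows "dagger_functor E_sa cech (power_functor b)"
proof -
  interpret E: dagger_simplicial_category E_sa by (rule E_sa_category)
  interpret C: dagger_simplicial_category cech by (rule cech_category)
  let ?m = "\<lambda>m. ((+) b ^^ m) 0"
  have add: "?m (m + n) = ?m m + ?m n" for m n by (induction m) (simp_all add: add.assoc)
  have dg: "dg (?m m) = ?m m" for m by (induction m) (simp_all add: dg_zero dg_add b)
  have E: "Obj E_sa = {()}" "Simp (Hom E_sa x y) n = UNIV" "act (Hom E_sa x y) m n \<alpha> f = f"
    "Comp E_sa x y z n g f = g + f" "Ident E_sa x = 0" "Dag E_sa x y n f = f" for x y z n m \<alpha> f g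
    by (simp_all add: E_sa_def)
  have "simplicial_set (Hom E_sa x y)" for x y by (rule E.Hom_simplicial) (simp_all add: E)
  moreover have "replicate (Suc n) a \<in> fibre_lists n" for n a
    by (auto simp: fibre_lists_def simp del: replicate_Suc)
  moreover have "map (\<lambda>i. replicate (Suc n) a ! \<alpha> i) [0..<Suc m] = replicate (Suc m) a"
    if "delta_map m n \<alpha>" for m n \<alpha> and a :: 'm
    using that by (simp add: list_eq_iff_nth_eq nth_map_upt_Suc less_Suc_eq_le delta_map_def
        del: upt_Suc replicate_Suc)
  moreover have "map2 (+) (replicate n a) (replicate n c) = replicate n (a + c)" for n and a c :: 'm
    by (simp add: list_eq_iff_nth_eq)
  ultimately show ?thesis
    using E.dagger_simplicial_category_axioms E.simplicial_category_axioms
      C.dagger_simplicial_category_axioms C.simplicial_category_axioms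
    by (simp add: dagger_functor_def simplicial_functor_def simplicial_map_def E cech_simps
        power_functor_def cech_hom_simplicial_set cech_hom_Simp cech_hom_act add dg
        del: upt_Suc replicate_Suc) simp
qed

end

text \<open>
  The lifting problem consists of the unit above and the classifying functor of \<open>b\<close> below. A solution
  sends the self-adjoint generator of \<^term>\<open>E_sa\<close> to a self-adjoint vertex over \<open>b\<close>.
\<close>

lemma (in cech_projection) self_adjoint_lift:
  assumes cof: "dagger_bergner_cofibration TYPE('u) terminal_dscat E_sa terminal_to_E_sa"
    and b: "dg' b = b"
  obtains a where "dg a = a" "q a = b"
proof -
  \<comment> \<open>The only functor from the terminal category, written as the restriction of a functor on \<^term>\<open>E_sa\<close>.\<close>
  let ?u = "sfun_comp (M.power_functor 0) terminal_to_E_sa"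
  have u: "dagger_functor terminal_dscat M.cech ?u"
    by (rule dagger_functor_comp[OF terminal_to_E_sa_functor M.power_functor_functor[OF M.dg_zero]])
  have "sfun_eq terminal_dscat (sfun_comp proj ?u) (sfun_comp (N.power_functor b) terminal_to_E_sa)"
    by (simp add: sfun_eq_def sfun_comp_def proj_def M.power_functor_def N.power_functor_def
        terminal_to_E_sa_def q_zero)
  then obtain w where w: "dagger_functor E_sa M.cech w"
      "sfun_eq E_sa (sfun_comp proj w) (N.power_functor b)"
    using cof proj_trivial_fibration u N.power_functor_functor[OF b]
    unfolding dagger_bergner_cofibration_def by blast
  have E: "() \<in> Obj E_sa" "1 \<in> Simp (Hom E_sa x y) n" "Dag E_sa x y n f = f" for x y n f
    by (simp_all add: E_sa_def)
  have "simplicial_map (Hom E_sa () ()) M.cech_hom (fhom w () ())"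
    using w(1) E(1) by (simp add: dagger_functor_def simplicial_functor_def M.cech_simps)
  then have "fhom w () () 0 1 \<in> Simp M.cech_hom 0" using E(2) by (simp add: simplicial_map_def)
  then obtain s where s: "fhom w () () 0 1 = enc s" "length s = 1"
    by (auto simp: M.cech_hom_Simp M.fibre_lists_def)
  then obtain a where a: "fhom w () () 0 1 = enc [a]" by (metis One_nat_def length_0_conv length_Suc_conv)
  have "fhom w () () 0 (Dag E_sa () () 0 1) = Dag M.cech (fobj w ()) (fobj w ()) 0 (fhom w () () 0 1)"
    using w(1) E(1,2) by (simp add: dagger_functor_def)
  then have "dg a = a" by (simp only: E(3) a M.cech_simps M.enc_eq_iff list.map list.inject)
  moreover have "fhom (sfun_comp proj w) () () 0 1 = fhom (N.power_functor b) () () 0 1"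
    using w(2) E(1,2) by (simp add: sfun_eq_def)
  then have "q a = b" by (simp add: sfun_comp_def proj_def a[unfolded One_nat_def] N.power_functor_def)
  ultimately show ?thesis using that by blast
qed

text \<open>
  The parity argument: pairs fixed by the swap have even sums. Lists of pairs of natural numbers are
  countable, so they can be encoded in every infinite universe.
\<close>

lemma terminal_to_E_sa_not_cofibration:
  assumes "infinite (UNIV :: 'u set)"
  shows "\<not> dagger_bergner_cofibration TYPE('u) terminal_dscat E_sa terminal_to_E_sa"
proof
  assume cof: "dagger_bergner_cofibration TYPE('u) terminal_dscat E_sa terminal_to_E_sa"
  obtain f :: "nat \<Rightarrow> 'u" where f: "inj f" using infinite_countable_subset[OF assms] by blast
  define enc :: "(nat \<times> nat) list \<Rightarrow> 'u" where "enc = f \<circ> to_nat"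
  define enc' :: "nat list \<Rightarrow> 'u" where "enc' = f \<circ> to_nat"
  have "inj enc" "inj enc'" unfolding enc_def enc'_def by (auto intro: inj_compose f)
  then interpret cech_projection enc enc' prod.swap "\<lambda>n. n" "\<lambda>a. fst a + snd a"
  proof unfold_locales
    show "surj (\<lambda>a :: nat \<times> nat. fst a + snd a)" by (rule surjI[of _ "\<lambda>n. (n, 0)"]) simp
  qed (auto simp: prod_eq_iff)
  obtain a :: "nat \<times> nat" where a: "prod.swap a = a" "fst a + snd a = 1"
    by (rule self_adjoint_lift[OF cof refl])
  have "fst a = snd a" using arg_cong[OF a(1), of snd] by (simp only: snd_swap)
  then show False using a(2) by presburger
qed

theorem proposition3p3p3:
  assumes "infinite (UNIV :: 'u set)"
  shows
    "\<not> (\<forall>(X :: (nat \<Rightarrow> nat) set dsset) (Y :: (nat \<Rightarrow> nat) set dsset) f. dagger_mono X Y f \<longrightarrow>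
          dagger_bergner_cofibration TYPE('u) (dagger_rigidification X) (dagger_rigidification Y)
            (rigidification_map Y f)) \<and>
     dagger_mono boundary_Q1 Q1 boundary_Q1_incl \<and>
     dagger_arrow_iso (dagger_rigidification boundary_Q1) (dagger_rigidification Q1)
       (rigidification_map Q1 boundary_Q1_incl)
       terminal_dscat E_sa terminal_to_E_sa \<and>
     \<not> dagger_bergner_cofibration TYPE('u) (dagger_rigidification boundary_Q1)
          (dagger_rigidification Q1) (rigidification_map Q1 boundary_Q1_incl)"
proof -
  have "\<not> dagger_bergner_cofibration TYPE('u) (dagger_rigidification boundary_Q1)
          (dagger_rigidification Q1) (rigidification_map Q1 boundary_Q1_incl)"
    using dagger_bergner_cofibration_arrow_iso rigidification_boundary_Q1_incl
      terminal_to_E_sa_not_cofibration[OF assms] by blast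
  then show ?thesis using boundary_Q1_incl_mono rigidification_boundary_Q1_incl by blast
qed

end
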